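(* Let $d\ge 2$ and suppose $g_2,\dots,g_d:[0,\infty)\to[0,\infty)$ all satisfy Conditions (A) and (B). Then there is a constant $C=C(\{g_i\})\in(0,\infty)$ such that, for all sufficiently large $t$ and any $z\in\mathbb{R}$, $$\begin{aligned}\mathcal{C}_t(\{g_i\},z)\le C\Big(&\gamma_d(t)\big(E_0[G(\zeta_{t/d}-z)1(\zeta_{t/d}\ge z)]+E_0[G'(\zeta_{t/d}-z)1(\zeta_{t/d}\ge z)]\big)^2\\&+\gamma_{d+1}(t)\,E_0[G(\zeta_{t/d}-z)1(\zeta_{t/d}\ge z)]\,E_0[\widehat G(\zeta_{t/d}-z)1(\zeta_{t/d}\ge z)]\Big).\end{aligned}$$
   Context: Exclusion process. $\{\eta_t\}_{t\ge0}$ is the symmetric simple exclusion process on $\mathbb{Z}^d$: the Markov process on $\{0,1\}^{\mathbb{Z}^d}$ with generator $\mathcal{L}_d f(\eta)=\frac{1}{2d}\sum_{x\in\mathbb{Z}^d}\sum_{|y-x|=1}\eta(x)(1-\eta(y))(f(\eta^{x,y})-f(\eta))$ for local functions $f$, where $\eta^{x,y}$ is $\eta$ with the values at $x$ and $y$ exchanged. $\mathrm{Cov}_\eta$ is the covariance under the law with $\eta_0=\eta$. Initial profiles. For $g_2,\dots,g_d:[0,\infty)\to[0,\infty)$, let $\eta_{\{g_i\}}(x)=1$ if $x_1\le 0$ and $|x_i|\le g_i(-x_1)$ for $i=2,\dots,d$, and $\eta_{\{g_i\}}(x)=0$ otherwise. $\mathcal{C}_t(\{g_i\},z)=-2\sum_{\{x,y\}}\mathrm{Cov}_{\eta_{\{g_i\}}}(\eta_t(x),\eta_t(y))$,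 the sum being over unordered pairs of distinct sites $x,y\in\mathbb{Z}^d$ with $x_1>z$ and $y_1>z$. Conditions on $g:[0,\infty)\to[0,\infty)$. (A) $g$ is nondecreasing. (B) $g$ is continuously differentiable and $\sup_{m\in\Delta(g)}\frac{|g(m)-g(m-1)|}{g'(m)}<\infty$, where $\Delta(g)=\{m\in\{1,2,\dots\}:g(m)\ne g(m-1)\}$ (in particular $g'(m)\neq 0$ for $m\in\Delta(g)$ is required; the condition is vacuous if $\Delta(g)=\varnothing$). $G(u)=\prod_{i=2}^d(2g_i(u)+1)$ and $\widehat G(u)=\int_0^u\sum_{i=2}^d\prod_{l\in\{2,\dots,d\}\setminus\{i\}}(2g_l(v)+1)\,dv$ (so $\widehat G(u)=u$ when $d=2$). $\gamma_2(t)=\sqrt t$, $\gamma_3(t)=\log t$, and $\gamma_d(t)=1$ for $d\ge 4$. $\zeta_t$ is the continuous-time simple symmetric random walk on $\mathbb{Z}$ with jump rate $1$; $P_j,E_j$ denote law and expectation with $\zeta_0=j$. Expectations of nonnegative quantities are allowed to be $+\infty$. *)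

theory Defs
  imports "HOL-Probability.Probability"
begin

section \<open>The symmetric simple exclusion process\<close>

text \<open>The lattice is \<^typ>\<open>int ^ 'n\<close>, of dimension \<^term>\<open>CARD('n)\<close>. A configuration
  in \<open>{0,1}\<close> to the power of the lattice is a Boolean function, where \<^const>\<open>True\<close> means that
  the site is occupied; the configuration space carries the product topology.\<close>

type_synonym 'n site = "int ^ 'n"
type_synonym 'n config = "int ^ 'n \<Rightarrow> bool"

text \<open>For integer vectors, Euclidean distance 1 and \<open>l\<^sup>1\<close> distance 1 are the same condition.\<close>

definition nearest_nbr :: "'n::finite site \<Rightarrow> 'n site \<Rightarrow> bool" where
  "nearest_nbr x y \<longleftrightarrow> (\<Sum>i\<in>UNIV. \<bar>y $ i - x $ i\<bar>) = 1"

definition exchange :: "'n config \<Rightarrow> 'n site \<Rightarrow> 'n site \<Rightarrow> 'n config" where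
  "exchange \<eta> x y = \<eta>(x := \<eta> y, y := \<eta> x)"

definition local_fun :: "('n config \<Rightarrow> real) \<Rightarrow> bool" where
  "local_fun f \<longleftrightarrow>
     (\<exists>A. finite A \<and> (\<forall>\<eta> \<xi>. (\<forall>x\<in>A. \<eta> x = \<xi> x) \<longrightarrow> f \<eta> = f \<xi>))"

text \<open>For a local function, only finitely many \<open>x\<close> contribute to the outer sum.\<close>

definition ssep_gen :: "('n::finite config \<Rightarrow> real) \<Rightarrow> 'n config \<Rightarrow> real" where
  "ssep_gen f \<eta> = 1 / (2 * real CARD('n)) *
     (\<Sum>\<^sub>\<infinity>x\<in>UNIV. \<Sum>y | nearest_nbr x y.
        of_bool (\<eta> x) * (1 - of_bool (\<eta> y)) * (f (exchange \<eta> x y) - f \<eta>))"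

text \<open>Transition functions of Feller processes on the configuration space whose generator acts
  on local functions as \<^const>\<open>ssep_gen\<close>. Local functions are a core for the generator of the
  exclusion process, so there is exactly one such transition function (at nonnegative times).\<close>

definition ssep_transition ::
  "(real \<Rightarrow> 'n::finite config \<Rightarrow> 'n config measure) \<Rightarrow> bool" where
  "ssep_transition P \<longleftrightarrow>
     (\<forall>t\<ge>0. P t \<in> borel \<rightarrow>\<^sub>M prob_algebra borel) \<and>
     (\<forall>\<eta>. P 0 \<eta> = return borel \<eta>) \<and>
     (\<forall>s\<ge>0. \<forall>t\<ge>0. \<forall>\<eta>. P (s + t) \<eta> = P s \<eta> \<bind> P t) \<and>
     (\<forall>f :: 'n config \<Rightarrow> real. continuous_on UNIV f \<longrightarrow>
        (\<forall>t\<ge>0. continuous_on UNIV (\<lambda>\<eta>. \<integral>\<xi>. f \<xi> \<partial>P t \<eta>)) \<and>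
        uniform_limit UNIV (\<lambda>t \<eta>. \<integral>\<xi>. f \<xi> \<partial>P t \<eta>) f (at_right 0)) \<and>
     (\<forall>f :: 'n config \<Rightarrow> real. local_fun f \<longrightarrow>
        uniform_limit UNIV (\<lambda>t \<eta>. ((\<integral>\<xi>. f \<xi> \<partial>P t \<eta>) - f \<eta>) / t) (ssep_gen f) (at_right 0))"

definition natural_filtration ::
  "'w measure \<Rightarrow> (real \<Rightarrow> 'w \<Rightarrow> 'n config) \<Rightarrow> real \<Rightarrow> 'w measure" where
  "natural_filtration M X s =
     sigma (space M) {X u -` A \<inter> space M | u A. 0 \<le> u \<and> u \<le> s \<and> A \<in> sets borel}"

text \<open>\<open>X\<close> is an exclusion process started from \<open>\<eta>\<close>, defined on the probability space \<open>M\<close>.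
  Only nonnegative times are constrained.\<close>

definition ssep_process ::
  "'w measure \<Rightarrow> (real \<Rightarrow> 'w \<Rightarrow> 'n::finite config) \<Rightarrow> 'n config \<Rightarrow> bool" where
  "ssep_process M X \<eta> \<longleftrightarrow>
     prob_space M \<and>
     (\<forall>t\<ge>0. X t \<in> M \<rightarrow>\<^sub>M borel) \<and>
     (AE \<omega> in M. X 0 \<omega> = \<eta>) \<and>
     (\<exists>P. ssep_transition P \<and>
        (\<forall>s\<ge>0. \<forall>t\<ge>0. \<forall>A\<in>sets borel. AE \<omega> in M.
           real_cond_exp M (natural_filtration M X s) (\<lambda>\<omega>'. indicator A (X (s + t) \<omega>')) \<omega>
             = measure (P t (X s \<omega>)) A))"

definition covariance :: "'w measure \<Rightarrow> ('w \<Rightarrow> real) \<Rightarrow> ('w \<Rightarrow> real) \<Rightarrow> real" where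
  "covariance M U V =
     (\<integral>\<omega>. (U \<omega> - (\<integral>\<omega>'. U \<omega>' \<partial>M)) * (V \<omega> - (\<integral>\<omega>'. V \<omega>' \<partial>M)) \<partial>M)"

text \<open>Covariance of the occupation variables at the two elements of an unordered pair.\<close>

definition pair_cov :: "'w measure \<Rightarrow> ('w \<Rightarrow> 'n config) \<Rightarrow> 'n site set \<Rightarrow> real" where
  "pair_cov M Y p = (THE c. \<exists>x y. p = {x, y} \<and>
     c = covariance M (\<lambda>\<omega>. of_bool (Y \<omega> x)) (\<lambda>\<omega>. of_bool (Y \<omega> y)))"

lemma covariance_commute: "covariance M U V = covariance M V U"
  by (simp add: covariance_def mult.commute)

lemma pair_cov_doubleton:
  "pair_cov M Y {x, y} = covariance M (\<lambda>\<omega>. of_bool (Y \<omega> x)) (\<lambda>\<omega>. of_bool (Y \<omega> y))"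
  unfolding pair_cov_def
  by (rule the_equality) (auto simp: doubleton_eq_iff covariance_commute)

text \<open>The sum is taken in the extended reals. Occupation variables of the exclusion process
  are negatively correlated, so it converges unconditionally, possibly to \<open>-\<infinity>\<close>, in
  which case the value of \<open>cov_sum\<close> is \<open>\<infinity>\<close>. The index \<open>k\<close> is the
  distinguished (first) coordinate direction.\<close>

definition cov_sum ::
  "'n \<Rightarrow> 'w measure \<Rightarrow> (real \<Rightarrow> 'w \<Rightarrow> 'n::finite config) \<Rightarrow> real \<Rightarrow> real \<Rightarrow> ereal" where
  "cov_sum k M X t z =
     - 2 * (\<Sum>\<^sub>\<infinity>p\<in>{{x, y} | x y. x \<noteq> y \<and> z < real_of_int (x $ k) \<and> z < real_of_int (y $ k)}.
              ereal (pair_cov M (X t) p))"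


section \<open>Initial profiles\<close>

text \<open>Profiles are indexed by all coordinate directions; \<open>g k\<close> is never used. They matter on
  \<open>[0,\<infinity>)\<close> only.\<close>

definition profile :: "'n \<Rightarrow> ('n \<Rightarrow> real \<Rightarrow> real) \<Rightarrow> 'n::finite config" where
  "profile k g x \<longleftrightarrow> x $ k \<le> 0 \<and>
     (\<forall>i. i \<noteq> k \<longrightarrow> \<bar>real_of_int (x $ i)\<bar> \<le> g i (- real_of_int (x $ k)))"

text \<open>Derivative of a function on \<open>[0,\<infinity>)\<close>, one-sided at 0.\<close>

definition hderiv :: "(real \<Rightarrow> real) \<Rightarrow> real \<Rightarrow> real" where
  "hderiv g u = vector_derivative g (at u within {0..})"

definition condition_A :: "(real \<Rightarrow> real) \<Rightarrow> bool" where
  "condition_A g \<longleftrightarrow> mono_on {0..} g"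

definition change_set :: "(real \<Rightarrow> real) \<Rightarrow> nat set" where
  "change_set g = {m. 1 \<le> m \<and> g (real m) \<noteq> g (real m - 1)}"

definition condition_B :: "(real \<Rightarrow> real) \<Rightarrow> bool" where
  "condition_B g \<longleftrightarrow>
     g differentiable_on {0..} \<and> continuous_on {0..} (hderiv g) \<and>
     (\<forall>m\<in>change_set g. hderiv g (real m) \<noteq> 0) \<and>
     bdd_above ((\<lambda>m. \<bar>g (real m) - g (real m - 1)\<bar> / hderiv g (real m)) ` change_set g)"

definition G_fun :: "'n::finite \<Rightarrow> ('n \<Rightarrow> real \<Rightarrow> real) \<Rightarrow> real \<Rightarrow> real" where
  "G_fun k g u = (\<Prod>i\<in>UNIV - {k}. (2 * g i u + 1))"

definition G_hat :: "'n::finite \<Rightarrow> ('n \<Rightarrow> real \<Rightarrow> real) \<Rightarrow> real \<Rightarrow> real" where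
  "G_hat k g u =
     integral {0..u} (\<lambda>v. \<Sum>i\<in>UNIV - {k}. \<Prod>l\<in>UNIV - {k} - {i}. (2 * g l v + 1))"

definition gamma_dim :: "nat \<Rightarrow> real \<Rightarrow> real" where
  "gamma_dim d t = (if d = 2 then sqrt t else if d = 3 then ln t else 1)"


section \<open>Continuous-time simple random walk on the integers\<close>

primrec srw_pmf :: "int \<Rightarrow> nat \<Rightarrow> int pmf" where
  "srw_pmf j 0 = return_pmf j"
| "srw_pmf j (Suc n) = srw_pmf j n \<bind> (\<lambda>i. pmf_of_set {i - 1, i + 1})"

text \<open>The law at time \<open>t > 0\<close> of the walk with jump rate 1 started at \<open>j\<close>: the number of jumps
  up to time \<open>t\<close> is Poisson distributed with parameter \<open>t\<close> and independent of the jumps.\<close>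

definition ctrw_pmf :: "int \<Rightarrow> real \<Rightarrow> int pmf" where
  "ctrw_pmf j t = poisson_pmf t \<bind> srw_pmf j"

text \<open>\<open>walk_exp t z h\<close> is the expectation of \<open>h (\<zeta>\<^sub>t - z) 1(\<zeta>\<^sub>t \<ge> z)\<close> for the walk \<open>\<zeta>\<close> started
  at 0, where \<open>h\<close> is nonnegative on \<open>[0,\<infinity>)\<close>.\<close>

definition walk_exp :: "real \<Rightarrow> real \<Rightarrow> (real \<Rightarrow> real) \<Rightarrow> ennreal" where
  "walk_exp t z h =
     (\<integral>\<^sup>+ m. ennreal (h (real_of_int m - z)) * indicator {z..} (real_of_int m)
        \<partial>measure_pmf (ctrw_pmf 0 t))"

end

theory Submission
  imports Defs
begin

text \<open>Let \<open>u\<^sub>s\<close> be the density profile, \<open>d\<close> the dimension, \<open>n = \<lfloor>z\<rfloor> + 1\<close> the first level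
  above \<open>z\<close> and \<open>\<tau> = t/d\<close>. The negated covariances \<open>v\<^sub>s\<close> solve the two-particle exclusion
  equation with source \<open>(u\<^sub>s(x) - u\<^sub>s(y))\<^sup>2/(2d)\<close> on neighbouring pairs; in particular
  \<open>v\<^sub>s \<ge> 0\<close>. Pairing \<open>v\<^sub>s\<close> with the product of two independent walks over the remaining
  time \<open>t - s\<close>, and using \<open>v\<^sub>s \<ge> 0\<close> for the interaction term, bounds the sum of the covariances
  by the integral over \<open>s\<close> of the sum of \<open>|u\<^sub>s(x) - u\<^sub>s(y)|\<^sup>2 h(x) h(y)\<close>, where \<open>h(x)\<close> is the
  probability that a walk started at \<open>x\<close> is above \<open>z\<close> after the time \<open>t - s\<close>. The gradient is a
  sum of heat kernels over the boundary of the profile. One factor of its square is summed, which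
  by the Markov property turns \<open>h\<close> into the same probability for the full time \<open>t\<close>; the other is
  bounded uniformly with the decay \<open>s\<^bsup>-(d-1)/2\<^esup>\<close> of the kernel in the \<open>d - 1\<close> transversal
  coordinates, or \<open>s\<^bsup>-d/2\<^esup>\<close> when the gradient itself is transversal. Integration in \<open>s\<close> produces
  \<open>\<gamma>\<^sub>d\<close> and \<open>\<gamma>\<^sub>d\<^sub>+\<^sub>1\<close>.

  In the first direction one of the two factors \<open>h\<close> is shifted by one site. For lines of the profile
  ending within distance \<open>\<tau>\<close> of level \<open>n\<close> this costs a constant factor. The remaining particles
  are so far away that their expected number above \<open>z\<close> is comparable with that at the level \<open>n\<close>
  itself, and the trivial bound \<open>v \<le> u \<otimes> u\<close> suffices for them.\<close>

section \<open>The heat semigroup of a walk on an abelian group\<close>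

text \<open>The cut at distance \<tau> comes from the recurrence
  \<open>n * kint t n = t / 2 * (kint t (n - 1) - kint t (n + 1))\<close>. Up to n = t, moving one
  site down multiplies the kernel by at most 3; beyond n = t, each site up at least halves it. So on
  one side of the cut a shifted tail is comparable with the tail, and on the other side the tail is
  comparable with the kernel.

  Covariances are not additive in the initial configuration, which is the obstacle to cutting. Their
  source is quadratic in the density, however, so (a + b)^2 \<le> 2a^2 + 2b^2 and a comparison
  principle give subadditivity up to a factor 2.

  The kernel summed along a line of the profile is the tail at the end of that line. Hence particle
  sums and sums over line ends are the same quantity, bounded by E[G]. For transversal boundaries a
  summation by parts turns tails weighted by face areas into the integrated face area, plus one more
  E[G]. The resulting \<gamma>_{d+1} E[G]^2 is absorbed by \<gamma>_{d+1} \<le> 2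
  \<gamma>_d.\<close>

text \<open>On an infinite index set a minimum need not be attained, so the bound -K is improved
  iteratively: y \<ge> -K(Lt)^n/n!, inserted into the differential inequality, yields the same with
  n + 1. The factor \<open>exp (l p * s)\<close> removes the diagonal term.\<close>

lemma evolution_nonneg:
  fixes y :: "real \<Rightarrow> 'i \<Rightarrow> real"
  assumes cont: "\<And>p. p \<in> I \<Longrightarrow> continuous_on {0..T} (\<lambda>t. y t p)"
    and der: "\<And>p t. p \<in> I \<Longrightarrow> 0 < t \<Longrightarrow> t < T \<Longrightarrow>
      \<exists>D. ((\<lambda>t. y t p) has_real_derivative D) (at t) \<and>
          (\<Sum>q\<in>N p. c p q * y t q) - l p * y t p \<le> D"
    and N: "\<And>p. p \<in> I \<Longrightarrow> N p \<subseteq> I"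
    and l: "\<And>p. p \<in> I \<Longrightarrow> 0 \<le> l p"
    and c: "\<And>p q. p \<in> I \<Longrightarrow> q \<in> N p \<Longrightarrow> 0 \<le> c p q"
    and L: "\<And>p. p \<in> I \<Longrightarrow> (\<Sum>q\<in>N p. c p q) \<le> L"
    and bnd: "\<And>p t. p \<in> I \<Longrightarrow> 0 \<le> t \<Longrightarrow> t \<le> T \<Longrightarrow> - K \<le> y t p"
    and init: "\<And>p. p \<in> I \<Longrightarrow> 0 \<le> y 0 p"
    and p: "p \<in> I" and t: "0 \<le> t" "t \<le> T"
  shows "0 \<le> y t p"
proof -
  \<comment> \<open>Truncation at 0 makes the iterates \<open>b n\<close> nonnegative whatever the
    signs of \<open>K\<close> and \<open>L\<close>.\<close>
  define L' K' where "L' = max L 0" and "K' = max K 0"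
  define b where "b n t = K' * (L' * t) ^ n / fact n" for n t
  have b0: "0 \<le> b n t" if "0 \<le> t" for n t
    using that by (simp add: b_def L'_def K'_def)
  have bder: "(b (Suc n) has_real_derivative L' * b n t) (at t)" for n t
  proof -
    have "(b (Suc n) has_real_derivative K' * (real (Suc n) * (L' * t) ^ n * L') / fact (Suc n)) (at t)"
      unfolding b_def by (rule derivative_eq_intros refl | simp del: of_nat_Suc fact_Suc)+
    then show ?thesis by (simp add: b_def field_simps del: of_nat_Suc)
  qed
  have bcont: "continuous_on S (b n)" for S n
    unfolding b_def by (intro continuous_intros) auto
  have main: "\<forall>p\<in>I. \<forall>t\<in>{0..T}. - b n t \<le> y t p" for n
  proof (induction n)
    case 0
    show ?case
    proof (intro ballI)
      fix p t assume "p \<in> I" "t \<in> {0..T}"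
      then show "- b 0 t \<le> y t p" using bnd[of p t] by (auto simp: b_def K'_def)
    qed
  next
    case (Suc n)
    show ?case
    proof (intro ballI)
      fix p t assume p: "p \<in> I" and t: "t \<in> {0..T}"
      define W where "W s = exp (l p * s) * (y s p + b (Suc n) s)" for s
      have "W 0 \<le> W t"
      proof (rule DERIV_nonneg_imp_increasing_open[where f = W])
        show "0 \<le> t" using t by simp
        show "continuous_on {0..t} W"
          unfolding W_def using t
          by (intro continuous_intros bcont continuous_on_subset[OF cont[OF p]]) auto
        fix s assume s: "0 < s" "s < t"
        then have sT: "s < T" "s \<in> {0..T}" using t by auto
        obtain D where D: "((\<lambda>t. y t p) has_real_derivative D) (at s)"
          "(\<Sum>q\<in>N p. c p q * y s q) - l p * y s p \<le> D"
          using der[OF p s(1) sT(1)] by blast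
        have "(W has_real_derivative
            exp (l p * s) * (D + l p * y s p + L' * b n s + l p * b (Suc n) s)) (at s)"
          unfolding W_def
          by (auto intro!: derivative_eq_intros D bder simp: algebra_simps)
        moreover have "0 \<le> D + l p * y s p + L' * b n s + l p * b (Suc n) s"
        proof -
          have "(\<Sum>q\<in>N p. c p q * (- b n s)) \<le> (\<Sum>q\<in>N p. c p q * y s q)"
            using Suc N[OF p] sT c[OF p] by (intro sum_mono mult_left_mono) auto
          moreover have "(\<Sum>q\<in>N p. c p q * (- b n s)) = - (sum (c p) (N p)) * b n s"
            by (simp add: sum_distrib_right sum_negf)
          moreover have "sum (c p) (N p) * b n s \<le> L' * b n s"
            using L[OF p] s b0[of s n] by (intro mult_right_mono) (auto simp: L'_def)
          moreover have "0 \<le> l p * b (Suc n) s" using l[OF p] b0 s by simp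
          ultimately show ?thesis using D(2) by linarith
        qed
        ultimately show "\<exists>z. (W has_real_derivative z) (at s) \<and> 0 \<le> z" by fastforce
      qed
      moreover have "0 \<le> W 0" using init[OF p] b0[of 0 "Suc n"] by (simp add: W_def)
      ultimately have "0 \<le> W t" by simp
      then show "- b (Suc n) t \<le> y t p" by (simp add: W_def zero_le_mult_iff not_le)
    qed
  qed
  have "(\<lambda>n. - (K' * (inverse (fact n) * (L' * t) ^ n))) \<longlonglongrightarrow> - (K' * 0)"
    by (intro tendsto_intros summable_LIMSEQ_zero[OF summable_exp])
  then have "(\<lambda>n. - b n t) \<longlonglongrightarrow> 0" by (simp add: b_def divide_inverse mult_ac)
  then show ?thesis
    by (rule LIMSEQ_le_const2) (use main p t in auto)
qed

definition avg :: "'a set \<Rightarrow> ('a::ab_group_add \<Rightarrow> real) \<Rightarrow> 'a \<Rightarrow> real" where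
  "avg E f x = (\<Sum>e\<in>E. f (x + e)) / real (card E)"

text \<open>The semigroup exp(t(A - 1)) of the rate 1 walk with steps uniform in \<open>E\<close>,
  where A is \<open>avg E\<close>. The power series in t can be differentiated term by term for
  bounded f.\<close>

definition heat :: "'a set \<Rightarrow> real \<Rightarrow> ('a::ab_group_add \<Rightarrow> real) \<Rightarrow> 'a \<Rightarrow> real" where
  "heat E t f x = exp (- t) * (\<Sum>m. ((avg E ^^ m) f x / fact m) * t ^ m)"

abbreviation ker :: "'a set \<Rightarrow> real \<Rightarrow> 'a::ab_group_add \<Rightarrow> real" where
  "ker E t \<equiv> heat E t (indicator {0})"

locale walk =
  fixes E :: "'a::ab_group_add set"
  assumes fin: "finite E" and ne: "E \<noteq> {}" and neg: "\<And>e. e \<in> E \<Longrightarrow> - e \<in> E"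
begin

lemma cardE: "real (card E) > 0"
  using fin ne by (simp add: card_gt_0_iff)

lemma avg_mono: "(\<And>x. f x \<le> g x) \<Longrightarrow> avg E f x \<le> avg E g x"
  unfolding avg_def using cardE by (intro divide_right_mono sum_mono) auto

lemma avg_const: "avg E (\<lambda>_. c) x = c"
  using cardE by (simp add: avg_def)

lemma avg_bound: "(\<And>x. \<bar>f x\<bar> \<le> K) \<Longrightarrow> \<bar>avg E f x\<bar> \<le> K"
  using avg_mono[of f "\<lambda>_. K" x] avg_mono[of "\<lambda>_. - K" f x]
  by (simp add: avg_const abs_le_iff) (metis avg_const minus_le_iff)

lemma avg_iter_Suc: "(avg E ^^ Suc m) f x = (\<Sum>e\<in>E. (avg E ^^ m) f (x + e)) / real (card E)"
  by (simp add: avg_def[of E "(avg E ^^ m) f"])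

lemma avg_iter_bound: "(\<And>x. \<bar>f x\<bar> \<le> K) \<Longrightarrow> \<bar>(avg E ^^ m) f x\<bar> \<le> K"
  by (induction m arbitrary: x) (auto intro: avg_bound)

lemma avg_iter_mono: "(\<And>x. f x \<le> g x) \<Longrightarrow> (avg E ^^ m) f x \<le> (avg E ^^ m) g x"
  by (induction m arbitrary: x) (auto intro: avg_mono)

lemma avg_iter_nonneg: "(\<And>x. 0 \<le> f x) \<Longrightarrow> 0 \<le> (avg E ^^ m) f x"
  by (induction m arbitrary: x)
     (auto simp: avg_iter_Suc simp del: funpow.simps(2) intro!: divide_nonneg_nonneg sum_nonneg)

lemma summable_heat:
  assumes "\<And>x. \<bar>f x\<bar> \<le> K"
  shows "summable (\<lambda>m. ((avg E ^^ m) f x / fact m) * t ^ m)"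
proof (rule summable_comparison_test[OF _ summable_mult[OF summable_exp[of "\<bar>t\<bar>"]]])
  have "norm ((avg E ^^ m) f x / fact m * t ^ m) \<le> K * (inverse (fact m) * \<bar>t\<bar> ^ m)" for m
    using avg_iter_bound[of f K m x, OF assms]
    by (simp add: abs_mult power_abs divide_inverse mult.assoc mult_right_mono)
  then show "\<exists>N. \<forall>n\<ge>N. norm ((avg E ^^ n) f x / fact n * t ^ n) \<le> K * (inverse (fact n) * \<bar>t\<bar> ^ n)"
    by blast
qed

lemma heat_0 [simp]: "heat E 0 f x = f x"
proof -
  have "(\<Sum>m. ((avg E ^^ m) f x / fact m) * 0 ^ m) = (\<Sum>m\<in>{0}. ((avg E ^^ m) f x / fact m) * 0 ^ m)"
    by (rule suminf_finite) auto
  then show ?thesis by (simp add: heat_def)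
qed

text \<open>\<open>diffs\<close> shifts the series by one index; the extra application of
  \<open>avg E\<close> is a finite average and commutes with the sum.\<close>

lemma heat_deriv:
  assumes "\<And>x. \<bar>f x\<bar> \<le> K"
  shows "((\<lambda>t. heat E t f x) has_real_derivative avg E (heat E t f) x - heat E t f x) (at t)"
proof -
  let ?c = "\<lambda>x m. (avg E ^^ m) f x / fact m"
  have d: "((\<lambda>t. \<Sum>m. ?c x m * t ^ m) has_real_derivative (\<Sum>m. diffs (?c x) m * t ^ m)) (at t)"
    by (rule termdiffs_strong_converges_everywhere) (rule summable_heat[OF assms])
  have "(\<Sum>m. diffs (?c x) m * t ^ m) = (\<Sum>m. (\<Sum>e\<in>E. ?c (x + e) m * t ^ m) / real (card E))"
    by (intro suminf_cong)
       (simp add: diffs_def avg_iter_Suc field_simps sum_distrib_left sum_distrib_right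
          sum_divide_distrib del: of_nat_Suc funpow.simps(2))
  also have "\<dots> = (\<Sum>m. \<Sum>e\<in>E. ?c (x + e) m * t ^ m) / real (card E)"
    by (intro suminf_divide summable_sum summable_heat[OF assms])
  also have "(\<Sum>m. \<Sum>e\<in>E. ?c (x + e) m * t ^ m) = (\<Sum>e\<in>E. \<Sum>m. ?c (x + e) m * t ^ m)"
    by (intro suminf_sum summable_heat[OF assms])
  finally have eq: "exp (- t) * (\<Sum>m. diffs (?c x) m * t ^ m) = avg E (heat E t f) x"
    unfolding avg_def[of E "heat E t f"] heat_def by (simp only: sum_distrib_left times_divide_eq_right)
  show ?thesis
    unfolding heat_def[of E _ f x] eq[symmetric]
    by (rule DERIV_cong[OF DERIV_mult[OF _ d]]) (auto intro!: derivative_eq_intros)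
qed

lemma heat_continuous:
  assumes "\<And>x. \<bar>f x\<bar> \<le> K"
  shows "continuous_on S (\<lambda>t. heat E t f x)"
  by (rule DERIV_continuous_on[OF has_field_derivative_at_within[OF heat_deriv[OF assms]]])

lemma heat_const: "heat E t (\<lambda>_. c) x = c"
proof -
  have "(avg E ^^ m) (\<lambda>_. c) = (\<lambda>_. c)" for m
    by (induction m) (auto simp: avg_const)
  then have "(\<Sum>m. ((avg E ^^ m) (\<lambda>_. c) x / fact m) * t ^ m) = c * (\<Sum>m. inverse (fact m) * t ^ m)"
    by (subst suminf_mult[symmetric, OF summable_exp]) (simp add: divide_inverse mult_ac)
  also have "\<dots> = c * exp t" by (simp add: exp_def divide_inverse mult_ac)
  finally show ?thesis by (simp add: heat_def exp_minus)
qed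

lemma heat_mono:
  assumes "0 \<le> t" "\<And>x. \<bar>f x\<bar> \<le> K" "\<And>x. \<bar>g x\<bar> \<le> K'" "\<And>x. f x \<le> g x"
  shows "heat E t f x \<le> heat E t g x"
  unfolding heat_def
  by (intro mult_left_mono suminf_le summable_heat[OF assms(2)] summable_heat[OF assms(3)]
        mult_right_mono divide_right_mono avg_iter_mono assms) (auto simp: assms)

lemma heat_bound:
  assumes "0 \<le> t" "\<And>x. \<bar>f x\<bar> \<le> K"
  shows "\<bar>heat E t f x\<bar> \<le> K"
proof -
  have "0 \<le> K" using assms(2)[of x] by linarith
  then show ?thesis
    using heat_mono[OF assms, where g = "\<lambda>_. K" and K' = K and x = x] assms(2)
      heat_mono[OF assms(1) _ assms(2), where f = "\<lambda>_. - K" and K = K and x = x]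
    by (auto simp: heat_const abs_le_iff minus_le_iff)
qed

lemma heat_nonneg:
  assumes "0 \<le> t" "\<And>x. \<bar>f x\<bar> \<le> K" "\<And>x. 0 \<le> f x"
  shows "0 \<le> heat E t f x"
  using heat_mono[OF assms(1) _ assms(2,3), of 0] by (simp add: heat_const)

lemma avg_iter_add:
  "(avg E ^^ m) (\<lambda>x. f x + c * g x) x = (avg E ^^ m) f x + c * (avg E ^^ m) g x"
proof (induction m arbitrary: x)
  case (Suc m)
  show ?case
    unfolding avg_iter_Suc Suc by (simp add: sum.distrib sum_distrib_left add_divide_distrib)
qed simp

lemma heat_add:
  assumes "\<And>x. \<bar>f x\<bar> \<le> K" "\<And>x. \<bar>g x\<bar> \<le> K'"
  shows "heat E t (\<lambda>x. f x + c * g x) x = heat E t f x + c * heat E t g x"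
proof -
  have "(\<Sum>m. (avg E ^^ m) (\<lambda>x. f x + c * g x) x / fact m * t ^ m)
     = (\<Sum>m. (avg E ^^ m) f x / fact m * t ^ m + c * ((avg E ^^ m) g x / fact m * t ^ m))"
    by (simp add: avg_iter_add field_simps)
  also have "\<dots> = (\<Sum>m. (avg E ^^ m) f x / fact m * t ^ m) + c * (\<Sum>m. (avg E ^^ m) g x / fact m * t ^ m)"
    by (subst suminf_add[symmetric, OF summable_heat[OF assms(1)]
          summable_mult[OF summable_heat[OF assms(2)]]])
       (simp only: suminf_mult[OF summable_heat[OF assms(2)]])
  finally show ?thesis by (simp add: heat_def algebra_simps)
qed

lemma heat_uminus:
  assumes "\<And>x. \<bar>f x\<bar> \<le> K"
  shows "heat E t (\<lambda>x. - f x) x = - heat E t f x"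
  using heat_add[of "\<lambda>_. 0" 0 f K t "- 1" x] assms by (simp add: heat_const)

lemma heat_abs:
  assumes t: "0 \<le> t" and f: "\<And>x. \<bar>f x\<bar> \<le> K"
  shows "\<bar>heat E t f x\<bar> \<le> heat E t (\<lambda>x. \<bar>f x\<bar>) x"
proof -
  have "heat E t f x \<le> heat E t (\<lambda>x. \<bar>f x\<bar>) x"
    by (rule heat_mono[OF t, where K = K and K' = K]) (use f in auto)
  moreover have "heat E t (\<lambda>x. - f x) x \<le> heat E t (\<lambda>x. \<bar>f x\<bar>) x"
    by (rule heat_mono[OF t, where K = K and K' = K]) (use f in auto)
  ultimately show ?thesis unfolding heat_uminus[OF f] by linarith
qed

lemma heat_translate: "heat E t (\<lambda>x. f (x + a)) x = heat E t f (x + a)"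
proof -
  have "(avg E ^^ m) (\<lambda>x. f (x + a)) x = (avg E ^^ m) f (x + a)" for m x
    by (induction m arbitrary: x) (auto simp: avg_iter_Suc ac_simps simp del: funpow.simps(2))
  then show ?thesis by (simp add: heat_def)
qed

lemma sum_neg: "(\<Sum>e\<in>E. h (- e)) = (\<Sum>e\<in>E. h e)"
  by (rule sum.reindex_bij_witness[of _ uminus uminus]) (auto simp: neg)

lemma avg_iter_reflect: "(avg E ^^ m) (\<lambda>x. f (- x)) x = (avg E ^^ m) f (- x)"
proof (induction m arbitrary: x)
  case (Suc m)
  then show ?case
    using sum_neg[of "\<lambda>e. (avg E ^^ m) f (- x + e)"]
    by (simp add: avg_iter_Suc del: funpow.simps(2))
qed simp

lemma heat_reflect: "heat E t (\<lambda>x. f (- x)) x = heat E t f (- x)"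
  by (simp add: heat_def avg_iter_reflect)

lemma ind_bound: "\<bar>indicator A x :: real\<bar> \<le> 1"
  by (simp add: indicator_def)

lemma ker_sym: "ker E t (- x) = ker E t x"
proof -
  have "(\<lambda>x::'a. indicator {0} (- x) :: real) = indicator {0}" by (auto simp: indicator_def)
  then show ?thesis using heat_reflect[of t "indicator {0}" x] by simp
qed

lemma ker_nonneg: "0 \<le> t \<Longrightarrow> 0 \<le> ker E t x"
  by (rule heat_nonneg[OF _ ind_bound]) auto

lemma ker_le_1: "0 \<le> t \<Longrightarrow> ker E t x \<le> 1"
  using heat_bound[of t "indicator {0}" 1 x] by (simp add: ind_bound)

text \<open>The difference of two bounded solutions vanishes at time 0, and
  \<open>evolution_nonneg\<close> applies to it with either sign. The semigroup property, the
  product form of the lattice kernel and the density of the exclusion process are all identified by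
  this uniqueness.\<close>

lemma heat_unique:
  assumes cont: "\<And>x. continuous_on {0..T} (\<lambda>s. y s x)"
    and der: "\<And>x s. 0 < s \<Longrightarrow> s < T \<Longrightarrow>
      ((\<lambda>s. y s x) has_real_derivative avg E (y s) x - y s x) (at s)"
    and bnd: "\<And>x s. 0 \<le> s \<Longrightarrow> s \<le> T \<Longrightarrow> \<bar>y s x\<bar> \<le> K"
    and T: "0 \<le> T"
  shows "y T x = heat E T (y 0) x"
proof -
  have b0: "\<bar>y 0 x\<bar> \<le> K" for x using bnd T by simp
  have avg_E: "avg E h x = (\<Sum>q\<in>(+) x ` E. 1 / real (card E) * h q)" for h x
    by (subst sum.reindex) (auto simp: avg_def sum_divide_distrib inj_on_def)
  have card_E: "(\<Sum>q\<in>(+) x ` E. 1 / real (card E)) \<le> 1" for x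
    by (subst sum.reindex) (use cardE in \<open>auto simp: inj_on_def\<close>)
  have *: "0 \<le> s * (y T x - heat E T (y 0) x)" if "\<bar>s\<bar> = 1" for s
  proof (rule evolution_nonneg[where I = UNIV and T = T and N = "\<lambda>x. (+) x ` E"
        and c = "\<lambda>_ _. 1 / real (card E)" and L = 1 and l = "\<lambda>_. 1" and K = "2 * K" and t = T
        and y = "\<lambda>t x. s * (y t x - heat E t (y 0) x)" and p = x])
    fix p t assume t: "0 < t" "t < T"
    have "((\<lambda>t. s * (y t p - heat E t (y 0) p)) has_real_derivative
       s * ((avg E (y t) p - y t p) - (avg E (heat E t (y 0)) p - heat E t (y 0) p))) (at t)"
      by (rule derivative_eq_intros der heat_deriv[OF b0] t refl)+ simp
    moreover have "s * ((avg E (y t) p - y t p) - (avg E (heat E t (y 0)) p - heat E t (y 0) p)) =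
        (\<Sum>q\<in>(+) p ` E. 1 / real (card E) * (s * (y t q - heat E t (y 0) q)))
          - 1 * (s * (y t p - heat E t (y 0) p))"
      by (simp add: avg_E sum_distrib_left sum_subtractf algebra_simps sum_divide_distrib)
    ultimately show "\<exists>D. ((\<lambda>t. s * (y t p - heat E t (y 0) p)) has_real_derivative D) (at t) \<and>
        (\<Sum>q\<in>(+) p ` E. 1 / real (card E) * (s * (y t q - heat E t (y 0) q)))
          - 1 * (s * (y t p - heat E t (y 0) p)) \<le> D"
      by auto
  next
    fix p t assume t: "0 \<le> t" "t \<le> T"
    have "\<bar>s * (y t p - heat E t (y 0) p)\<bar> \<le> 2 * K"
      using bnd[OF t, of p] heat_bound[OF t(1), of "y 0" K p] b0 that by (simp add: abs_mult)
    then show "- (2 * K) \<le> s * (y t p - heat E t (y 0) p)" by linarith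
  qed (use T card_E in \<open>auto intro!: continuous_intros cont heat_continuous[OF b0]\<close>)
  show ?thesis using *[of 1] *[of "- 1"] by simp
qed

lemma heat_semigroup:
  assumes "0 \<le> s" "0 \<le> t" and f: "\<And>x. \<bar>f x\<bar> \<le> K"
  shows "heat E (s + t) f x = heat E s (heat E t f) x"
proof -
  have "((\<lambda>s. heat E (s + t) f x) has_real_derivative avg E (heat E (r + t) f) x - heat E (r + t) f x) (at r)"
    for r x
    using DERIV_shift[of "\<lambda>t. heat E t f x" _ r t] heat_deriv[of f K x "r + t"] f by simp
  moreover from this have "continuous_on S (\<lambda>s. heat E (s + t) f x)" for S x
    by (rule DERIV_continuous_on[OF has_field_derivative_at_within])
  ultimately show ?thesis
    using heat_unique[where y = "\<lambda>s. heat E (s + t) f" and T = s and K = K and x = x]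
      assms heat_bound[of _ f K] by simp
qed

text \<open>For f \<ge> 0 the series increases with time and only the factor
  \<open>exp (- t)\<close> is lost. This gives a majorant on a whole time interval, which later
  makes the flux through the boundary of a large finite set small uniformly in time.\<close>

lemma ker_growth:
  assumes "0 \<le> s" "s \<le> t" "\<And>x. \<bar>f x\<bar> \<le> K" "\<And>x. 0 \<le> f x"
  shows "heat E s f x \<le> exp t * heat E t f x"
proof -
  let ?S = "\<lambda>t. (\<Sum>m. (avg E ^^ m) f x / fact m * t ^ m)"
  have le: "?S s \<le> ?S t"
    using assms by (intro suminf_le summable_heat[OF assms(3)] mult_left_mono power_mono
       divide_nonneg_nonneg avg_iter_nonneg) auto
  have "0 \<le> ?S s"
    using assms by (intro suminf_nonneg summable_heat[OF assms(3)] mult_nonneg_nonneg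
       divide_nonneg_nonneg avg_iter_nonneg) auto
  then have "exp (- s) * ?S s \<le> 1 * ?S s" using assms by (intro mult_right_mono) auto
  also have "\<dots> \<le> ?S t" using le by simp
  finally show ?thesis by (simp add: heat_def flip: mult.assoc exp_add)
qed

end

section \<open>Extended sums and the kernel representation of the semigroup\<close>

abbreviation csum :: "'a set \<Rightarrow> ('a \<Rightarrow> ennreal) \<Rightarrow> ennreal" where
  "csum A f \<equiv> (\<integral>\<^sup>+x. f x \<partial>count_space A)"

lemma csum_UNIV: "csum A f = csum UNIV (\<lambda>x. f x * indicator A x)"
  by (cases "A = UNIV") (auto simp: nn_integral_count_space_indicator)

lemma csum_swap: "csum A (\<lambda>x. csum B (f x)) = csum B (\<lambda>y. csum A (\<lambda>x. f x y))"
proof -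
  have U: "csum UNIV (\<lambda>x. csum UNIV (\<lambda>y. g x y)) = csum UNIV (\<lambda>y. csum UNIV (\<lambda>x. g x y))"
    for g :: "'a \<Rightarrow> 'b \<Rightarrow> ennreal"
    using nn_integral_fst_count_space[of "\<lambda>(x, y). g x y"] nn_integral_snd_count_space[of "\<lambda>(x, y). g x y"]
    by simp
  have "csum A (\<lambda>x. csum B (f x)) = csum UNIV (\<lambda>x. csum UNIV (\<lambda>y. f x y * indicator B y) * indicator A x)"
    by (simp add: csum_UNIV[of A] csum_UNIV[of B])
  also have "\<dots> = csum UNIV (\<lambda>x. csum UNIV (\<lambda>y. f x y * indicator B y * indicator A x))"
    by (simp add: nn_integral_multc)
  also have "\<dots> = csum UNIV (\<lambda>y. csum UNIV (\<lambda>x. f x y * indicator A x * indicator B y))"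
    by (subst U) (simp add: ac_simps)
  also have "\<dots> = csum UNIV (\<lambda>y. csum UNIV (\<lambda>x. f x y * indicator A x) * indicator B y)"
    by (simp add: nn_integral_multc)
  also have "\<dots> = csum B (\<lambda>y. csum A (\<lambda>x. f x y))"
    by (simp add: csum_UNIV[of A] csum_UNIV[of B])
  finally show ?thesis .
qed

lemma csum_translate:
  fixes a :: "'a::ab_group_add"
  shows "csum UNIV (\<lambda>x. f (x + a)) = csum UNIV f"
  by (rule nn_integral_bij_count_space)
     (rule bij_betw_byWitness[where f' = "\<lambda>x. x - a"], auto)

context walk
begin

text \<open>The symmetry of \<open>E\<close> converts a shift of the starting point x into a shift
  of the argument y - x.\<close>

lemma csum_avg_iter:
  assumes f: "\<And>x. 0 \<le> f x"
  shows "ennreal ((avg E ^^ m) f x) =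
    csum UNIV (\<lambda>y. ennreal ((avg E ^^ m) (indicator {0}) (y - x)) * ennreal (f y))"
proof (induction m arbitrary: x)
  case 0
  have "csum UNIV (\<lambda>y. ennreal (indicator {0} (y - x)) * ennreal (f y)) =
      csum UNIV (\<lambda>y. ennreal (f y) * indicator {x} y)"
    by (intro nn_integral_cong) (auto simp: indicator_def)
  also have "\<dots> = ennreal (f x)" by (simp add: nn_integral_indicator_finite)
  finally show ?case by simp
next
  case (Suc m)
  let ?a = "(avg E ^^ m) (indicator {0})" and ?c = "ennreal (1 / real (card E))"
  have a0: "0 \<le> ?a x" for x by (rule avg_iter_nonneg) auto
  have "ennreal ((avg E ^^ Suc m) f x) = ?c * (\<Sum>e\<in>E. ennreal ((avg E ^^ m) f (x + e)))"
    using avg_iter_nonneg[OF f, of m]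
    by (simp add: avg_iter_Suc sum_nonneg del: funpow.simps(2) flip: ennreal_mult)
  also have "\<dots> = ?c * (\<Sum>e\<in>E. csum UNIV (\<lambda>y. ennreal (?a (y - (x + e))) * ennreal (f y)))"
    by (simp add: Suc)
  also have "\<dots> = csum UNIV (\<lambda>y. ?c * (\<Sum>e\<in>E. ennreal (?a (y - (x + e))) * ennreal (f y)))"
    by (simp add: nn_integral_sum nn_integral_cmult)
  also have "\<dots> = csum UNIV (\<lambda>y. ennreal ((avg E ^^ Suc m) (indicator {0}) (y - x)) * ennreal (f y))"
  proof (rule nn_integral_cong)
    fix y
    have "(\<Sum>e\<in>E. ?a (y - (x + e))) = (\<Sum>e\<in>E. ?a (y - x + e))"
      using sum_neg[of "\<lambda>e. ?a (y - x + e)"] by (simp add: diff_diff_eq)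
    then have "?c * (\<Sum>e\<in>E. ennreal (?a (y - (x + e)))) = ennreal ((avg E ^^ Suc m) (indicator {0}) (y - x))"
      using a0 by (simp add: avg_iter_Suc sum_nonneg del: funpow.simps(2) flip: ennreal_mult)
    then show "?c * (\<Sum>e\<in>E. ennreal (?a (y - (x + e))) * ennreal (f y)) =
        ennreal ((avg E ^^ Suc m) (indicator {0}) (y - x)) * ennreal (f y)"
      by (metis mult.assoc sum_distrib_right)
  qed
  finally show ?case .
qed

lemma heat_csum:
  assumes "0 \<le> t" and b: "\<And>x. \<bar>f x\<bar> \<le> K" and f: "\<And>x. 0 \<le> f x"
  shows "ennreal (heat E t f x) = csum UNIV (\<lambda>y. ennreal (ker E t (y - x)) * ennreal (f y))"
proof -
  have ser: "ennreal (heat E t g x) = (\<Sum>m. ennreal (exp (- t) * t ^ m / fact m) * ennreal ((avg E ^^ m) g x))"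
    if b: "\<And>x. \<bar>g x\<bar> \<le> K" and g: "\<And>x. 0 \<le> g x" for g :: "'a \<Rightarrow> real" and K x
  proof -
    have "ennreal (heat E t g x) = ennreal (\<Sum>m. exp (- t) * ((avg E ^^ m) g x / fact m * t ^ m))"
      unfolding heat_def by (subst suminf_mult[OF summable_heat[OF b]]) simp
    also have "\<dots> = (\<Sum>m. ennreal (exp (- t) * ((avg E ^^ m) g x / fact m * t ^ m)))"
      using assms(1) g
      by (intro suminf_ennreal2[symmetric] summable_mult summable_heat[OF b] mult_nonneg_nonneg
          divide_nonneg_nonneg avg_iter_nonneg) auto
    also have "\<dots> = (\<Sum>m. ennreal (exp (- t) * t ^ m / fact m) * ennreal ((avg E ^^ m) g x))"
      using assms(1) g
      by (intro suminf_cong) (subst ennreal_mult[symmetric], auto intro!: avg_iter_nonneg arg_cong[where f = ennreal])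
    finally show ?thesis .
  qed
  have "ennreal (heat E t f x) = (\<Sum>m. csum UNIV (\<lambda>y. ennreal (exp (- t) * t ^ m / fact m) *
      ennreal ((avg E ^^ m) (indicator {0}) (y - x)) * ennreal (f y)))"
    by (simp add: ser[OF b f] csum_avg_iter[OF f] nn_integral_cmult mult.assoc)
  also have "\<dots> = csum UNIV (\<lambda>y. \<Sum>m. ennreal (exp (- t) * t ^ m / fact m) *
      ennreal ((avg E ^^ m) (indicator {0}) (y - x)) * ennreal (f y))"
    by (rule nn_integral_suminf[symmetric]) simp
  also have "\<dots> = csum UNIV (\<lambda>y. ennreal (ker E t (y - x)) * ennreal (f y))"
    by (simp add: ser[OF ind_bound] ennreal_suminf_multc)
  finally show ?thesis .
qed

lemma csum_ker: "0 \<le> t \<Longrightarrow> csum UNIV (\<lambda>y. ennreal (ker E t (y - x))) = 1"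
  using heat_csum[of t "\<lambda>_. 1" 1 x] by (simp add: heat_const)

lemma csum_ker': "0 \<le> t \<Longrightarrow> csum UNIV (\<lambda>y. ennreal (ker E t (x - y))) = 1"
  using csum_ker[of t x] ker_sym[of t "x - _"] by simp

end

section \<open>The walk on the integers\<close>

lemma walk_int: "walk {1, - 1 :: int}"
  by unfold_locales auto

interpretation Z: walk "{1, - 1 :: int}"
  by (rule walk_int)

abbreviation kint :: "real \<Rightarrow> int \<Rightarrow> real" where
  "kint \<equiv> ker {1, - 1}"

lemma avg_int: "avg {1, - 1} f (x::int) = (f (x + 1) + f (x - 1)) / 2"
  by (simp add: avg_def)

abbreviation srw :: "nat \<Rightarrow> int \<Rightarrow> real" where
  "srw m n \<equiv> (avg {1, - 1} ^^ m) (indicator {0}) n"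

lemma srw_Suc: "srw (Suc m) n = (srw m (n + 1) + srw m (n - 1)) / 2"
  by (simp add: avg_int)

lemma pmf_srw: "pmf (srw_pmf 0 m) n = srw m n"
proof (induction m arbitrary: n)
  case (Suc m)
  have "pmf (srw_pmf 0 (Suc m)) n = (\<integral>i. pmf (pmf_of_set {i - 1, i + 1}) n \<partial>srw_pmf 0 m)"
    by (simp add: pmf_bind)
  also have "\<dots> = (\<integral>i. 1 / 2 * indicator {n - 1, n + 1} i \<partial>srw_pmf 0 m)"
    by (intro Bochner_Integration.integral_cong) (auto simp: pmf_of_set indicator_def)
  also have "\<dots> = 1 / 2 * measure (srw_pmf 0 m) {n - 1, n + 1}"
    by simp
  also have "measure (srw_pmf 0 m) {n - 1, n + 1} = pmf (srw_pmf 0 m) (n - 1) + pmf (srw_pmf 0 m) (n + 1)"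
    by (subst measure_measure_pmf_finite) auto
  finally show ?case using Suc by (simp add: srw_Suc del: funpow.simps)
qed (auto simp: indicator_def)

text \<open>Links the Poisson clock of the statement with the exponential series: the Poisson
  weights are the coefficients exp(-t) t^m / m!.\<close>

lemma pmf_ctrw:
  assumes "0 < t"
  shows "pmf (ctrw_pmf 0 t) n = kint t n"
proof -
  have "ennreal (pmf (ctrw_pmf 0 t) n) = (\<integral>\<^sup>+m. ennreal (srw m n) \<partial>poisson_pmf t)"
    by (simp add: ctrw_pmf_def ennreal_pmf_bind pmf_srw del: funpow.simps)
  also have "\<dots> = csum UNIV (\<lambda>m. ennreal (t ^ m / fact m * exp (- t)) * ennreal (srw m n))"
    using assms by (simp add: nn_integral_measure_pmf del: funpow.simps)
  also have "\<dots> = (\<Sum>m. ennreal (exp (- t) * (srw m n / fact m * t ^ m)))"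
    unfolding nn_integral_count_space_nat
    by (intro suminf_cong) (subst ennreal_mult[symmetric],
      use assms in \<open>auto intro!: Z.avg_iter_nonneg arg_cong[where f = ennreal]\<close>)
  also have "\<dots> = ennreal (\<Sum>m. exp (- t) * (srw m n / fact m * t ^ m))"
    using assms
    by (intro suminf_ennreal2 summable_mult Z.summable_heat[OF Z.ind_bound] mult_nonneg_nonneg
        divide_nonneg_nonneg Z.avg_iter_nonneg) auto
  also have "(\<Sum>m. exp (- t) * (srw m n / fact m * t ^ m)) = kint t n"
    unfolding heat_def by (subst suminf_mult[OF Z.summable_heat[OF Z.ind_bound]]) simp
  finally show ?thesis using Z.ker_nonneg[of t n] assms by simp
qed

section \<open>Recurrences and pointwise bounds for the transition probabilities\<close>

text \<open>Exchangeability of the steps: given position n after m + 1 steps, each step has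
  conditional mean n/(m + 1), while the joint weight of one step and position n is (p_m(n-1) -
  p_m(n+1))/2. The formal argument is an induction on m.\<close>

lemma srw_gradient:
  "real_of_int n * srw (Suc m) n = real (Suc m) / 2 * (srw m (n - 1) - srw m (n + 1))"
proof (induction m arbitrary: n)
  case 0
  show ?case by (auto simp: avg_int indicator_def)
next
  case (Suc m)
  have "real_of_int n * srw (Suc (Suc m)) n =
     (real_of_int (n + 1) * srw (Suc m) (n + 1) + real_of_int (n - 1) * srw (Suc m) (n - 1)
       + srw (Suc m) (n - 1) - srw (Suc m) (n + 1)) / 2"
    by (subst srw_Suc) (simp add: algebra_simps add_divide_distrib diff_divide_distrib del: funpow.simps)
  also have "\<dots> = (real (Suc m) / 2 * (srw m (n - 2) - srw m (n + 2)) + srw (Suc m) (n - 1) - srw (Suc m) (n + 1)) / 2"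
    unfolding Suc by (simp add: algebra_simps del: funpow.simps)
  also have "srw m (n - 2) - srw m (n + 2) = 2 * (srw (Suc m) (n - 1) - srw (Suc m) (n + 1))"
    by (simp add: srw_Suc field_simps del: funpow.simps)
  finally show ?case by (simp add: field_simps del: funpow.simps)
qed

text \<open>The Bessel recurrence; it controls the ratios of neighbouring transition probabilities.\<close>

lemma kint_gradient: "real_of_int n * kint t n = t / 2 * (kint t (n - 1) - kint t (n + 1))"
proof -
  let ?S = "\<lambda>n. \<Sum>m. srw m n / fact m * t ^ m"
  have sm: "summable (\<lambda>m. srw m n / fact m * t ^ m)" for n
    by (rule Z.summable_heat[OF Z.ind_bound])
  have "real_of_int n * ?S n = (\<Sum>m. real_of_int n * (srw m n / fact m * t ^ m))"
    by (rule suminf_mult[symmetric, OF sm])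
  \<comment> \<open>The term m = 0 drops out, since n times the point mass at 0 vanishes.\<close>
  also have "\<dots> = (\<Sum>m. real_of_int n * (srw (Suc m) n / fact (Suc m) * t ^ Suc m))"
    using suminf_split_head[OF summable_mult[OF sm, of "real_of_int n" n]]
    by (auto simp: indicator_def simp del: fact_Suc power_Suc funpow.simps(2))
  also have "\<dots> = (\<Sum>m. t / 2 * (srw m (n - 1) / fact m * t ^ m - srw m (n + 1) / fact m * t ^ m))"
  proof (rule suminf_cong)
    fix m
    have "real_of_int n * (srw (Suc m) n / fact (Suc m) * t ^ Suc m) =
        (real_of_int n * srw (Suc m) n) / fact (Suc m) * t ^ Suc m" by simp
    also have "\<dots> = t / 2 * (srw m (n - 1) / fact m * t ^ m - srw m (n + 1) / fact m * t ^ m)"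
      unfolding srw_gradient by (simp add: field_simps del: funpow.simps of_nat_Suc)
    finally show "real_of_int n * (srw (Suc m) n / fact (Suc m) * t ^ Suc m) =
      t / 2 * (srw m (n - 1) / fact m * t ^ m - srw m (n + 1) / fact m * t ^ m)" .
  qed
  also have "\<dots> = t / 2 * (?S (n - 1) - ?S (n + 1))"
    by (subst suminf_mult[OF summable_diff[OF sm sm]], subst suminf_diff[OF sm sm]) simp
  finally have "exp (- t) * (real_of_int n * ?S n) = exp (- t) * (t / 2 * (?S (n - 1) - ?S (n + 1)))"
    by (simp only:)
  then show ?thesis unfolding heat_def by (simp only: algebra_simps)
qed

text \<open>The recurrence at n = 1 gives p_{m+2}(0) = (m+1)/(m+2) p_m(0), and (m+1)(m+3) \<le>
  (m+2)^2 propagates the claim in steps of two.\<close>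

lemma srw_return: "srw m 0 \<le> 1 / sqrt (real m + 1)"
proof (induction m rule: induct_nat_012)
  case (ge2 m)
  have sym: "srw (Suc m) (- 1) = srw (Suc m) 1"
  proof -
    have "(\<lambda>x::int. indicator {0} (- x) :: real) = indicator {0}" by (auto simp: indicator_def)
    then show ?thesis using Z.avg_iter_reflect[of "Suc m" "indicator {0}" 1] by simp
  qed
  have a: "srw (Suc (Suc m)) 0 = srw (Suc m) 1"
    using sym by (subst srw_Suc) (simp del: funpow.simps)
  have "srw m 0 = srw (Suc m) 1 * (real m + 2) / (real m + 1)"
  proof -
    have "srw m 2 = 2 * srw (Suc m) 1 - srw m 0"
      using srw_Suc[of m 1] by (simp del: funpow.simps)
    then have "srw (Suc m) 1 = (real m + 1) / 2 * (srw m 0 - (2 * srw (Suc m) 1 - srw m 0))"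
      using srw_gradient[of 1 m] by (simp add: add.commute del: funpow.simps)
    then show ?thesis by (simp add: field_simps del: funpow.simps)
  qed
  then have "srw (Suc (Suc m)) 0 = (real m + 1) / (real m + 2) * srw m 0"
    using a by (simp add: field_simps del: funpow.simps)
  also have "\<dots> \<le> (real m + 1) / (real m + 2) * (1 / sqrt (real m + 1))"
    by (intro mult_left_mono ge2) simp
  also have "\<dots> = sqrt (real m + 1) / (real m + 2)"
    by (simp add: real_div_sqrt field_simps)
  also have "\<dots> \<le> 1 / sqrt (real m + 3)"
  proof -
    have "sqrt (real m + 1) * sqrt (real m + 3) = sqrt ((real m + 1) * (real m + 3))"
      by (simp add: real_sqrt_mult)
    also have "\<dots> \<le> sqrt ((real m + 2)\<^sup>2)"
      by (intro real_sqrt_le_mono) (simp add: power2_eq_square algebra_simps)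
    finally show ?thesis by (simp add: field_simps)
  qed
  finally show ?case by (simp add: add.commute del: funpow.simps)
qed (auto simp: avg_int indicator_def)

text \<open>A Poisson mean of 1/sqrt(m+1) has to be bounded. The arithmetic-geometric mean
  inequality linearises it to half of sqrt t/(m+1) + 1/sqrt t, and the Poisson mean of 1/(m+1) is (1
  - exp(-t))/t.\<close>

lemma kint_return:
  assumes t: "0 < t"
  shows "kint t 0 \<le> 1 / sqrt t"
proof -
  have s1: "summable (\<lambda>m. t ^ m / fact m)" using summable_exp[of t] by (simp add: divide_inverse mult.commute)
  have e1: "(\<Sum>m. t ^ m / fact m) = exp t" by (simp add: exp_def divide_inverse mult.commute)
  have s2: "summable (\<lambda>m. t ^ m / fact (Suc m))"
    by (rule summable_comparison_test'[OF s1, of 0]) (use t in \<open>auto intro!: divide_left_mono fact_mono simp del: fact_Suc\<close>)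
  have e2: "t * (\<Sum>m. t ^ m / fact (Suc m)) = exp t - 1"
    using suminf_split_head[OF s1] e1 suminf_mult[OF s2, of t] by (simp del: fact_Suc)
  have "(\<Sum>m. srw m 0 / fact m * t ^ m) \<le>
     (\<Sum>m. sqrt t / 2 * (t ^ m / fact (Suc m)) + 1 / (2 * sqrt t) * (t ^ m / fact m))"
  proof (intro suminf_le Z.summable_heat[OF Z.ind_bound] summable_add summable_mult s1 s2)
    fix m
    have "1 / sqrt (real m + 1) = sqrt ((sqrt t / (real m + 1)) * (1 / sqrt t))"
      using t by (simp add: real_sqrt_divide)
    also have "\<dots> \<le> (sqrt t / (real m + 1) + 1 / sqrt t) / 2"
      using t by (intro arith_geo_mean_sqrt) auto
    finally have "srw m 0 \<le> (sqrt t / (real m + 1) + 1 / sqrt t) / 2"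
      using srw_return[of m] by linarith
    then have "srw m 0 * (t ^ m / fact m) \<le> (sqrt t / (real m + 1) + 1 / sqrt t) / 2 * (t ^ m / fact m)"
      using t by (intro mult_right_mono) auto
    also have "\<dots> = sqrt t / 2 * (t ^ m / fact m / (real m + 1)) + 1 / (2 * sqrt t) * (t ^ m / fact m)"
    proof -
      have "(a + b) / 2 * F = a / 2 * F + b / 2 * F" for a b F :: real
        by (simp add: field_simps)
      moreover have "sqrt t / (real m + 1) / 2 * F = sqrt t / 2 * (F / (real m + 1))" for F
        by simp
      moreover have "1 / sqrt t / 2 * F = 1 / (2 * sqrt t) * F" for F
        by simp
      ultimately show ?thesis by (simp only:)
    qed
    also have "t ^ m / fact m / (real m + 1) = t ^ m / fact (Suc m)"
      by (simp add: field_simps)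
    finally show "srw m 0 / fact m * t ^ m \<le> sqrt t / 2 * (t ^ m / fact (Suc m)) + 1 / (2 * sqrt t) * (t ^ m / fact m)"
      by (simp only: times_divide_eq_left times_divide_eq_right)
  qed
  also have "\<dots> = sqrt t / 2 * ((exp t - 1) / t) + 1 / (2 * sqrt t) * exp t"
  proof -
    have "(\<Sum>m. t ^ m / fact (Suc m)) = (exp t - 1) / t"
      using e2 t by (simp add: field_simps del: fact_Suc)
    then show ?thesis
      by (subst suminf_add[symmetric, OF summable_mult[OF s2] summable_mult[OF s1]])
         (simp only: suminf_mult[OF s2] suminf_mult[OF s1] e1)
  qed
  also have "\<dots> = (2 * exp t - 1) / (2 * sqrt t)"
    using t by (simp add: field_simps flip: power2_eq_square)
  also have "\<dots> \<le> exp t / sqrt t" using t by (simp add: field_simps)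
  finally have "exp (- t) * (\<Sum>m. srw m 0 / fact m * t ^ m) \<le> exp (- t) * (exp t / sqrt t)"
    by (intro mult_left_mono) auto
  then show ?thesis by (simp add: heat_def exp_minus)
qed

text \<open>The differences k(p) - k(p+1) with p \<ge> 0 solve a positivity preserving equation on
  the half-line. By symmetry of the kernel the difference at p = -1 is the negative of the one at 0,
  which raises the diagonal rate there from 1 to 3/2.\<close>

lemma kint_unimodal:
  assumes t: "0 \<le> t" and n: "0 \<le> n"
  shows "kint t (n + 1) \<le> kint t n"
proof -
  let ?y = "\<lambda>t p. kint t (int p) - kint t (int p + 1)"
  have "0 \<le> ?y t (nat n)"
  proof (rule evolution_nonneg[where I = UNIV and T = t and l = "\<lambda>p. if p = 0 then 3 / 2 else 1"
        and N = "\<lambda>p. if p = 0 then {1} else {p - 1, p + 1}" and c = "\<lambda>_ _. 1 / 2" and L = 1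
        and K = 1 and y = ?y])
    fix p :: nat and s :: real
    define D where "D = (kint s (int p + 1) + kint s (int p - 1)) / 2 - kint s (int p)
        - ((kint s (int p + 2) + kint s (int p)) / 2 - kint s (int p + 1))"
    have der: "((\<lambda>t. ?y t p) has_real_derivative
        (avg {1, - 1} (kint s) (int p) - kint s (int p)) - (avg {1, - 1} (kint s) (int p + 1) - kint s (int p + 1))) (at s)"
      by (intro DERIV_diff Z.heat_deriv[OF Z.ind_bound])
    have "((\<lambda>t. ?y t p) has_real_derivative D) (at s)"
    proof -
      have "int p + 1 + 1 = int p + 2" "int p + 1 - 1 = int p" by simp_all
      then show ?thesis using der by (simp only: avg_int D_def)
    qed
    moreover have "(\<Sum>r\<in>(if p = 0 then {1} else {p - 1, p + 1}). 1 / 2 * ?y s r)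
        - (if p = 0 then 3 / 2 else 1) * ?y s p \<le> D"
    proof (cases p)
      case 0
      then show ?thesis using Z.ker_sym[of s 1] by (simp add: D_def field_simps)
    next
      case (Suc m)
      have "(\<Sum>r\<in>{m, Suc (Suc m)}. 1 / 2 * ?y s r) = (?y s m + ?y s (Suc (Suc m))) / 2"
        by (simp add: field_simps)
      then show ?thesis using Suc by (simp add: D_def field_simps)
    qed
    ultimately show "\<exists>D. ((\<lambda>t. ?y t p) has_real_derivative D) (at s) \<and>
       (\<Sum>r\<in>(if p = 0 then {1} else {p - 1, p + 1}). 1 / 2 * ?y s r) - (if p = 0 then 3 / 2 else 1) * ?y s p \<le> D"
      by blast
  next
    fix p :: nat and s :: real assume s: "0 \<le> s"
    show "- 1 \<le> ?y s p"
      using Z.ker_nonneg[OF s, of "int p"] Z.ker_le_1[OF s, of "int p + 1"] by linarith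
  qed (use t in \<open>auto intro!: continuous_intros Z.heat_continuous[OF Z.ind_bound]\<close>)
  then show ?thesis using n by simp
qed

lemma kint_le_return:
  assumes t: "0 \<le> t"
  shows "kint t n \<le> kint t 0"
proof -
  have "kint t (int m) \<le> kint t 0" for m
  proof (induction m)
    case (Suc m)
    then show ?case using kint_unimodal[OF t, of "int m"] by (simp add: add.commute)
  qed simp
  from this[of "nat \<bar>n\<bar>"] show ?thesis
    using Z.ker_sym[of t n] by (cases "0 \<le> n") auto
qed

lemma kint_bound:
  assumes t: "0 \<le> t"
  shows "kint t n \<le> 2 / sqrt (1 + t)"
proof (cases "t \<le> 1")
  case True
  have "kint t n \<le> 1" by (rule Z.ker_le_1[OF t])
  also have "1 \<le> 2 / sqrt (1 + t)"
    using True t real_sqrt_le_mono[of "1 + t" "2\<^sup>2"] by (simp add: field_simps)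
  finally show ?thesis .
next
  case False
  have "kint t n \<le> 1 / sqrt t" using kint_le_return[OF t, of n] kint_return[of t] False by simp
  also have "\<dots> \<le> 2 / sqrt (1 + t)"
    using False real_sqrt_le_mono[of "1 + t" "2\<^sup>2 * t"] by (simp add: real_sqrt_mult field_simps)
  finally show ?thesis .
qed

lemma csum_int_split:
  "csum UNIV f = csum UNIV (\<lambda>i. f (int i)) + csum UNIV (\<lambda>i. f (- 1 - int i))"
proof -
  have "csum UNIV f = csum UNIV (\<lambda>n. f n * indicator {0..} n + f n * indicator {..<0} n)"
    by (intro nn_integral_cong) (auto simp: indicator_def)
  also have "\<dots> = csum {0..} f + csum {..<0} f"
    by (simp add: nn_integral_add csum_UNIV[of "{0..}"] csum_UNIV[of "{..<0}"])
  also have "csum {0..} f = csum UNIV (\<lambda>i. f (int i))"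
    by (rule nn_integral_bij_count_space[symmetric])
       (rule bij_betw_byWitness[where f' = nat], auto)
  also have "csum {..<0} f = csum UNIV (\<lambda>i. f (- 1 - int i))"
    by (rule nn_integral_bij_count_space[symmetric])
       (rule bij_betw_byWitness[where f' = "\<lambda>n. nat (- 1 - n)"], auto)
  finally show ?thesis .
qed

lemma kint_variation:
  assumes t: "0 \<le> t"
  shows "csum UNIV (\<lambda>n. ennreal \<bar>kint t n - kint t (n + 1)\<bar>) \<le> ennreal (2 * kint t 0)"
proof -
  have half: "(\<Sum>i. ennreal \<bar>kint t (int i) - kint t (int i + 1)\<bar>) \<le> ennreal (kint t 0)"
  proof (rule suminf_le_const)
    fix m
    have "(\<Sum>i<m. ennreal \<bar>kint t (int i) - kint t (int i + 1)\<bar>) =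
        ennreal (\<Sum>i<m. kint t (int i) - kint t (int (Suc i)))"
    proof (subst sum_ennreal[symmetric])
      show "0 \<le> kint t (int i) - kint t (int (Suc i))" for i
        using kint_unimodal[OF t, of "int i"] by (simp add: add.commute)
      then show "(\<Sum>i<m. ennreal \<bar>kint t (int i) - kint t (int i + 1)\<bar>) =
          (\<Sum>i<m. ennreal (kint t (int i) - kint t (int (Suc i))))"
        by (intro sum.cong refl) (simp add: add.commute)
    qed
    also have "(\<Sum>i<m. kint t (int i) - kint t (int (Suc i))) = kint t 0 - kint t (int m)"
      by (subst sum_lessThan_telescope') simp
    also have "ennreal \<dots> \<le> ennreal (kint t 0)"
      using Z.ker_nonneg[OF t] by (intro ennreal_leI) simp
    finally show "(\<Sum>i<m. ennreal \<bar>kint t (int i) - kint t (int i + 1)\<bar>) \<le> ennreal (kint t 0)" .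
  qed simp
  have "csum UNIV (\<lambda>n. ennreal \<bar>kint t n - kint t (n + 1)\<bar>) =
      (\<Sum>i. ennreal \<bar>kint t (int i) - kint t (int i + 1)\<bar>) + (\<Sum>i. ennreal \<bar>kint t (- 1 - int i) - kint t (- int i)\<bar>)"
    by (subst csum_int_split) (simp add: nn_integral_count_space_nat)
  also have "(\<Sum>i. ennreal \<bar>kint t (- 1 - int i) - kint t (- int i)\<bar>) = (\<Sum>i. ennreal \<bar>kint t (int i) - kint t (int i + 1)\<bar>)"
  proof (rule suminf_cong)
    fix i show "ennreal \<bar>kint t (- 1 - int i) - kint t (- int i)\<bar> = ennreal \<bar>kint t (int i) - kint t (int i + 1)\<bar>"
      using Z.ker_sym[of t "int i"] Z.ker_sym[of t "int i + 1"] by (simp add: algebra_simps abs_minus_commute)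
  qed
  also have "(\<Sum>i. ennreal \<bar>kint t (int i) - kint t (int i + 1)\<bar>) + (\<Sum>i. ennreal \<bar>kint t (int i) - kint t (int i + 1)\<bar>)
      \<le> ennreal (kint t 0) + ennreal (kint t 0)"
    by (intro add_mono half)
  also have "\<dots> = ennreal (2 * kint t 0)"
    using Z.ker_nonneg[OF t, of 0] by (simp flip: ennreal_plus)
  finally show ?thesis .
qed

text \<open>Since the kernel is unimodal, its total variation is \<open>2 * kint t 0\<close>, and by the semigroup
  property the gradient at time \<open>t\<close> is at most \<open>2 * (kint (t/2) 0)\<^sup>2\<close>.\<close>

lemma kint_gradient_bound:
  assumes t: "0 \<le> t"
  shows "\<bar>kint t n - kint t (n + 1)\<bar> \<le> 16 / (1 + t)"
proof -
  let ?s = "t / 2" and ?D = "\<lambda>x. kint (t / 2) x - kint (t / 2) (x + 1)"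
  have s: "0 \<le> ?s" using t by simp
  have qb: "\<bar>kint ?s x\<bar> \<le> 1" for x using Z.ker_nonneg[OF s] Z.ker_le_1[OF s] by simp
  have D: "\<bar>?D x\<bar> \<le> 1" for x
    using Z.ker_nonneg[OF s, of x] Z.ker_le_1[OF s, of x] Z.ker_nonneg[OF s, of "x + 1"]
      Z.ker_le_1[OF s, of "x + 1"] by linarith
  have "kint t n - kint t (n + 1) = heat {1, - 1} ?s (kint ?s) n - heat {1, - 1} ?s (kint ?s) (n + 1)"
    using Z.heat_semigroup[OF s s, of "indicator {0}" 1] Z.ind_bound by simp
  also have "\<dots> = heat {1, - 1} ?s ?D n"
    using Z.heat_add[of "kint ?s" 1 "\<lambda>x. kint ?s (x + 1)" 1 ?s "- 1" n] qb
    by (simp add: Z.heat_translate[of ?s "kint ?s" 1])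
  finally have eq: "kint t n - kint t (n + 1) = heat {1, - 1} ?s ?D n" .
  have "\<bar>kint t n - kint t (n + 1)\<bar> \<le> heat {1, - 1} ?s (\<lambda>x. \<bar>?D x\<bar>) n"
    unfolding eq by (rule Z.heat_abs[OF s D])
  then have "ennreal \<bar>kint t n - kint t (n + 1)\<bar> \<le> ennreal (heat {1, - 1} ?s (\<lambda>x. \<bar>?D x\<bar>) n)"
    by (rule ennreal_leI)
  also have "\<dots> = csum UNIV (\<lambda>y. ennreal (kint ?s (y - n)) * ennreal \<bar>?D y\<bar>)"
    by (rule Z.heat_csum[OF s, of _ 1]) (use D in auto)
  also have "\<dots> \<le> csum UNIV (\<lambda>y. ennreal (kint ?s 0) * ennreal \<bar>?D y\<bar>)"
    by (intro nn_integral_mono mult_right_mono ennreal_leI kint_le_return[OF s]) auto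
  also have "\<dots> \<le> ennreal (kint ?s 0) * ennreal (2 * kint ?s 0)"
    by (simp add: nn_integral_cmult) (intro mult_left_mono kint_variation[OF s], auto)
  also have "\<dots> = ennreal (2 * (kint ?s 0)\<^sup>2)"
    using Z.ker_nonneg[OF s, of 0] by (simp add: power2_eq_square flip: ennreal_mult)
  finally have "\<bar>kint t n - kint t (n + 1)\<bar> \<le> 2 * (kint ?s 0)\<^sup>2"
    by (subst (asm) ennreal_le_iff) auto
  also have "\<dots> \<le> 2 * (2 / sqrt (1 + ?s))\<^sup>2"
    using kint_bound[OF s, of 0] Z.ker_nonneg[OF s, of 0] by (intro mult_left_mono power_mono) auto
  also have "\<dots> = 8 / (1 + ?s)" using t by (simp add: power_divide)
  also have "\<dots> \<le> 16 / (1 + t)" using t by (simp add: field_simps)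
  finally show ?thesis .
qed

section \<open>Upper tails of the walk\<close>

text \<open>The probability that the walk from 0 is at or above j at time t. The probability h(x) of
  the overview becomes this tail at distance n - x_k and time (t - s)/d.\<close>

definition tail :: "real \<Rightarrow> int \<Rightarrow> real" where
  "tail t j = heat {1, - 1} t (indicator {j..}) 0"

lemma heat_tail: "heat {1, - 1} t (indicator {j..}) x = tail t (j - x)"
proof -
  have "heat {1, - 1} t (indicator {j..}) (0 + x) = heat {1, - 1} t (\<lambda>y. indicator {j..} (y + x)) 0"
    by (rule Z.heat_translate[symmetric])
  also have "(\<lambda>y. indicator {j..} (y + x) :: real) = indicator {j - x..}"
    by (auto simp: indicator_def)
  finally show ?thesis by (simp add: tail_def)
qed

lemma tail_nonneg: "0 \<le> t \<Longrightarrow> 0 \<le> tail t j"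
  unfolding tail_def by (rule Z.heat_nonneg[OF _ Z.ind_bound]) auto

lemma tail_csum:
  assumes t: "0 \<le> t"
  shows "ennreal (tail t j) = csum UNIV (\<lambda>i. ennreal (kint t (j + int i)))"
proof -
  have "ennreal (tail t j) = csum UNIV (\<lambda>y. ennreal (kint t (y - 0)) * ennreal (indicator {j..} y))"
    unfolding tail_def by (rule Z.heat_csum[OF t Z.ind_bound]) auto
  also have "\<dots> = csum {j..} (\<lambda>y. ennreal (kint t y))"
    by (simp add: csum_UNIV[of "{j..}"] ennreal_indicator)
  also have "\<dots> = csum UNIV (\<lambda>i. ennreal (kint t (j + int i)))"
    by (rule nn_integral_bij_count_space[symmetric])
       (rule bij_betw_byWitness[where f' = "\<lambda>n. nat (n - j)"], auto)
  finally show ?thesis .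
qed

lemma tail_step: "0 \<le> t \<Longrightarrow> tail t (j - 1) = tail t j + kint t (j - 1)"
proof -
  assume t: "0 \<le> t"
  have "(\<lambda>x. indicator {j..} x + 1 * indicator {0} (x + (1 - j)) :: real) = indicator {j - 1..}"
    by (auto simp: indicator_def)
  then have "tail t (j - 1) = heat {1, - 1} t (\<lambda>x. indicator {j..} x + 1 * indicator {0} (x + (1 - j))) 0"
    by (simp add: tail_def)
  also have "\<dots> = tail t j + kint t (1 - j)"
    by (subst Z.heat_add[OF Z.ind_bound Z.ind_bound])
       (simp add: tail_def Z.heat_translate[of t "indicator {0}" "1 - j"])
  finally show ?thesis using Z.ker_sym[of t "j - 1"] by simp
qed

lemma kint_le_tail: "0 \<le> t \<Longrightarrow> kint t j \<le> tail t j"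
  using tail_step[of t "j + 1"] tail_nonneg[of t "j + 1"] by simp

lemma tail_antimono:
  assumes "0 \<le> t" "i \<le> j"
  shows "tail t j \<le> tail t i"
  unfolding tail_def
  by (rule Z.heat_mono[OF assms(1) Z.ind_bound Z.ind_bound]) (use assms in \<open>auto simp: indicator_def\<close>)

text \<open>If one increment is at least i and an independent one at least j, their sum is at least
  i + j.\<close>

lemma tail_mult:
  assumes s: "0 \<le> s" and t: "0 \<le> t"
  shows "tail s i * tail t j \<le> tail (s + t) (i + j)"
proof -
  have tb: "\<bar>tail t k\<bar> \<le> 1" for k
    unfolding tail_def by (rule Z.heat_bound[OF t Z.ind_bound])
  have "tail s i * tail t j = heat {1, - 1} s (\<lambda>x. 0 + tail t j * indicator {i..} x) 0"
    by (subst Z.heat_add[where K = 0 and K' = 1]) (auto simp: Z.ind_bound tail_def Z.heat_const)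
  also have "\<dots> \<le> heat {1, - 1} s (\<lambda>x. tail t (i + j - x)) 0"
  proof (rule Z.heat_mono[OF s, where K = 1 and K' = 1])
    fix x
    show "\<bar>0 + tail t j * indicator {i..} x\<bar> \<le> 1" using tb[of j] by (auto simp: indicator_def)
    show "0 + tail t j * indicator {i..} x \<le> tail t (i + j - x)"
      using tail_antimono[OF t, of "i + j - x" j] tail_nonneg[OF t]
      by (auto simp: indicator_def)
  qed (rule tb)
  also have "\<dots> = tail (s + t) (i + j)"
  proof -
    have "(\<lambda>x. tail t (i + j - x)) = heat {1, - 1} t (indicator {i + j..})"
      by (simp add: heat_tail fun_eq_iff)
    then show ?thesis
      using Z.heat_semigroup[OF s t, of "indicator {i + j..}" 1 0] Z.ind_bound
      by (simp add: tail_def[of "s + t"])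
  qed
  finally show ?thesis .
qed

lemma kint_tail:
  assumes s: "0 \<le> s" and t: "0 \<le> t"
  shows "kint s i * tail t j \<le> tail (s + t) (i + j)"
  using mult_right_mono[OF kint_le_tail[OF s] tail_nonneg[OF t]] tail_mult[OF s t] by (rule order_trans)

text \<open>For 1 \<le> j \<le> t the recurrence and unimodality give k(j-1) \<le> (1 + 2j/t) k(j)
  \<le> 3 k(j); for j \<le> 0 already k(j-1) \<le> k(j). The tail gains just this one kernel value,
  which is at most 3 times the tail itself.\<close>

lemma tail_shift:
  assumes t: "0 < t" and j: "real_of_int j \<le> t"
  shows "tail t (j - 1) \<le> 4 * tail t j"
proof -
  have "kint t (j - 1) \<le> 3 * kint t j"
  proof (cases "1 \<le> j")
    case True
    have "kint t (j - 1) = kint t (j + 1) + 2 * (real_of_int j / t) * kint t j"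
      using kint_gradient[of j t] t by (simp add: field_simps)
    also have "\<dots> \<le> kint t j + 2 * 1 * kint t j"
      using True j t Z.ker_nonneg[of t j] kint_unimodal[of t j]
      by (intro add_mono mult_right_mono mult_left_mono) auto
    finally show ?thesis by simp
  next
    case False
    have "kint t (j - 1) = kint t (- j + 1)" using Z.ker_sym[of t "j - 1"] by simp
    also have "\<dots> \<le> kint t (- j)" using False t by (intro kint_unimodal) auto
    also have "\<dots> = kint t j" by (rule Z.ker_sym)
    finally show ?thesis using Z.ker_nonneg[of t j] t by linarith
  qed
  then show ?thesis using tail_step[of t j] kint_le_tail[of t j] t by simp
qed

text \<open>From level t on, the recurrence makes each kernel value at most half of the preceding
  one, so a geometric series dominates the tail.\<close>

lemma tail_far:
  assumes t: "0 < t" and j: "t \<le> real_of_int j"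
  shows "tail t j \<le> 2 * kint t j"
proof -
  have step: "kint t (k + 1) \<le> kint t k / 2" if "j \<le> k" for k
  proof -
    have "t * kint t (k + 1) \<le> real_of_int (k + 1) * kint t (k + 1)"
      using that j t Z.ker_nonneg[of t "k + 1"] by (intro mult_right_mono) auto
    also have "\<dots> = t / 2 * (kint t k - kint t (k + 2))" using kint_gradient[of "k + 1" t] by (simp add: add.assoc)
    also have "\<dots> \<le> t * (kint t k / 2)"
      using t Z.ker_nonneg[of t "k + 2"] by (simp add: field_simps)
    finally show ?thesis using t by simp
  qed
  have geo: "kint t (j + int i) \<le> kint t j * (1 / 2) ^ i" for i
  proof (induction i)
    case (Suc i)
    then show ?case using step[of "j + int i"] by (simp add: algebra_simps)
  qed simp
  have "ennreal (tail t j) = (\<Sum>i. ennreal (kint t (j + int i)))"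
    using t by (simp add: tail_csum nn_integral_count_space_nat)
  also have "\<dots> \<le> (\<Sum>i. ennreal (kint t j * (1 / 2) ^ i))"
    by (intro suminf_le ennreal_leI geo) auto
  also have "\<dots> = ennreal (\<Sum>i. kint t j * (1 / 2) ^ i)"
    using t Z.ker_nonneg[of t j] by (intro suminf_ennreal2 summable_mult summable_geometric) auto
  also have "(\<Sum>i. kint t j * (1 / 2) ^ i) = kint t j * 2"
    by (subst suminf_mult) (auto simp: suminf_geometric summable_geometric)
  finally show ?thesis using t Z.ker_nonneg[of t j] by (simp add: mult.commute)
qed

section \<open>The walk on the lattice\<close>

definition units :: "(int ^ 'n::finite) set" where
  "units = range (\<lambda>i. axis i 1) \<union> range (\<lambda>i. - axis i 1)"

lemma axis_inj: "axis i (1::int) = axis j 1 \<longleftrightarrow> i = j"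
  by (auto simp: axis_eq_axis)

lemma axis_neq: "axis i (1::int) \<noteq> - axis j 1"
proof
  assume "axis i (1::int) = - axis j 1"
  then have "axis i (1::int) $ i = (- axis j 1) $ i" by simp
  then show False by (auto simp: axis_def split: if_splits)
qed

lemma sum_units: "(\<Sum>e\<in>(units :: (int ^ 'n::finite) set). h e) = (\<Sum>i\<in>UNIV. h (axis i 1) + h (- axis i 1))"
proof -
  have "(\<Sum>e\<in>(units :: (int ^ 'n) set). h e) = (\<Sum>e\<in>range (\<lambda>i. axis i 1). h e) + (\<Sum>e\<in>range (\<lambda>i. - axis i 1). h e)"
    unfolding units_def by (rule sum.union_disjoint) (auto simp: axis_neq)
  also have "\<dots> = (\<Sum>i\<in>UNIV. h (axis i 1)) + (\<Sum>i\<in>UNIV. h (- axis i 1))"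
    by (subst (1 2) sum.reindex) (auto simp: inj_on_def axis_inj)
  finally show ?thesis by (simp add: sum.distrib)
qed

lemma card_units: "card (units :: (int ^ 'n::finite) set) = 2 * CARD('n)"
proof -
  have "(\<Sum>e\<in>(units :: (int ^ 'n) set). 1 :: nat) = (\<Sum>i\<in>(UNIV :: 'n set). 1 + 1)"
    by (rule sum_units)
  then show ?thesis by simp
qed

lemma walk_units: "walk (units :: (int ^ 'n::finite) set)"
  by unfold_locales (auto simp: units_def)

interpretation U: walk "units :: (int ^ 'n::finite) set"
  by (rule walk_units)

lemma avg_units:
  "avg units f (x :: int ^ 'n::finite) = (\<Sum>i\<in>UNIV. f (x + axis i 1) + f (x - axis i 1)) / (2 * real CARD('n))"
  by (simp add: avg_def sum_units card_units)

lemma nearest_nbr_units: "nearest_nbr x y \<longleftrightarrow> y - x \<in> (units :: (int ^ 'n::finite) set)"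
proof
  assume "nearest_nbr x y"
  define v where "v = y - x"
  have v: "(\<Sum>i\<in>UNIV. \<bar>v $ i\<bar>) = 1" using \<open>nearest_nbr x y\<close> by (simp add: nearest_nbr_def v_def)
  then obtain i where i: "v $ i \<noteq> 0" by (metis abs_zero sum.neutral zero_neq_one)
  have split: "\<bar>v $ i\<bar> + (\<Sum>j\<in>UNIV - {i}. \<bar>v $ j\<bar>) = 1"
    using v by (simp add: sum.remove[of UNIV i])
  moreover have "0 \<le> (\<Sum>j\<in>UNIV - {i}. \<bar>v $ j\<bar>)" by (intro sum_nonneg) auto
  ultimately have 1: "\<bar>v $ i\<bar> = 1" and 0: "(\<Sum>j\<in>UNIV - {i}. \<bar>v $ j\<bar>) = 0" using i by linarith+
  have "v $ j = 0" if "j \<noteq> i" for j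
    using 0 that by (subst (asm) sum_nonneg_eq_0_iff) auto
  then have "v = axis i (v $ i)" by (auto simp: vec_eq_iff axis_def)
  moreover have "v $ i = 1 \<or> v $ i = - 1" using 1 by linarith
  moreover have "axis i (- 1 :: int) = - axis i 1" by (auto simp: vec_eq_iff axis_def)
  ultimately show "y - x \<in> units" unfolding units_def v_def[symmetric] by (metis UnI1 UnI2 rangeI)
next
  assume "y - x \<in> units"
  then obtain i where "y - x = axis i 1 \<or> y - x = - axis i 1" by (auto simp: units_def)
  then have "\<bar>(y - x) $ j\<bar> = (if j = i then 1 else 0)" for j
    by (elim disjE) (simp_all only: axis_def vec_lambda_beta vector_uminus_component, simp_all)
  then show "nearest_nbr x y" by (simp add: nearest_nbr_def flip: vector_minus_component)
qed

lemma nearest_nbr_image: "{y. nearest_nbr x y} = (+) x ` units"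
proof (intro equalityI subsetI)
  fix y assume "y \<in> {y. nearest_nbr x y}"
  then show "y \<in> (+) x ` units"
    by (intro image_eqI[of _ _ "y - x"]) (simp_all add: nearest_nbr_units)
qed (auto simp: nearest_nbr_units)

lemma finite_nearest_nbr [simp]: "finite {y. nearest_nbr x y}"
  by (simp add: nearest_nbr_image U.fin)

lemma nearest_nbr_sym: "nearest_nbr x y \<longleftrightarrow> nearest_nbr y x"
  by (simp add: nearest_nbr_def abs_minus_commute)

text \<open>Only 2 of the 2d steps move coordinate k, so a function of that coordinate solves the
  one-dimensional equation slowed down by the factor d.\<close>

lemma heat_units_coordinate:
  fixes x :: "int ^ 'n::finite"
  assumes t: "0 \<le> t" and \<phi>: "\<And>m. \<bar>\<phi> m\<bar> \<le> K"
  shows "heat units t (\<lambda>x. \<phi> (x $ k)) x = heat {1, - 1} (t / real CARD('n)) \<phi> (x $ k)"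
proof -
  let ?d = "real CARD('n)"
  define y where "y s x = heat {1, - 1} (s / ?d) \<phi> (x $ k)" for s and x :: "int ^ 'n"
  have der: "((\<lambda>s. y s x) has_real_derivative avg units (y s) x - y s x) (at s)" for s x
  proof -
    let ?h = "heat {1, - 1} (s / ?d) \<phi>"
    have "((\<lambda>s. y s x) has_real_derivative (avg {1, - 1} ?h (x $ k) - ?h (x $ k)) * (1 / ?d)) (at s)"
      unfolding y_def
      by (rule DERIV_chain2[where f = "\<lambda>s. heat {1, - 1} s \<phi> (x $ k)" and g = "\<lambda>s. s / ?d"])
         (auto intro!: Z.heat_deriv[OF \<phi>] derivative_eq_intros)
    moreover have "avg units (y s) x =
        (\<Sum>i\<in>UNIV. 2 * ?h (x $ k) + (if i = k then ?h (x $ k + 1) + ?h (x $ k - 1) - 2 * ?h (x $ k) else 0)) / (2 * ?d)"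
      unfolding avg_units by (intro arg_cong2[where f = "(/)"] sum.cong) (auto simp: y_def axis_def)
    then have "avg units (y s) x = ?h (x $ k) + (?h (x $ k + 1) + ?h (x $ k - 1) - 2 * ?h (x $ k)) / (2 * ?d)"
      by (simp add: sum.distrib add_divide_distrib)
    moreover have "((a + b) / 2 - c) * (1 / ?d) = (c + (a + b - 2 * c) / (2 * ?d)) - c" for a b c
      by (simp add: field_simps)
    ultimately show ?thesis by (simp only: y_def avg_int)
  qed
  have "y t x = heat units t (y 0) x"
  proof (rule U.heat_unique[where K = K])
    show "continuous_on {0..t} (\<lambda>s. y s x)" for x
      by (rule DERIV_continuous_on[OF has_field_derivative_at_within[OF der]])
    show "\<bar>y s x\<bar> \<le> K" if "0 \<le> s" for s x
      unfolding y_def using that by (intro Z.heat_bound \<phi>) auto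
  qed (use t der in auto)
  then show ?thesis by (simp add: y_def[abs_def])
qed

text \<open>The coordinates are independent walks of rate 1/d: the product of their kernels solves
  the lattice equation with the point mass as initial value.\<close>

lemma ker_units:
  fixes x :: "int ^ 'n::finite"
  assumes t: "0 \<le> t"
  shows "ker units t x = (\<Prod>i\<in>UNIV. kint (t / real CARD('n)) (x $ i))"
proof -
  let ?d = "real CARD('n)"
  define y where "y s x = (\<Prod>i\<in>UNIV. kint (s / ?d) (x $ i))" for s and x :: "int ^ 'n"
  have der: "((\<lambda>s. y s x) has_real_derivative avg units (y s) x - y s x) (at s)" for s x
  proof -
    let ?h = "kint (s / ?d)"
    let ?P = "\<lambda>i. \<Prod>j\<in>UNIV - {i}. ?h (x $ j)"
    have "((\<lambda>s. kint (s / ?d) m) has_real_derivative ((?h (m + 1) + ?h (m - 1)) / 2 - ?h m) * (1 / ?d)) (at s)" for m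
      unfolding avg_int[symmetric]
      by (rule DERIV_chain2[where f = "\<lambda>s. kint s m" and g = "\<lambda>s. s / ?d"])
         (auto intro!: Z.heat_deriv[OF Z.ind_bound] derivative_eq_intros)
    then have hder: "((\<lambda>s. y s x) has_real_derivative
       (\<Sum>i\<in>UNIV. ((?h (x $ i + 1) + ?h (x $ i - 1)) / 2 - ?h (x $ i)) * (1 / ?d) * ?P i)) (at s)"
      unfolding y_def by (intro has_field_derivative_prod)
    \<comment> \<open>A shift along axis i affects factor i only; c = 1, -1 and 0 give the two
      neighbours and x itself.\<close>
    have hshift: "y s (x + c *s axis i 1) = ?h (x $ i + c) * ?P i" for i c
    proof -
      have "y s (x + c *s axis i 1) = ?h ((x + c *s axis i 1) $ i) * (\<Prod>j\<in>UNIV - {i}. ?h ((x + c *s axis i 1) $ j))"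
        unfolding y_def by (rule prod.remove) auto
      also have "(\<Prod>j\<in>UNIV - {i}. ?h ((x + c *s axis i 1) $ j)) = ?P i"
        by (intro prod.cong) (auto simp: axis_def)
      finally show ?thesis by (simp add: axis_def)
    qed
    have "x + - 1 *s axis i 1 = x - axis i 1" for i by (simp add: vec_eq_iff)
    note hshift[of 1] hshift[of "- 1", unfolded this] hshift[of 0]
    then
    have "y s (x + axis i 1) = ?h (x $ i + 1) * ?P i" "y s (x - axis i 1) = ?h (x $ i - 1) * ?P i"
      "y s x = ?h (x $ i) * ?P i" for i by simp_all
    note y = this
    have "y s x = (\<Sum>i\<in>(UNIV :: 'n set). y s x / ?d)" by simp
    also have "\<dots> = (\<Sum>i\<in>UNIV. ?h (x $ i) * ?P i / ?d)" using y(3) by (intro sum.cong) auto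
    finally have "avg units (y s) x - y s x = (\<Sum>i\<in>UNIV. (?h (x $ i + 1) * ?P i + ?h (x $ i - 1) * ?P i) / (2 * ?d) - ?h (x $ i) * ?P i / ?d)"
      by (simp add: avg_units y sum_subtractf sum_divide_distrib)
    also have "\<dots> = (\<Sum>i\<in>UNIV. ((?h (x $ i + 1) + ?h (x $ i - 1)) / 2 - ?h (x $ i)) * (1 / ?d) * ?P i)"
      by (intro sum.cong) (auto simp: field_simps)
    finally show ?thesis using hder by (simp only:)
  qed
  have "y t x = heat units t (y 0) x"
  proof (rule U.heat_unique[where K = 1])
    show "continuous_on {0..t} (\<lambda>s. y s x)" for x
      by (rule DERIV_continuous_on[OF has_field_derivative_at_within[OF der]])
    show "\<bar>y s x\<bar> \<le> 1" if "0 \<le> s" for s x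
      unfolding y_def using that Z.ker_le_1[of "s / ?d"] Z.ker_nonneg[of "s / ?d"]
      by (subst abs_of_nonneg) (auto intro!: prod_nonneg prod_le_1)
  qed (use t der in auto)
  moreover have "y 0 = indicator {0}"
    by (rule ext) (auto simp: y_def indicator_def vec_eq_iff)
  ultimately show ?thesis by (simp add: y_def)
qed

text \<open>A single quantity b of order s^(-1/2) such that b bounds the one-dimensional kernel at
  time s/d and b^2 its gradient. The factor 16 d comes from 16/(1 + s/d) \<le> 16 d/(1 + s) \<le>
  (16 d)^2/(1 + s).\<close>

definition step_bound :: "nat \<Rightarrow> real \<Rightarrow> real" where
  "step_bound d s = 16 * real d / sqrt (1 + s)"

lemma step_bound_nonneg: "0 \<le> step_bound d s" if "0 \<le> s"
  using that by (simp add: step_bound_def)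

lemma kint_step_bound:
  assumes s: "0 \<le> s" and d: "1 \<le> d"
  shows "kint (s / real d) m \<le> step_bound d s"
    and "\<bar>kint (s / real d) m - kint (s / real d) (m - 1)\<bar> \<le> step_bound d s ^ 2"
proof -
  have *: "(1 + s) / real d \<le> 1 + s / real d" using d by (simp add: add_divide_distrib)
  have "kint (s / real d) m \<le> 2 / sqrt (1 + s / real d)" using s by (intro kint_bound) auto
  also have "\<dots> \<le> 2 / sqrt ((1 + s) / real d)"
    using s d * by (intro divide_left_mono real_sqrt_le_mono mult_pos_pos) (auto intro!: add_pos_nonneg)
  also have "\<dots> = 2 * sqrt (real d) / sqrt (1 + s)" by (simp add: real_sqrt_divide)
  also have "\<dots> \<le> 2 * real d / sqrt (1 + s)"
    using s d sqrt_le_D[of "real d" "real d"] real_le_lsqrt[of "real d" "real d"]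
    by (intro divide_right_mono mult_left_mono) (auto simp: power2_eq_square)
  also have "\<dots> \<le> step_bound d s"
    unfolding step_bound_def using s by (intro divide_right_mono) auto
  finally show "kint (s / real d) m \<le> step_bound d s" .
  have "\<bar>kint (s / real d) m - kint (s / real d) (m - 1)\<bar> \<le> 16 / (1 + s / real d)"
    using kint_gradient_bound[of "s / real d" "m - 1"] s by (simp add: abs_minus_commute)
  also have "\<dots> \<le> 16 / ((1 + s) / real d)"
    using s d * by (intro divide_left_mono mult_pos_pos) (auto intro!: add_pos_nonneg)
  also have "\<dots> = 16 * real d / (1 + s)" by simp
  also have "\<dots> \<le> (16 * real d)\<^sup>2 / (1 + s)"
    using s d by (intro divide_right_mono) (auto simp: power2_eq_square)
  also have "\<dots> = step_bound d s ^ 2" using s by (simp add: step_bound_def power_divide)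
  finally show "\<bar>kint (s / real d) m - kint (s / real d) (m - 1)\<bar> \<le> step_bound d s ^ 2" .
qed

lemma ker_units_bound:
  fixes x :: "int ^ 'n::finite"
  assumes s: "0 \<le> s"
  shows "ker units s x \<le> step_bound CARD('n) s ^ (CARD('n) - 1) * kint (s / real CARD('n)) (x $ k)"
proof -
  let ?h = "kint (s / real CARD('n))"
  have h0: "0 \<le> ?h m" for m using s by (intro Z.ker_nonneg) auto
  have "ker units s x = ?h (x $ k) * (\<Prod>i\<in>UNIV - {k}. ?h (x $ i))"
    unfolding ker_units[OF s] by (rule prod.remove) auto
  also have "\<dots> \<le> ?h (x $ k) * (\<Prod>i\<in>UNIV - {k}. step_bound CARD('n) s)"
    using h0 kint_step_bound(1)[OF s] by (intro mult_left_mono prod_mono) (auto simp: Suc_leI)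
  finally show ?thesis by (simp add: mult.commute)
qed

text \<open>Direction i contributes a gradient b^2 and each of the other d - 2 transversal
  directions a factor b, so the exponent is d, one more than for the kernel itself.\<close>

lemma ker_units_gradient_bound:
  fixes x :: "int ^ 'n::finite"
  assumes s: "0 \<le> s" and ik: "i \<noteq> k"
  shows "\<bar>ker units s x - ker units s (x - axis i 1)\<bar>
    \<le> step_bound CARD('n) s ^ CARD('n) * kint (s / real CARD('n)) (x $ k)"
proof -
  let ?h = "kint (s / real CARD('n))" and ?b = "step_bound CARD('n) s"
  have h0: "0 \<le> ?h m" for m using s by (intro Z.ker_nonneg) auto
  have b0: "0 \<le> ?b" by (rule step_bound_nonneg[OF s])
  have card: "CARD('n) = Suc (Suc (card (UNIV - {i} - {k})))"
    using ik card_Diff_singleton[of k "UNIV - {i}"] card_Diff_singleton[of i UNIV]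
      card_gt_0_iff[of "UNIV - {i}"] by (auto simp: Suc_diff_le)
  have split: "ker units s z = ?h (z $ i) * (?h (z $ k) * (\<Prod>j\<in>UNIV - {i} - {k}. ?h (z $ j)))" for z :: "int ^ 'n"
  proof -
    have "ker units s z = ?h (z $ i) * (\<Prod>j\<in>UNIV - {i}. ?h (z $ j))"
      unfolding ker_units[OF s] by (rule prod.remove) auto
    also have "(\<Prod>j\<in>UNIV - {i}. ?h (z $ j)) = ?h (z $ k) * (\<Prod>j\<in>UNIV - {i} - {k}. ?h (z $ j))"
      using ik by (intro prod.remove) auto
    finally show ?thesis .
  qed
  let ?R = "\<Prod>j\<in>UNIV - {i} - {k}. ?h (x $ j)"
  have "(\<Prod>j\<in>UNIV - {i} - {k}. ?h ((x - axis i 1) $ j)) = ?R"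
    by (intro prod.cong) (auto simp: axis_def)
  then have "ker units s (x - axis i 1) = ?h (x $ i - 1) * (?h (x $ k) * ?R)"
    using ik by (simp add: split axis_def)
  then have "\<bar>ker units s x - ker units s (x - axis i 1)\<bar> = \<bar>?h (x $ i) - ?h (x $ i - 1)\<bar> * (?h (x $ k) * ?R)"
    using h0 by (simp add: split[of x] abs_mult prod_nonneg flip: left_diff_distrib)
  also have "\<dots> \<le> ?b ^ 2 * (?h (x $ k) * ?b ^ card (UNIV - {i} - {k}))"
  proof (intro mult_mono)
    show "?R \<le> ?b ^ card (UNIV - {i} - {k})"
      using prod_mono[of "UNIV - {i} - {k}" "\<lambda>j. ?h (x $ j)" "\<lambda>_. ?b"] h0 kint_step_bound(1)[OF s]
      by (auto simp: Suc_leI)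
  qed (use h0 b0 kint_step_bound(2)[OF s] in \<open>auto intro!: mult_nonneg_nonneg prod_nonneg simp: Suc_leI\<close>)
  also have "\<dots> = ?b ^ CARD('n) * ?h (x $ k)" by (subst card) (simp add: power2_eq_square)
  finally show ?thesis .
qed

lemma heat_units_tail:
  fixes x :: "int ^ 'n::finite"
  assumes "0 \<le> r"
  shows "heat units r (\<lambda>x. indicator {n..} (x $ k)) x = tail (r / real CARD('n)) (n - x $ k)"
  using heat_units_coordinate[OF assms, of "indicator {n..}" 1 k x] by (simp add: Z.ind_bound heat_tail)

text \<open>Markov property at time s: averaging the probability for the remaining time r over the
  position at time s gives the probability for the full time s + r.\<close>

lemma csum_ker_tail:
  fixes y :: "int ^ 'n::finite"
  assumes s: "0 \<le> s" and r: "0 \<le> r"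
  shows "csum UNIV (\<lambda>a. ennreal (ker units s (y - a)) * ennreal (tail (r / real CARD('n)) (n - a $ k)))
     = ennreal (tail ((s + r) / real CARD('n)) (n - y $ k))"
proof -
  let ?H = "\<lambda>x :: int ^ 'n. indicator {n..} (x $ k) :: real"
  have b: "\<bar>?H x\<bar> \<le> 1" for x by (rule Z.ind_bound)
  have b': "\<bar>heat units r ?H x\<bar> \<le> 1" "0 \<le> heat units r ?H x" for x
    by (rule U.heat_bound[OF r b]) (rule U.heat_nonneg[OF r b], auto)
  have "ennreal (tail ((s + r) / real CARD('n)) (n - y $ k)) = ennreal (heat units s (heat units r ?H) y)"
    using U.heat_semigroup[OF s r, of ?H 1 y] b s r heat_units_tail[of "s + r" n k y] by simp
  also have "\<dots> = csum UNIV (\<lambda>a. ennreal (ker units s (a - y)) * ennreal (heat units r ?H a))"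
    by (rule U.heat_csum[OF s b'])
  finally show ?thesis
    using U.ker_sym[of s "y - _"] by (simp add: heat_units_tail[OF r])
qed

lemma csum_Times: "csum (A \<times> B) f = csum A (\<lambda>x. csum B (\<lambda>y. f (x, y)))"
proof -
  have "csum (A \<times> B) f = csum UNIV (\<lambda>z. f z * indicator (A \<times> B) z)"
    by (rule csum_UNIV)
  also have "\<dots> = csum UNIV (\<lambda>x. csum UNIV (\<lambda>y. f (x, y) * indicator (A \<times> B) (x, y)))"
    by (rule nn_integral_fst_count_space[symmetric])
  also have "\<dots> = csum UNIV (\<lambda>x. csum UNIV (\<lambda>y. f (x, y) * indicator B y) * indicator A x)"
    by (subst nn_integral_multc[symmetric]) (auto intro!: nn_integral_cong simp: indicator_def)
  finally show ?thesis by (simp add: csum_UNIV[of A] csum_UNIV[of B])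
qed

section \<open>Downward closed configurations and their fronts\<close>

text \<open>Such a configuration is a disjoint union of half-lines in direction -e_k, each
  determined by its upper end; these ends form \<open>front\<close>.\<close>

locale downset =
  fixes k :: "'n::finite" and \<eta> :: "'n site set"
  assumes down: "y \<in> \<eta> \<Longrightarrow> y - axis k 1 \<in> \<eta>"
    and top: "y \<in> \<eta> \<Longrightarrow> y $ k \<le> 0"
begin

definition front :: "'n site set" where
  "front = {y \<in> \<eta>. y + axis k 1 \<notin> \<eta>}"

lemma down_multiple: "y \<in> \<eta> \<Longrightarrow> y - int i *s axis k 1 \<in> \<eta>"
proof (induction i)
  case (Suc i)
  have "y - int (Suc i) *s axis k 1 = (y - int i *s axis k 1) - axis k 1"
    by (simp add: vec_eq_iff algebra_simps)
  then show ?case using down[OF Suc.IH[OF Suc.prems]] by (simp only:)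
qed simp

lemma front_bij: "bij_betw (\<lambda>(y, i). y - int i *s axis k 1) (front \<times> UNIV) \<eta>"
proof -
  have ex: "\<exists>i. y + int i *s axis k 1 \<in> front" if "y \<in> \<eta>" for y
  proof -
    let ?P = "\<lambda>i. y + int i *s axis k 1 \<notin> \<eta>"
    \<comment> \<open>After \<open>nat (1 - y $ k)\<close> steps up the level is positive, hence
      outside \<eta>. The site just before the first exit belongs to the front.\<close>
    have "y $ k + int (nat (1 - y $ k)) > 0" by simp
    then have P: "?P (nat (1 - y $ k))"
      using top[of "y + int (nat (1 - y $ k)) *s axis k 1"] by (auto simp: axis_def)
    define m where "m = (LEAST i. ?P i)"
    have Pm: "?P m" unfolding m_def by (rule LeastI[of ?P, OF P])
    have "m \<noteq> 0"
    proof
      assume "m = 0"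
      with Pm that show False by simp
    qed
    then obtain i where i: "m = Suc i" by (cases m) auto
    have Pi: "y + int i *s axis k 1 \<in> \<eta>"
      using not_less_Least[of i ?P] i unfolding m_def[symmetric] by simp
    have eq: "y + int (Suc i) *s axis k 1 = (y + int i *s axis k 1) + axis k 1"
      by (simp add: vec_eq_iff algebra_simps)
    have "y + int i *s axis k 1 + axis k 1 \<notin> \<eta>"
      using Pm unfolding i eq .
    then show ?thesis using Pi unfolding front_def by blast
  qed
  have inj: "i = i' \<and> y = y'" if "y - int i *s axis k 1 = y' - int i' *s axis k 1" "y \<in> front" "y' \<in> front" for y y' i i'
  proof -
    \<comment> \<open>With i < i' the site above y lies on the half-line of y', hence in \<eta>, so
      y is not an upper end.\<close>
    have aux: False if "y - int i *s axis k 1 = y' - int i' *s axis k 1" "y \<in> front" "y' \<in> front" "i < i'" for y y' i i'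
    proof -
      have "y + axis k 1 = y' - int (i' - i - 1) *s axis k 1"
      proof (rule vec_eq_iff[THEN iffD2], rule allI)
        fix j
        define a where "a = axis k (1::int) $ j"
        have "(y - int i *s axis k 1) $ j = (y' - int i' *s axis k 1) $ j"
          by (rule arg_cong[OF that(1)])
        then have "y $ j = y' $ j - int i' * a + int i * a" by (simp add: a_def)
        moreover have "int (i' - i - 1) = int i' - int i - 1" using that(4) by simp
        ultimately show "(y + axis k 1) $ j = (y' - int (i' - i - 1) *s axis k 1) $ j"
          by (simp add: left_diff_distrib flip: a_def)
      qed
      then show False using that(2,3) down_multiple[of y' "i' - i - 1"] by (auto simp: front_def)
    qed
    have "\<not> i < i'" "\<not> i' < i"
      using aux[OF that] aux[OF that(1)[symmetric] that(3,2)] by blast+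
    then have "i = i'" by simp
    then show ?thesis using that(1) by simp
  qed
  show ?thesis
    unfolding bij_betw_def
  proof
    show "inj_on (\<lambda>(y, i). y - int i *s axis k 1) (front \<times> UNIV)"
      by (rule inj_onI) (auto dest: inj)
    show "(\<lambda>(y, i). y - int i *s axis k 1) ` (front \<times> UNIV) = \<eta>"
    proof (intro equalityI subsetI)
      fix y assume "y \<in> \<eta>"
      then obtain i where "y + int i *s axis k 1 \<in> front" using ex by blast
      then show "y \<in> (\<lambda>(y, i). y - int i *s axis k 1) ` (front \<times> UNIV)"
        by (intro image_eqI[of _ _ "(y + int i *s axis k 1, i)"]) auto
    qed (auto simp: front_def intro: down_multiple)
  qed
qed

text \<open>Along each half-line the kernel values add up to the tail at its upper end.\<close>

lemma csum_front:
  assumes "0 \<le> t"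
  shows "csum \<eta> (\<lambda>y. ennreal (kint t (a - y $ k))) = csum front (\<lambda>y. ennreal (tail t (a - y $ k)))"
proof -
  have "csum \<eta> (\<lambda>y. ennreal (kint t (a - y $ k))) =
      csum (front \<times> UNIV) (\<lambda>z. ennreal (kint t (a - (case z of (y, i) \<Rightarrow> y - int i *s axis k 1) $ k)))"
    by (rule nn_integral_bij_count_space[OF front_bij, symmetric])
  also have "\<dots> = csum front (\<lambda>y. csum UNIV (\<lambda>i. ennreal (kint t (a - y $ k + int i))))"
    by (subst csum_Times) (simp add: axis_def algebra_simps)
  finally show ?thesis using assms by (simp add: tail_csum)
qed

text \<open>The pointwise comparison of \<open>kint s * tail r\<close> with
  \<open>kint (s + r)\<close> is false. It holds after summation over a downward closed set, because
  both sums become sums of tails over the front, where \<open>tail_mult\<close> applies.\<close>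

lemma csum_transport:
  assumes s: "0 \<le> s" and r: "0 \<le> r"
  shows "csum \<eta> (\<lambda>y. ennreal (kint s (y $ k - a))) * ennreal (tail r (n - a))
    \<le> csum \<eta> (\<lambda>y. ennreal (kint (s + r) (n - y $ k)))"
proof -
  have "csum \<eta> (\<lambda>y. ennreal (kint s (y $ k - a))) = csum \<eta> (\<lambda>y. ennreal (kint s (a - y $ k)))"
    using Z.ker_sym[of s "a - _"] by simp
  also have "\<dots> = csum front (\<lambda>y. ennreal (tail s (a - y $ k)))" by (rule csum_front[OF s])
  finally have "csum \<eta> (\<lambda>y. ennreal (kint s (y $ k - a))) * ennreal (tail r (n - a)) =
      csum front (\<lambda>y. ennreal (tail s (a - y $ k)) * ennreal (tail r (n - a)))"
    by (simp add: nn_integral_multc)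
  also have "\<dots> \<le> csum front (\<lambda>y. ennreal (tail (s + r) (n - y $ k)))"
  proof (rule nn_integral_mono)
    fix y
    show "ennreal (tail s (a - y $ k)) * ennreal (tail r (n - a)) \<le> ennreal (tail (s + r) (n - y $ k))"
      using tail_mult[OF s r, of "a - y $ k" "n - a"] tail_nonneg[OF s] tail_nonneg[OF r]
      by (simp add: ennreal_leI flip: ennreal_mult)
  qed
  also have "\<dots> = csum \<eta> (\<lambda>y. ennreal (kint (s + r) (n - y $ k)))"
    using s r by (intro csum_front[symmetric]) auto
  finally show ?thesis .
qed

end

section \<open>Density gradients and their weighted energies\<close>

definition bdry :: "'n::finite site set \<Rightarrow> 'n site \<Rightarrow> 'n site set" where
  "bdry \<eta> e = {y. (y \<in> \<eta>) \<noteq> (y + e \<in> \<eta>)}"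

text \<open>The difference of densities is the evolution of the difference of indicators, whose
  absolute value is the indicator of the boundary.\<close>

lemma gradient_bdry:
  fixes \<eta> :: "'n::finite site set"
  assumes s: "0 \<le> s"
  shows "ennreal \<bar>heat units s (indicator \<eta>) a - heat units s (indicator \<eta>) (a + e)\<bar>
    \<le> csum (bdry \<eta> e) (\<lambda>y. ennreal (ker units s (y - a)))"
proof -
  let ?D = "\<lambda>x. indicator \<eta> x + - 1 * indicator \<eta> (x + e) :: real"
  have D: "\<bar>?D x\<bar> \<le> 1" for x by (auto simp: indicator_def)
  have "heat units s (indicator \<eta>) a - heat units s (indicator \<eta>) (a + e) = heat units s ?D a"
    by (subst U.heat_add[OF U.ind_bound U.ind_bound]) (simp add: U.heat_translate)
  then have "\<bar>heat units s (indicator \<eta>) a - heat units s (indicator \<eta>) (a + e)\<bar> \<le> heat units s (\<lambda>x. \<bar>?D x\<bar>) a"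
    using U.heat_abs[OF s D] by simp
  then have "ennreal \<bar>heat units s (indicator \<eta>) a - heat units s (indicator \<eta>) (a + e)\<bar> \<le> ennreal (heat units s (\<lambda>x. \<bar>?D x\<bar>) a)"
    by (rule ennreal_leI)
  also have "\<dots> = csum UNIV (\<lambda>y. ennreal (ker units s (y - a)) * ennreal \<bar>?D y\<bar>)"
    by (rule U.heat_csum[OF s, where K = 1]) (auto simp: D indicator_def)
  also have "\<dots> = csum (bdry \<eta> e) (\<lambda>y. ennreal (ker units s (y - a)))"
    unfolding csum_UNIV[of "bdry \<eta> e"] by (intro nn_integral_cong) (auto simp: indicator_def bdry_def)
  finally show ?thesis .
qed

text \<open>Here the difference is put on the kernel instead of the configuration. This gains decay
  in time, at the price of a sum over all of \<eta> in place of its boundary.\<close>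

lemma gradient_transversal:
  fixes \<eta> :: "'n::finite site set"
  assumes s: "0 \<le> s" and ik: "i \<noteq> k"
  shows "ennreal \<bar>heat units s (indicator \<eta>) a - heat units s (indicator \<eta>) (a + axis i 1)\<bar>
    \<le> ennreal (step_bound CARD('n) s ^ CARD('n)) * csum \<eta> (\<lambda>y. ennreal (kint (s / real CARD('n)) (y $ k - a $ k)))"
proof -
  let ?e = "axis i 1 :: 'n site" and ?u = "heat units s (indicator \<eta>)"
  let ?g = "\<lambda>y. \<bar>ker units s (y - a) - ker units s (y - a - ?e)\<bar>"
  have u: "ennreal (?u x) = csum UNIV (\<lambda>y. ennreal (ker units s (y - x)) * ennreal (indicator \<eta> y))" for x
    by (rule U.heat_csum[OF s U.ind_bound]) auto
  \<comment> \<open>Stated additively and in both directions, which avoids subtraction in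
    \<open>ennreal\<close>.\<close>
  have aux: "ennreal (?u x) \<le> ennreal (?u z) + csum UNIV (\<lambda>y. ennreal (?g y) * ennreal (indicator \<eta> y))"
    if "(x = a \<and> z = a + ?e) \<or> (x = a + ?e \<and> z = a)" for x z
  proof -
    have "ennreal (?u x) \<le> csum UNIV (\<lambda>y. ennreal (ker units s (y - z)) * ennreal (indicator \<eta> y) + ennreal (?g y) * ennreal (indicator \<eta> y))"
      unfolding u
    proof (rule nn_integral_mono)
      fix y
      have "ker units s (y - x) \<le> ker units s (y - z) + ?g y"
        using that by (auto simp: diff_diff_eq)
      then have "ennreal (ker units s (y - x)) \<le> ennreal (ker units s (y - z)) + ennreal (?g y)"
        by (subst ennreal_plus[symmetric]) (auto intro!: ennreal_leI U.ker_nonneg[OF s])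
      then show "ennreal (ker units s (y - x)) * ennreal (indicator \<eta> y) \<le>
          ennreal (ker units s (y - z)) * ennreal (indicator \<eta> y) + ennreal (?g y) * ennreal (indicator \<eta> y)"
        by (simp add: mult_right_mono flip: distrib_right)
    qed
    then show ?thesis by (simp add: nn_integral_add u)
  qed
  have "ennreal \<bar>?u a - ?u (a + ?e)\<bar> \<le> csum UNIV (\<lambda>y. ennreal (?g y) * ennreal (indicator \<eta> y))" (is "_ \<le> ?S")
  proof (cases "?S = \<top>")
    case False
    then obtain S where S: "?S = ennreal S" "0 \<le> S" by (cases ?S) auto
    have "?u a \<le> ?u (a + ?e) + S" "?u (a + ?e) \<le> ?u a + S"
      using aux[of a "a + ?e"] aux[of "a + ?e" a] S U.heat_nonneg[OF s, of "indicator \<eta>" 1] U.ind_bound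
      by (auto simp flip: ennreal_plus)
    then show ?thesis using S by (auto intro!: ennreal_leI)
  qed simp
  also have "?S \<le> csum UNIV (\<lambda>y. ennreal (step_bound CARD('n) s ^ CARD('n)) * (ennreal (kint (s / real CARD('n)) (y $ k - a $ k)) * ennreal (indicator \<eta> y)))"
  proof (rule nn_integral_mono)
    fix y
    have "ennreal (?g y) \<le> ennreal (step_bound CARD('n) s ^ CARD('n) * kint (s / real CARD('n)) (y $ k - a $ k))"
      using ker_units_gradient_bound[OF s ik, of "y - a"] by (intro ennreal_leI) simp
    also have "\<dots> = ennreal (step_bound CARD('n) s ^ CARD('n)) * ennreal (kint (s / real CARD('n)) (y $ k - a $ k))"
      using step_bound_nonneg[OF s] Z.ker_nonneg[of "s / real CARD('n)"] s by (intro ennreal_mult) auto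
    finally show "ennreal (?g y) * ennreal (indicator \<eta> y) \<le> ennreal (step_bound CARD('n) s ^ CARD('n)) * (ennreal (kint (s / real CARD('n)) (y $ k - a $ k)) * ennreal (indicator \<eta> y))"
      by (simp add: mult_right_mono flip: mult.assoc)
  qed
  also have "\<dots> = ennreal (step_bound CARD('n) s ^ CARD('n)) * csum \<eta> (\<lambda>y. ennreal (kint (s / real CARD('n)) (y $ k - a $ k)))"
    by (simp add: nn_integral_cmult csum_UNIV[of \<eta>] ennreal_indicator)
  finally show ?thesis .
qed

text \<open>One factor of the squared gradient is bounded uniformly by \<open>S\<close>, the other is summed
  over the boundary.\<close>

lemma energy_bound:
  fixes \<eta> :: "'n::finite site set"
  assumes s: "0 \<le> s" and r: "0 \<le> r"
    and S: "\<And>a. ennreal \<bar>heat units s (indicator \<eta>) a - heat units s (indicator \<eta>) (a + e)\<bar> *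
      ennreal (tail (r / real CARD('n)) (n - (a + e) $ k)) \<le> S"
  shows "csum UNIV (\<lambda>a. ennreal ((heat units s (indicator \<eta>) a - heat units s (indicator \<eta>) (a + e))\<^sup>2 *
      tail (r / real CARD('n)) (n - a $ k) * tail (r / real CARD('n)) (n - (a + e) $ k)))
    \<le> S * csum (bdry \<eta> e) (\<lambda>y. ennreal (tail ((s + r) / real CARD('n)) (n - y $ k)))"
proof -
  let ?g = "\<lambda>a. \<bar>heat units s (indicator \<eta>) a - heat units s (indicator \<eta>) (a + e)\<bar>"
  let ?h = "\<lambda>a. tail (r / real CARD('n)) (n - a $ k)"
  have h0: "0 \<le> ?h a" for a using r by (intro tail_nonneg) auto
  have "csum UNIV (\<lambda>a. ennreal ((heat units s (indicator \<eta>) a - heat units s (indicator \<eta>) (a + e))\<^sup>2 * ?h a * ?h (a + e)))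
      = csum UNIV (\<lambda>a. (ennreal (?g a) * ennreal (?h (a + e))) * (ennreal (?g a) * ennreal (?h a)))"
  proof (rule nn_integral_cong)
    fix a
    have m4: "ennreal (x * y * (z * w)) = (ennreal x * ennreal y) * (ennreal z * ennreal w)"
      if "0 \<le> x" "0 \<le> y" "0 \<le> z" "0 \<le> w" for x y z w
      using that by (simp add: ennreal_mult)
    have "(heat units s (indicator \<eta>) a - heat units s (indicator \<eta>) (a + e))\<^sup>2 * ?h a * ?h (a + e)
        = (?g a * ?h (a + e)) * (?g a * ?h a)"
      by (subst power2_abs[symmetric]) (simp only: power2_eq_square mult_ac)
    then show "ennreal ((heat units s (indicator \<eta>) a - heat units s (indicator \<eta>) (a + e))\<^sup>2 * ?h a * ?h (a + e))
        = (ennreal (?g a) * ennreal (?h (a + e))) * (ennreal (?g a) * ennreal (?h a))"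
      by (simp only:) (intro m4 h0 abs_ge_zero)
  qed
  also have "\<dots> \<le> csum UNIV (\<lambda>a. S * (csum (bdry \<eta> e) (\<lambda>y. ennreal (ker units s (y - a))) * ennreal (?h a)))"
    by (intro nn_integral_mono mult_mono S mult_right_mono gradient_bdry[OF s]) auto
  also have "\<dots> = S * csum UNIV (\<lambda>a. csum (bdry \<eta> e) (\<lambda>y. ennreal (ker units s (y - a)) * ennreal (?h a)))"
    by (simp add: nn_integral_cmult nn_integral_multc)
  also have "\<dots> = S * csum (bdry \<eta> e) (\<lambda>y. ennreal (tail ((s + r) / real CARD('n)) (n - y $ k)))"
    by (subst csum_swap) (simp add: csum_ker_tail[OF s r])
  finally show ?thesis .
qed

context downset
begin

text \<open>A transversal step keeps the level, so the two tails coincide and no shift occurs. The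
  uniform factor is bounded by \<open>gradient_transversal\<close> followed by
  \<open>csum_transport\<close>.\<close>

lemma energy_transversal:
  assumes s: "0 \<le> s" and r: "0 \<le> r" and ik: "i \<noteq> k"
  shows "csum UNIV (\<lambda>a. ennreal ((heat units s (indicator \<eta>) a - heat units s (indicator \<eta>) (a + axis i 1))\<^sup>2 *
      tail (r / real CARD('n)) (n - a $ k) * tail (r / real CARD('n)) (n - (a + axis i 1) $ k)))
    \<le> ennreal (step_bound CARD('n) s ^ CARD('n)) * csum \<eta> (\<lambda>y. ennreal (kint ((s + r) / real CARD('n)) (n - y $ k)))
      * csum (bdry \<eta> (axis i 1)) (\<lambda>y. ennreal (tail ((s + r) / real CARD('n)) (n - y $ k)))"
proof (rule energy_bound[OF s r])
  fix a :: "'n site"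
  have "ennreal \<bar>heat units s (indicator \<eta>) a - heat units s (indicator \<eta>) (a + axis i 1)\<bar> *
      ennreal (tail (r / real CARD('n)) (n - (a + axis i 1) $ k))
    \<le> (ennreal (step_bound CARD('n) s ^ CARD('n)) * csum \<eta> (\<lambda>y. ennreal (kint (s / real CARD('n)) (y $ k - a $ k))))
      * ennreal (tail (r / real CARD('n)) (n - a $ k))"
    using ik gradient_transversal[OF s ik, of \<eta> a] by (simp add: axis_def mult_right_mono)
  also have "\<dots> \<le> ennreal (step_bound CARD('n) s ^ CARD('n)) * csum \<eta> (\<lambda>y. ennreal (kint ((s + r) / real CARD('n)) (n - y $ k)))"
    using csum_transport[of "s / real CARD('n)" "r / real CARD('n)" "a $ k" n] s r
    by (simp add: mult.assoc add_divide_distrib mult_left_mono)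
  finally show "ennreal \<bar>heat units s (indicator \<eta>) a - heat units s (indicator \<eta>) (a + axis i 1)\<bar> *
      ennreal (tail (r / real CARD('n)) (n - (a + axis i 1) $ k))
    \<le> ennreal (step_bound CARD('n) s ^ CARD('n)) * csum \<eta> (\<lambda>y. ennreal (kint ((s + r) / real CARD('n)) (n - y $ k)))" .
qed

lemma bdry_front: "bdry \<eta> (axis k 1) = front"
  using down[of "_ + axis k 1"] by (auto simp: bdry_def front_def)

text \<open>The boundary in direction k is the front, so by \<open>csum_front\<close> the summed
  factor and the uniform factor lead to the same quantity, whence the square. The tail at a + e_k is
  one site closer to n; \<open>near\<close> allows \<open>tail_shift\<close> to pay for this with
  the factor 4.\<close>

lemma energy_longitudinal:
  assumes s: "0 \<le> s" and r: "0 \<le> r" and pos: "0 < s + r"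
    and near: "\<And>y. y \<in> front \<Longrightarrow> real_of_int (n - y $ k) \<le> (s + r) / real CARD('n)"
  shows "csum UNIV (\<lambda>a. ennreal ((heat units s (indicator \<eta>) a - heat units s (indicator \<eta>) (a + axis k 1))\<^sup>2 *
      tail (r / real CARD('n)) (n - a $ k) * tail (r / real CARD('n)) (n - (a + axis k 1) $ k)))
    \<le> ennreal (4 * step_bound CARD('n) s ^ (CARD('n) - 1))
      * (csum \<eta> (\<lambda>y. ennreal (kint ((s + r) / real CARD('n)) (n - y $ k))))\<^sup>2"
proof -
  let ?\<tau> = "(s + r) / real CARD('n)" and ?b = "step_bound CARD('n) s ^ (CARD('n) - 1)"
  have b0: "0 \<le> ?b" using step_bound_nonneg[OF s] by simp
  define Q where "Q = csum \<eta> (\<lambda>y. ennreal (kint ?\<tau> (n - y $ k)))"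
  have Q: "Q = csum front (\<lambda>y. ennreal (tail ?\<tau> (n - y $ k)))"
    unfolding Q_def using s r by (intro csum_front) auto
  have "csum UNIV (\<lambda>a. ennreal ((heat units s (indicator \<eta>) a - heat units s (indicator \<eta>) (a + axis k 1))\<^sup>2 *
      tail (r / real CARD('n)) (n - a $ k) * tail (r / real CARD('n)) (n - (a + axis k 1) $ k)))
    \<le> ennreal (4 * ?b) * Q * csum (bdry \<eta> (axis k 1)) (\<lambda>y. ennreal (tail ?\<tau> (n - y $ k)))"
  proof (rule energy_bound[OF s r])
    fix a :: "'n site"
    have "ennreal \<bar>heat units s (indicator \<eta>) a - heat units s (indicator \<eta>) (a + axis k 1)\<bar> *
        ennreal (tail (r / real CARD('n)) (n - (a + axis k 1) $ k))
      \<le> csum front (\<lambda>y. ennreal (ker units s (y - a))) * ennreal (tail (r / real CARD('n)) (n - (a + axis k 1) $ k))"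
      using gradient_bdry[OF s, of \<eta> a "axis k 1"] by (intro mult_right_mono) (auto simp: bdry_front)
    also have "\<dots> = csum front (\<lambda>y. ennreal (ker units s (y - a)) * ennreal (tail (r / real CARD('n)) (n - a $ k - 1)))"
      by (simp add: nn_integral_multc axis_def diff_diff_eq)
    also have "\<dots> \<le> csum front (\<lambda>y. ennreal (4 * ?b) * ennreal (tail ?\<tau> (n - y $ k)))"
    proof (rule nn_integral_mono)
      fix y assume "y \<in> space (count_space front)"
      then have y: "y \<in> front" by simp
      let ?T = "tail (r / real CARD('n)) (n - a $ k - 1)"
      have T0: "0 \<le> ?T" using r by (intro tail_nonneg) auto
      have "ker units s (y - a) * ?T \<le> ?b * kint (s / real CARD('n)) ((y - a) $ k) * ?T"
        by (intro mult_right_mono ker_units_bound[OF s] T0)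
      also have "\<dots> = ?b * (kint (s / real CARD('n)) (a $ k - y $ k) * ?T)"
        using Z.ker_sym[of "s / real CARD('n)" "a $ k - y $ k"] by simp
      also have "\<dots> \<le> ?b * tail ?\<tau> (n - y $ k - 1)"
      proof (intro mult_left_mono b0)
        have "kint (s / real CARD('n)) (a $ k - y $ k) * ?T
            \<le> tail (s / real CARD('n) + r / real CARD('n)) (a $ k - y $ k + (n - a $ k - 1))"
          using s r by (intro kint_tail) auto
        moreover have "a $ k - y $ k + (n - a $ k - 1) = n - y $ k - 1" by simp
        ultimately show "kint (s / real CARD('n)) (a $ k - y $ k) * ?T \<le> tail ?\<tau> (n - y $ k - 1)"
          by (simp only: add_divide_distrib)
      qed
      also have "\<dots> \<le> ?b * (4 * tail ?\<tau> (n - y $ k))"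
        using near[OF y] pos b0 by (intro mult_left_mono tail_shift) auto
      finally have "ker units s (y - a) * ?T \<le> 4 * ?b * tail ?\<tau> (n - y $ k)" by simp
      then show "ennreal (ker units s (y - a)) * ennreal ?T \<le> ennreal (4 * ?b) * ennreal (tail ?\<tau> (n - y $ k))"
        using T0 U.ker_nonneg[OF s, of "y - a"] b0 tail_nonneg[of ?\<tau> "n - y $ k"] s r
        by (simp add: ennreal_leI flip: ennreal_mult)
    qed
    also have "\<dots> = ennreal (4 * ?b) * Q" by (simp add: nn_integral_cmult Q)
    finally show "ennreal \<bar>heat units s (indicator \<eta>) a - heat units s (indicator \<eta>) (a + axis k 1)\<bar> *
        ennreal (tail (r / real CARD('n)) (n - (a + axis k 1) $ k)) \<le> ennreal (4 * ?b) * Q" .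
  qed
  also have "\<dots> = ennreal (4 * ?b) * Q\<^sup>2" by (simp add: bdry_front Q power2_eq_square mult.assoc)
  finally show ?thesis by (simp add: Q_def)
qed

end

section \<open>One- and two-point functions of the exclusion process\<close>

definition occ :: "'n site \<Rightarrow> 'n config \<Rightarrow> real" where
  "occ x \<eta> = of_bool (\<eta> x)"

definition occ2 :: "'n site \<times> 'n site \<Rightarrow> 'n config \<Rightarrow> real" where
  "occ2 p \<eta> = occ (fst p) \<eta> * occ (snd p) \<eta>"

lemma occ_bound: "0 \<le> occ x \<eta>" "occ x \<eta> \<le> 1" "\<bar>occ x \<eta>\<bar> \<le> 1"
  by (auto simp: occ_def)

lemma occ2_bound: "0 \<le> occ2 p \<eta>" "occ2 p \<eta> \<le> 1" "\<bar>occ2 p \<eta>\<bar> \<le> 1"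
  by (auto simp: occ2_def occ_def)

lemma occ_continuous: "continuous_on UNIV (occ x)"
proof -
  have "continuous_on UNIV (of_bool :: bool \<Rightarrow> real)"
    by (simp add: continuous_on_discrete)
  then show ?thesis
    unfolding occ_def[abs_def]
    by (rule continuous_on_compose2) (auto intro: continuous_on_product_coordinates)
qed

lemma occ2_continuous: "continuous_on UNIV (occ2 p)"
  unfolding occ2_def[abs_def] by (intro continuous_intros occ_continuous)

lemma local_fun_occ: "local_fun (occ x)"
  unfolding local_fun_def occ_def by (intro exI[of _ "{x}"]) auto

lemma local_fun_occ2: "local_fun (occ2 p)"
  unfolding local_fun_def occ2_def occ_def by (intro exI[of _ "{fst p, snd p}"]) auto

lemma exchange_commute: "exchange \<eta> x y = exchange \<eta> y x"
  by (auto simp: exchange_def fun_eq_iff)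

text \<open>The two orientations of an edge contribute complementary terms, so each edge leaving
  the support \<open>A\<close> of \<open>f\<close> counts exactly once.\<close>

lemma ssep_gen_edges:
  fixes f :: "'n::finite config \<Rightarrow> real"
  assumes A: "finite A"
    and local: "\<And>\<eta> \<xi>. (\<And>x. x \<in> A \<Longrightarrow> \<eta> x = \<xi> x) \<Longrightarrow> f \<eta> = f \<xi>"
    and inner: "\<And>x y \<eta>. x \<in> A \<Longrightarrow> y \<in> A \<Longrightarrow> f (exchange \<eta> x y) = f \<eta>"
  shows "ssep_gen f \<eta> = (\<Sum>x\<in>A. \<Sum>y | nearest_nbr x y \<and> y \<notin> A. f (exchange \<eta> x y) - f \<eta>) / (2 * real CARD('n))"
proof -
  define D where "D x y = f (exchange \<eta> x y) - f \<eta>" for x y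
  define a :: "'n site \<Rightarrow> 'n site \<Rightarrow> real" where "a x y = of_bool (\<eta> x) * (1 - of_bool (\<eta> y))" for x y
  define B where "B = A \<union> (\<Union>x\<in>A. {y. nearest_nbr x y})"
  have fB: "finite B" using A by (auto simp: B_def)
  have Dsym: "D x y = D y x" for x y by (simp add: D_def exchange_commute)
  have Din: "D x y = 0" if "x \<in> A" "y \<in> A" for x y using inner[OF that] by (simp add: D_def)
  have Dout: "D x y = 0" if "x \<notin> A" "y \<notin> A" for x y
  proof -
    have "f (exchange \<eta> x y) = f \<eta>" by (rule local) (use that in \<open>auto simp: exchange_def\<close>)
    then show ?thesis by (simp add: D_def)
  qed
  have Dsame: "D x y = 0" if "\<eta> x = \<eta> y" for x y
  proof -
    have "exchange \<eta> x y = \<eta>" using that by (auto simp: exchange_def fun_eq_iff)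
    then show ?thesis by (simp add: D_def)
  qed
  have aD: "a x y * D x y + a y x * D y x = D x y" for x y
    using Dsym[of x y] Dsame[of x y] by (cases "\<eta> x"; cases "\<eta> y") (auto simp: a_def)
  let ?R = "SIGMA x:A. {y. nearest_nbr x y \<and> y \<notin> A}"
  let ?R' = "SIGMA x:B - A. {y. nearest_nbr x y \<and> y \<in> A}"
  have fR: "finite ?R" using A by (intro finite_SigmaI) (auto intro: finite_subset[OF _ finite_nearest_nbr])
  have fin: "finite {y. nearest_nbr x y \<and> P y}" for x :: "'n site" and P
    by (rule finite_subset[OF _ finite_nearest_nbr[of x]]) auto
  have "(\<Sum>\<^sub>\<infinity>x\<in>UNIV. \<Sum>y | nearest_nbr x y. a x y * D x y) = (\<Sum>\<^sub>\<infinity>x\<in>B. \<Sum>y | nearest_nbr x y. a x y * D x y)"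
  proof (rule infsum_cong_neutral)
    fix x assume x: "x \<in> UNIV - B"
    show "(\<Sum>y | nearest_nbr x y. a x y * D x y) = 0"
    proof (rule sum.neutral, rule ballI)
      fix y assume "y \<in> {y. nearest_nbr x y}"
      then have "x \<notin> A" "y \<notin> A" using x by (auto simp: B_def nearest_nbr_sym[of x])
      then show "a x y * D x y = 0" by (simp add: Dout)
    qed
  qed auto
  also have "\<dots> = (\<Sum>x\<in>B. \<Sum>y | nearest_nbr x y. a x y * D x y)" using fB by simp
  also have "\<dots> = (\<Sum>x\<in>A. \<Sum>y | nearest_nbr x y. a x y * D x y) + (\<Sum>x\<in>B - A. \<Sum>y | nearest_nbr x y. a x y * D x y)"
    by (subst sum.subset_diff[of A B]) (use fB in \<open>auto simp: B_def add.commute\<close>)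
  also have "(\<Sum>x\<in>A. \<Sum>y | nearest_nbr x y. a x y * D x y) = (\<Sum>x\<in>A. \<Sum>y | nearest_nbr x y \<and> y \<notin> A. a x y * D x y)"
    by (intro sum.cong refl sum.mono_neutral_right) (auto simp: Din)
  also have "\<dots> = (\<Sum>(x, y)\<in>?R. a x y * D x y)" using A fin by (intro sum.Sigma) auto
  also have "(\<Sum>x\<in>B - A. \<Sum>y | nearest_nbr x y. a x y * D x y) = (\<Sum>x\<in>B - A. \<Sum>y | nearest_nbr x y \<and> y \<in> A. a x y * D x y)"
    by (intro sum.cong refl sum.mono_neutral_right) (auto simp: Dout)
  also have "\<dots> = (\<Sum>(x, y)\<in>?R'. a x y * D x y)" using fB fin by (intro sum.Sigma) auto
  also have "\<dots> = (\<Sum>(x, y)\<in>?R. a y x * D y x)"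
    by (rule sum.reindex_bij_witness[of _ "\<lambda>(x, y). (y, x)" "\<lambda>(x, y). (y, x)"])
       (auto simp: B_def nearest_nbr_sym)
  also have "(\<Sum>(x, y)\<in>?R. a x y * D x y) + (\<Sum>(x, y)\<in>?R. a y x * D y x) = (\<Sum>(x, y)\<in>?R. D x y)"
    by (subst sum.distrib[symmetric]) (auto simp: aD intro!: sum.cong)
  also have "\<dots> = (\<Sum>x\<in>A. \<Sum>y | nearest_nbr x y \<and> y \<notin> A. D x y)"
    using A fin by (intro sum.Sigma[symmetric]) auto
  finally show ?thesis by (simp add: ssep_gen_def a_def D_def)
qed

lemma nearest_nbr_irrefl [simp]: "\<not> nearest_nbr x x"
  by (simp add: nearest_nbr_def)

lemma ssep_gen_occ: "ssep_gen (occ x) \<eta> = avg units (\<lambda>y. occ y \<eta>) x - occ x (\<eta> :: 'n::finite config)"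
proof -
  have "ssep_gen (occ x) \<eta> = (\<Sum>z\<in>{x}. \<Sum>y | nearest_nbr z y \<and> y \<notin> {x}. occ x (exchange \<eta> z y) - occ x \<eta>) / (2 * real CARD('n))"
    by (rule ssep_gen_edges) (auto simp: occ_def exchange_def)
  also have "(\<Sum>z\<in>{x}. \<Sum>y | nearest_nbr z y \<and> y \<notin> {x}. occ x (exchange \<eta> z y) - occ x \<eta>) = (\<Sum>y | nearest_nbr x y. occ y \<eta> - occ x \<eta>)"
    by (simp, intro sum.cong) (auto simp: occ_def exchange_def)
  also have "\<dots> = (\<Sum>e\<in>units. occ (x + e) \<eta> - occ x \<eta>)"
    unfolding nearest_nbr_image by (subst sum.reindex) (auto simp: inj_on_def)
  finally show ?thesis
    by (simp add: avg_def sum_subtractf card_units diff_divide_distrib)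
qed

text \<open>The generator of two exclusion particles, acting on functions of ordered pairs of distinct
  sites.\<close>

definition nbr_pairs :: "'n::finite site \<times> 'n site \<Rightarrow> ('n site \<times> 'n site) set" where
  "nbr_pairs p = {(x', snd p) | x'. nearest_nbr (fst p) x' \<and> x' \<noteq> snd p} \<union>
     {(fst p, y') | y'. nearest_nbr (snd p) y' \<and> y' \<noteq> fst p}"

definition excl :: "('n::finite site \<times> 'n site \<Rightarrow> real) \<Rightarrow> 'n site \<times> 'n site \<Rightarrow> real" where
  "excl w p = (\<Sum>q\<in>nbr_pairs p. w q - w p) / (2 * real CARD('n))"

lemma sum_nbr_pairs:
  fixes x y :: "'n::finite site"
  shows "(\<Sum>q\<in>nbr_pairs (x, y). h q) = (\<Sum>x' | nearest_nbr x x' \<and> x' \<noteq> y. h (x', y)) + (\<Sum>y' | nearest_nbr y y' \<and> y' \<noteq> x. h (x, y'))"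
    and finite_nbr_pairs: "finite (nbr_pairs (x, y))"
proof -
  let ?X = "{x'. nearest_nbr x x' \<and> x' \<noteq> y}" and ?Y = "{y'. nearest_nbr y y' \<and> y' \<noteq> x}"
  have eq: "nbr_pairs (x, y) = (\<lambda>x'. (x', y)) ` ?X \<union> (\<lambda>y'. (x, y')) ` ?Y"
    by (auto simp: nbr_pairs_def)
  have fin: "finite ?X" "finite ?Y"
    by (auto intro: finite_subset[OF _ finite_nearest_nbr])
  then show "finite (nbr_pairs (x, y))" by (simp add: eq)
  have "(\<Sum>q\<in>nbr_pairs (x, y). h q) = (\<Sum>q\<in>(\<lambda>x'. (x', y)) ` ?X. h q) + (\<Sum>q\<in>(\<lambda>y'. (x, y')) ` ?Y. h q)"
    unfolding eq by (rule sum.union_disjoint) (use fin in auto)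
  also have "\<dots> = (\<Sum>x'\<in>?X. h (x', y)) + (\<Sum>y'\<in>?Y. h (x, y'))"
    by (subst (1 2) sum.reindex) (auto simp: inj_on_def)
  finally show "(\<Sum>q\<in>nbr_pairs (x, y). h q) = (\<Sum>x'\<in>?X. h (x', y)) + (\<Sum>y'\<in>?Y. h (x, y'))" .
qed

lemma nbr_pairs_sym: "p \<in> nbr_pairs p' \<longleftrightarrow> p' \<in> nbr_pairs p" if "fst p \<noteq> snd p" "fst p' \<noteq> snd p'"
  using that by (cases p; cases p') (auto simp: nbr_pairs_def nearest_nbr_sym)

lemma nbr_pairs_distinct: "p' \<in> nbr_pairs p \<Longrightarrow> fst p' \<noteq> snd p'"
  by (auto simp: nbr_pairs_def)

lemma card_nearest_nbr: "card {y. nearest_nbr (x :: 'n::finite site) y} = 2 * CARD('n)"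
  unfolding nearest_nbr_image by (subst card_image) (auto simp: card_units inj_on_def)

lemma card_nbr_pairs: "card (nbr_pairs p) \<le> 4 * CARD('n)" for p :: "'n::finite site \<times> 'n site"
proof -
  obtain x y where p: "p = (x, y)" by (cases p)
  have "card (nbr_pairs p) = card {x'. nearest_nbr x x' \<and> x' \<noteq> y} + card {y'. nearest_nbr y y' \<and> y' \<noteq> x}"
    using sum_nbr_pairs(1)[of "\<lambda>_. 1 :: nat" x y] by (simp add: p)
  also have "\<dots> \<le> card {x'. nearest_nbr x x'} + card {y'. nearest_nbr y y'}"
    by (intro add_mono card_mono) auto
  finally show ?thesis by (simp add: card_nearest_nbr)
qed

text \<open>Independent walks differ from exclusion particles only by the jumps of neighbours onto
  each other, and these contribute (u y - u x) u y + u x (u x - u y) = (u x - u y)^2.\<close>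

lemma avg_product:
  fixes x y :: "'n::finite site"
  assumes xy: "x \<noteq> y"
  shows "(avg units u x - u x) * u y + u x * (avg units u y - u y) =
    excl (\<lambda>p. u (fst p) * u (snd p)) (x, y) + of_bool (nearest_nbr x y) * (u x - u y)\<^sup>2 / (2 * real CARD('n))"
proof -
  have avg: "avg units u x - u x = (\<Sum>x' | nearest_nbr x x'. u x' - u x) / (2 * real CARD('n))" for x :: "'n site"
    unfolding nearest_nbr_image
    by (subst sum.reindex) (auto simp: inj_on_def avg_def sum_subtractf card_units diff_divide_distrib)
  have rem: "(\<Sum>x' | nearest_nbr x x'. u x' - u x) =
      (\<Sum>x' | nearest_nbr x x' \<and> x' \<noteq> y. u x' - u x) + of_bool (nearest_nbr x y) * (u y - u x)" for x y :: "'n site"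
  proof -
    have "(\<Sum>x' | nearest_nbr x x'. u x' - u x) =
        (\<Sum>x'\<in>{x'. nearest_nbr x x'} - {y}. u x' - u x) + of_bool (nearest_nbr x y) * (u y - u x)"
      by (cases "nearest_nbr x y") (auto simp: sum.remove[of _ y])
    also have "{x'. nearest_nbr x x'} - {y} = {x'. nearest_nbr x x' \<and> x' \<noteq> y}" by auto
    finally show ?thesis .
  qed
  have e: "excl (\<lambda>p. u (fst p) * u (snd p)) (x, y) =
      ((\<Sum>x' | nearest_nbr x x' \<and> x' \<noteq> y. u x' - u x) * u y + u x * (\<Sum>y' | nearest_nbr y y' \<and> y' \<noteq> x. u y' - u y)) / (2 * real CARD('n))"
    by (simp add: excl_def sum_nbr_pairs sum_distrib_left sum_distrib_right algebra_simps)
  show ?thesis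
    unfolding avg e rem[of x y] rem[of y x]
    by (simp add: nearest_nbr_sym[of y x] power2_eq_square flip: add_divide_distrib)
       (simp add: algebra_simps)
qed

text \<open>Two-point self-duality: the exchange of the two observed sites leaves
  \<open>occ2 p\<close> unchanged, every other exchange moves one of them to a neighbour.\<close>

lemma ssep_gen_occ2:
  fixes \<eta> :: "'n::finite config"
  assumes "fst p \<noteq> snd p"
  shows "ssep_gen (occ2 p) \<eta> = excl (\<lambda>p. occ2 p \<eta>) p"
proof -
  obtain x y where p: "p = (x, y)" "x \<noteq> y" using assms by (cases p) auto
  have "ssep_gen (occ2 p) \<eta> = (\<Sum>z\<in>{x, y}. \<Sum>y' | nearest_nbr z y' \<and> y' \<notin> {x, y}. occ2 p (exchange \<eta> z y') - occ2 p \<eta>) / (2 * real CARD('n))"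
    by (rule ssep_gen_edges) (auto simp: occ2_def occ_def exchange_def p)
  also have "(\<Sum>z\<in>{x, y}. \<Sum>y' | nearest_nbr z y' \<and> y' \<notin> {x, y}. occ2 p (exchange \<eta> z y') - occ2 p \<eta>) =
    (\<Sum>x' | nearest_nbr x x' \<and> x' \<noteq> y. occ2 (x', y) \<eta> - occ2 p \<eta>) + (\<Sum>y' | nearest_nbr y y' \<and> y' \<noteq> x. occ2 (x, y') \<eta> - occ2 p \<eta>)"
    using p(2)
    by (simp, intro arg_cong2[where f = "(+)"] sum.cong) (auto simp: p(1) occ2_def occ_def exchange_def)
  finally show ?thesis by (simp add: p excl_def sum_nbr_pairs)
qed

lemma excl_nonneg:
  fixes y :: "real \<Rightarrow> 'n::finite site \<times> 'n site \<Rightarrow> real"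
  assumes cont: "\<And>p. fst p \<noteq> snd p \<Longrightarrow> continuous_on {0..T} (\<lambda>t. y t p)"
    and der: "\<And>p t. fst p \<noteq> snd p \<Longrightarrow> 0 < t \<Longrightarrow> t < T \<Longrightarrow>
      \<exists>D. ((\<lambda>t. y t p) has_real_derivative D) (at t) \<and> excl (y t) p \<le> D"
    and bnd: "\<And>p t. fst p \<noteq> snd p \<Longrightarrow> 0 \<le> t \<Longrightarrow> t \<le> T \<Longrightarrow> - K \<le> y t p"
    and init: "\<And>p. fst p \<noteq> snd p \<Longrightarrow> 0 \<le> y 0 p"
    and p: "fst p \<noteq> snd p" and t: "0 \<le> t" "t \<le> T"
  shows "0 \<le> y t p"
proof -
  let ?c = "1 / (2 * real CARD('n))"
  have excl: "excl w p = (\<Sum>q\<in>nbr_pairs p. ?c * w q) - real (card (nbr_pairs p)) * ?c * w p" for w and p :: "'n site \<times> 'n site"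
    by (simp add: excl_def sum_subtractf diff_divide_distrib sum_divide_distrib)
  show ?thesis
  \<comment> \<open>A pair has at most 4d neighbouring pairs, each at rate 1/(2d), whence
    \<open>L = 2\<close>.\<close>
  proof (rule evolution_nonneg[where I = "{p. fst p \<noteq> snd p}" and T = T and N = nbr_pairs
        and c = "\<lambda>_ _. ?c" and L = 2 and l = "\<lambda>p. real (card (nbr_pairs p)) * ?c" and K = K and t = t and y = y and p = p])
    show "\<exists>D. ((\<lambda>t. y t p) has_real_derivative D) (at t) \<and>
        (\<Sum>q\<in>nbr_pairs p. ?c * y t q) - real (card (nbr_pairs p)) * ?c * y t p \<le> D"
      if "p \<in> {p. fst p \<noteq> snd p}" "0 < t" "t < T" for p t
      using der[of p t] that unfolding excl by simp
    show "(\<Sum>q\<in>nbr_pairs p. ?c) \<le> 2" for p :: "'n site \<times> 'n site"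
    proof -
      have "real (card (nbr_pairs p)) \<le> 4 * real CARD('n)"
        using card_nbr_pairs[of p] by (metis of_nat_le_iff of_nat_mult of_nat_numeral)
      then show ?thesis by (simp add: field_simps)
    qed
    show "nbr_pairs p \<subseteq> {p. fst p \<noteq> snd p}" for p :: "'n site \<times> 'n site"
      using nbr_pairs_distinct by blast
  qed (use assms in auto)
qed

section \<open>The transition semigroup on continuous functions\<close>

definition semi :: "(real \<Rightarrow> 'n config \<Rightarrow> 'n config measure) \<Rightarrow> real \<Rightarrow> ('n::finite config \<Rightarrow> real) \<Rightarrow> 'n config \<Rightarrow> real" where
  "semi P t f \<eta> = (\<integral>\<xi>. f \<xi> \<partial>P t \<eta>)"

locale ssep =
  fixes P :: "real \<Rightarrow> 'n::finite config \<Rightarrow> 'n config measure"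
  assumes P: "ssep_transition P"
begin

lemma P_kernel: "0 \<le> t \<Longrightarrow> P t \<in> borel \<rightarrow>\<^sub>M prob_algebra borel"
  using P by (auto simp: ssep_transition_def)

lemma P_prob: "0 \<le> t \<Longrightarrow> prob_space (P t \<eta>)" and P_sets: "0 \<le> t \<Longrightarrow> sets (P t \<eta>) = sets borel"
  using measurable_space[OF P_kernel, of t \<eta>] by (auto simp: space_prob_algebra)

lemma P_integrable:
  assumes t: "0 \<le> t" and f: "continuous_on UNIV f" "\<And>\<xi>. \<bar>f \<xi>\<bar> \<le> K"
  shows "integrable (P t \<eta>) (f :: _ \<Rightarrow> real)"
proof -
  interpret prob_space "P t \<eta>" by (rule P_prob[OF t])
  have "f \<in> borel_measurable (P t \<eta>)"
    using borel_measurable_continuous_onI[OF f(1)] by (simp cong: measurable_cong_sets add: P_sets[OF t])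
  then show ?thesis by (intro integrable_const_bound[where B = K]) (use f(2) in auto)
qed

lemma semi_0: "continuous_on UNIV f \<Longrightarrow> semi P 0 f \<eta> = f \<eta>"
  using P borel_measurable_continuous_onI[of f]
  by (simp add: semi_def ssep_transition_def integral_return)

lemma semi_mono_bound:
  assumes t: "0 \<le> t" and f: "continuous_on UNIV f" "\<And>\<xi>. \<bar>f \<xi>\<bar> \<le> K"
  shows "\<bar>semi P t f \<eta>\<bar> \<le> K"
proof -
  interpret prob_space "P t \<eta>" by (rule P_prob[OF t])
  have "\<bar>semi P t f \<eta>\<bar> \<le> (\<integral>\<xi>. \<bar>f \<xi>\<bar> \<partial>P t \<eta>)"
    unfolding semi_def by (rule integral_abs_bound)
  also have "\<dots> \<le> (\<integral>\<xi>. K \<partial>P t \<eta>)"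
    by (intro integral_mono integrable_abs P_integrable[OF t f]) (use f in auto)
  also have "\<dots> = K" using prob_space by simp
  finally show ?thesis .
qed

lemma semi_nonneg: "(\<And>\<xi>. 0 \<le> f \<xi>) \<Longrightarrow> 0 \<le> semi P t f \<eta>"
  unfolding semi_def by (rule Bochner_Integration.integral_nonneg) auto

lemma semi_continuous: "0 \<le> t \<Longrightarrow> continuous_on UNIV f \<Longrightarrow> continuous_on UNIV (semi P t f)"
  using P by (auto simp: ssep_transition_def semi_def[abs_def])

lemma semi_diff:
  assumes t: "0 \<le> t" and f: "continuous_on UNIV f" "\<And>\<xi>. \<bar>f \<xi>\<bar> \<le> K" and g: "continuous_on UNIV g" "\<And>\<xi>. \<bar>g \<xi>\<bar> \<le> K'"
  shows "semi P t (\<lambda>\<xi>. f \<xi> - g \<xi>) \<eta> = semi P t f \<eta> - semi P t g \<eta>"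
  unfolding semi_def by (rule Bochner_Integration.integral_diff[OF P_integrable[OF t f] P_integrable[OF t g]])

lemma semi_sum:
  assumes t: "0 \<le> t" and f: "\<And>i. i \<in> I \<Longrightarrow> continuous_on UNIV (f i)" "\<And>i \<xi>. i \<in> I \<Longrightarrow> \<bar>f i \<xi>\<bar> \<le> K"
  shows "semi P t (\<lambda>\<xi>. \<Sum>i\<in>I. f i \<xi>) \<eta> = (\<Sum>i\<in>I. semi P t (f i) \<eta>)"
  unfolding semi_def by (rule Bochner_Integration.integral_sum) (rule P_integrable[OF t f], auto)

lemma semi_divide: "semi P t (\<lambda>\<xi>. f \<xi> / c) \<eta> = semi P t f \<eta> / c"
  by (simp add: semi_def)

lemma semi_semigroup:
  assumes s: "0 \<le> s" and t: "0 \<le> t" and f: "continuous_on UNIV f" "\<And>\<xi>. \<bar>f \<xi>\<bar> \<le> K"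
  shows "semi P (s + t) f \<eta> = semi P s (semi P t f) \<eta>"
proof -
  interpret prob_space "P s \<eta>" by (rule P_prob[OF s])
  have "P (s + t) \<eta> = P s \<eta> \<bind> P t" using P s t by (simp add: ssep_transition_def)
  moreover have "integral\<^sup>L (P s \<eta> \<bind> P t) f = (\<integral>x. integral\<^sup>L (P t x) f \<partial>P s \<eta>)"
  proof (rule integral_bind[where K = borel and B = K and B' = 1])
    show "f \<in> borel_measurable borel" by (rule borel_measurable_continuous_onI[OF f(1)])
    show "P t \<in> P s \<eta> \<rightarrow>\<^sub>M subprob_algebra borel"
      using measurable_prob_algebraD[OF P_kernel[OF t]] by (simp cong: measurable_cong_sets add: P_sets[OF s])
    show "AE x in P s \<eta>. emeasure (P t x) (space (P t x)) \<le> ennreal 1"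
      using prob_space.emeasure_space_1[OF P_prob[OF t]] by simp
  qed (use f(2) finite_measure_axioms in auto)
  ultimately show ?thesis by (simp add: semi_def[abs_def])
qed

text \<open>\<open>ssep_transition\<close> supplies only a uniform right derivative at time 0.
  Contractivity carries it to the right derivative at t. From the left, the quotient at y < t is the
  semigroup at time y applied to a quotient near g, and it is compared with the semigroup at time y
  applied to the evolution of g over t - y, which is near g as well.\<close>

lemma semi_deriv:
  assumes t: "0 \<le> t" and f: "local_fun f" "continuous_on UNIV f" "\<And>\<xi>. \<bar>f \<xi>\<bar> \<le> K"
    and g: "continuous_on UNIV (ssep_gen f)" "\<And>\<xi>. \<bar>ssep_gen f \<xi>\<bar> \<le> K'"
  shows "((\<lambda>t. semi P t f \<eta>) has_real_derivative semi P t (ssep_gen f) \<eta>) (at t within {0..})"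
proof -
  let ?g = "ssep_gen f"
  define Q where "Q h \<xi> = (semi P h f \<xi> - f \<xi>) / h" for h \<xi>
  have Qc: "continuous_on UNIV (Q h)" if "0 < h" for h
    unfolding Q_def[abs_def] using that by (intro continuous_intros semi_continuous f) auto
  have Qb: "\<bar>Q h \<xi>\<bar> \<le> 2 * K / h" if "0 < h" for h \<xi>
    using semi_mono_bound[OF _ f(2,3), of h \<xi>] f(3)[of \<xi>] that
    by (auto simp: Q_def divide_simps abs_le_iff)
  have quot: "(semi P (r + h) f \<eta> - semi P r f \<eta>) / h = semi P r (Q h) \<eta>" if "0 \<le> r" "0 < h" for r h
  proof -
    have "semi P r (Q h) \<eta> = semi P r (\<lambda>\<xi>. semi P h f \<xi> - f \<xi>) \<eta> / h"
      unfolding Q_def by (rule semi_divide)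
    also have "semi P r (\<lambda>\<xi>. semi P h f \<xi> - f \<xi>) \<eta> = semi P r (semi P h f) \<eta> - semi P r f \<eta>"
      using that by (intro semi_diff[where K = K and K' = K] semi_continuous semi_mono_bound f) auto
    finally show ?thesis using that by (simp add: semi_semigroup[OF _ _ f(2,3)])
  qed
  have lim1: "\<forall>\<^sub>F h in at_right 0. \<forall>\<xi>. \<bar>Q h \<xi> - ?g \<xi>\<bar> < \<epsilon>" if "0 < \<epsilon>" for \<epsilon>
  proof -
    have "uniform_limit UNIV Q ?g (at_right 0)"
      using P f(1) unfolding ssep_transition_def Q_def[abs_def] semi_def by blast
    from uniform_limitD[OF this that] show ?thesis by (simp add: dist_real_def)
  qed
  have lim2: "\<forall>\<^sub>F h in at_right 0. \<forall>\<xi>. \<bar>semi P h ?g \<xi> - ?g \<xi>\<bar> < \<epsilon>" if "0 < \<epsilon>" for \<epsilon>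
  proof -
    have "uniform_limit UNIV (\<lambda>t. semi P t ?g) ?g (at_right 0)"
      using P g(1) unfolding ssep_transition_def semi_def by blast
    from uniform_limitD[OF this that] show ?thesis by (simp add: dist_real_def)
  qed
  have close: "\<bar>semi P r a \<eta> - semi P r b \<eta>\<bar> \<le> \<epsilon>"
    if "0 \<le> r" "continuous_on UNIV a" "continuous_on UNIV b" "\<And>\<xi>. \<bar>a \<xi>\<bar> \<le> A" "\<And>\<xi>. \<bar>b \<xi>\<bar> \<le> B" "\<And>\<xi>. \<bar>a \<xi> - b \<xi>\<bar> \<le> \<epsilon>"
    for r a b A B \<epsilon>
  proof -
    have "\<bar>semi P r (\<lambda>\<xi>. a \<xi> - b \<xi>) \<eta>\<bar> \<le> \<epsilon>"
      using that by (intro semi_mono_bound continuous_intros) auto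
    then show ?thesis by (simp add: semi_diff[OF that(1,2,4,3,5)])
  qed
  show ?thesis
    unfolding has_field_derivative_iff
  proof (rule tendstoI)
    fix \<epsilon> :: real assume e: "0 < \<epsilon>"
    have "\<forall>\<^sub>F h in at_right 0. (\<forall>\<xi>. \<bar>Q h \<xi> - ?g \<xi>\<bar> < \<epsilon> / 4) \<and> (\<forall>\<xi>. \<bar>semi P h ?g \<xi> - ?g \<xi>\<bar> < \<epsilon> / 4)"
      using e by (intro eventually_conj lim1 lim2) auto
    then obtain \<delta> where \<delta>: "0 < \<delta>" and
      Qd: "\<And>h \<xi>. 0 < h \<Longrightarrow> h < \<delta> \<Longrightarrow> \<bar>Q h \<xi> - ?g \<xi>\<bar> < \<epsilon> / 4" and
      Sd: "\<And>h \<xi>. 0 < h \<Longrightarrow> h < \<delta> \<Longrightarrow> \<bar>semi P h ?g \<xi> - ?g \<xi>\<bar> < \<epsilon> / 4"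
      unfolding eventually_at_right_field by auto
    have "dist ((semi P y f \<eta> - semi P t f \<eta>) / (y - t)) (semi P t ?g \<eta>) < \<epsilon>"
      if y: "y \<in> {0..}" "y \<noteq> t" "dist y t < \<delta>" for y
    proof (cases "t < y")
      case True
      then have h: "0 < y - t" "y - t < \<delta>" using y by (auto simp: dist_real_def)
      have "(semi P y f \<eta> - semi P t f \<eta>) / (y - t) = semi P t (Q (y - t)) \<eta>"
        using quot[OF t h(1)] by simp
      moreover have "\<bar>semi P t (Q (y - t)) \<eta> - semi P t ?g \<eta>\<bar> \<le> \<epsilon> / 4"
        using Qd[OF h] by (intro close[OF t Qc[OF h(1)] g(1) Qb[OF h(1)] g(2)] less_imp_le)
      ultimately show ?thesis using e by (simp add: dist_real_def)
    next
      case False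
      then have h: "0 < t - y" "t - y < \<delta>" "0 \<le> y" using y by (auto simp: dist_real_def)
      have "(semi P y f \<eta> - semi P t f \<eta>) / (y - t) = (semi P (y + (t - y)) f \<eta> - semi P y f \<eta>) / (t - y)"
        using h by (simp add: field_simps)
      also have "\<dots> = semi P y (Q (t - y)) \<eta>" by (rule quot[OF h(3,1)])
      finally have eq: "(semi P y f \<eta> - semi P t f \<eta>) / (y - t) = semi P y (Q (t - y)) \<eta>" .
      have "semi P t ?g \<eta> = semi P y (semi P (t - y) ?g) \<eta>"
        using semi_semigroup[OF h(3) _ g, of "t - y" \<eta>] h by simp
      moreover have "\<bar>semi P y (Q (t - y)) \<eta> - semi P y (semi P (t - y) ?g) \<eta>\<bar> \<le> \<epsilon> / 2"
      proof (rule close[OF h(3) Qc[OF h(1)] _ Qb[OF h(1)]])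
        show "continuous_on UNIV (semi P (t - y) ?g)" using h by (intro semi_continuous g) auto
        show "\<bar>semi P (t - y) ?g \<xi>\<bar> \<le> K'" for \<xi> using h by (intro semi_mono_bound g) auto
        show "\<bar>Q (t - y) \<xi> - semi P (t - y) ?g \<xi>\<bar> \<le> \<epsilon> / 2" for \<xi>
          using Qd[OF h(1,2), of \<xi>] Sd[OF h(1,2), of \<xi>] by linarith
      qed
      ultimately show ?thesis using e eq by (simp add: dist_real_def)
    qed
    then show "\<forall>\<^sub>F y in at t within {0..}. dist ((semi P y f \<eta> - semi P t f \<eta>) / (y - t)) (semi P t ?g \<eta>) < \<epsilon>"
      unfolding eventually_at using \<delta> by blast
  qed
qed

lemma semi_interior:
  assumes "\<And>t. 0 \<le> t \<Longrightarrow> (f has_real_derivative f' t) (at t within {0..})"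
  shows "0 < t \<Longrightarrow> (f has_real_derivative f' t) (at t)" "continuous_on {0..T} f"
proof -
  assume t: "0 < t"
  then have "at t within {0..} = at t" by (intro at_within_interior) auto
  then show "(f has_real_derivative f' t) (at t)" using assms[of t] t by simp
next
  have "continuous_on {0..} f" using assms by (intro DERIV_continuous_on) auto
  then show "continuous_on {0..T} f" by (rule continuous_on_subset) auto
qed

text \<open>The equations for the one-point functions close among themselves, so uniqueness for the
  heat equation determines the density for every admissible \<open>P\<close>.\<close>

lemma semi_occ:
  assumes t: "0 \<le> t"
  shows "semi P t (occ x) \<eta> = heat units t (indicator {x. \<eta> x}) x"
proof -
  have gen: "ssep_gen (occ x) = (\<lambda>\<eta>. avg units (\<lambda>y. occ y \<eta>) x - occ x \<eta>)" for x :: "'n site"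
    by (rule ext) (rule ssep_gen_occ)
  have gc: "continuous_on UNIV (\<lambda>\<eta>. avg units (\<lambda>y. occ y \<eta>) x)" for x :: "'n site"
    unfolding avg_def by (intro continuous_intros occ_continuous) (auto simp: card_units)
  have gb: "\<bar>avg units (\<lambda>y. occ y \<eta>) x\<bar> \<le> 1" for x :: "'n site" and \<eta>
    by (rule U.avg_bound) (rule occ_bound)
  have der: "((\<lambda>t. semi P t (occ x) \<eta>) has_real_derivative avg units (\<lambda>y. semi P t (occ y) \<eta>) x - semi P t (occ x) \<eta>) (at t within {0..})"
    if "0 \<le> t" for t x
  proof -
    have "((\<lambda>t. semi P t (occ x) \<eta>) has_real_derivative semi P t (ssep_gen (occ x)) \<eta>) (at t within {0..})"
    proof (rule semi_deriv[OF that local_fun_occ occ_continuous occ_bound(3)])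
      show "\<bar>ssep_gen (occ x) \<xi>\<bar> \<le> 2" for \<xi>
        using gb[of \<xi> x] occ_bound(3)[of x \<xi>] unfolding gen by linarith
    qed (auto simp: gen intro!: continuous_intros gc occ_continuous)
    also have "semi P t (ssep_gen (occ x)) \<eta> = semi P t (\<lambda>\<eta>. avg units (\<lambda>y. occ y \<eta>) x) \<eta> - semi P t (occ x) \<eta>"
      unfolding gen by (rule semi_diff[OF that gc gb occ_continuous occ_bound(3)])
    also have "semi P t (\<lambda>\<eta>. avg units (\<lambda>y. occ y \<eta>) x) \<eta> = avg units (\<lambda>y. semi P t (occ y) \<eta>) x"
      unfolding avg_def semi_divide by (subst semi_sum[OF that, where K = 1]) (auto intro: occ_continuous occ_bound)
    finally show ?thesis .
  qed
  have "semi P t (occ x) \<eta> = heat units t (\<lambda>x. semi P 0 (occ x) \<eta>) x"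
    by (rule U.heat_unique[where y = "\<lambda>t x. semi P t (occ x) \<eta>" and K = 1])
      (auto intro!: semi_interior[OF der] semi_mono_bound occ_continuous occ_bound t)
  also have "(\<lambda>x. semi P 0 (occ x) \<eta>) = indicator {x. \<eta> x}"
    by (auto simp: semi_0[OF occ_continuous] occ_def indicator_def)
  finally show ?thesis .
qed

section \<open>Negated covariances and their evolution\<close>

text \<open>By \<open>semi_occ\<close> the two heat factors are the one-point expectations. With
  this sign the quantity is nonnegative off the diagonal.\<close>

definition ncov :: "'n config \<Rightarrow> real \<Rightarrow> 'n site \<times> 'n site \<Rightarrow> real" where
  "ncov \<eta> t p = heat units t (indicator {x. \<eta> x}) (fst p) * heat units t (indicator {x. \<eta> x}) (snd p) - semi P t (occ2 p) \<eta>"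

definition source :: "'n config \<Rightarrow> real \<Rightarrow> 'n site \<times> 'n site \<Rightarrow> real" where
  "source \<eta> t p = of_bool (nearest_nbr (fst p) (snd p)) *
     (heat units t (indicator {x. \<eta> x}) (fst p) - heat units t (indicator {x. \<eta> x}) (snd p))\<^sup>2 / (2 * real CARD('n))"

lemma source_nonneg: "0 \<le> source \<eta> t p"
  by (simp add: source_def)

lemma semi_occ2_deriv:
  assumes p: "fst p \<noteq> snd p" and t: "0 \<le> t"
  shows "((\<lambda>t. semi P t (occ2 p) \<eta>) has_real_derivative excl (\<lambda>p. semi P t (occ2 p) \<eta>) p) (at t within {0..})"
proof -
  let ?I = "nbr_pairs p"
  have gen: "ssep_gen (occ2 p) = (\<lambda>\<eta>. (\<Sum>q\<in>?I. occ2 q \<eta> - occ2 p \<eta>) / (2 * real CARD('n)))"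
    by (rule ext) (simp add: ssep_gen_occ2[OF p] excl_def)
  have b: "\<bar>occ2 q \<eta> - occ2 p \<eta>\<bar> \<le> 2" for q \<eta>
    using occ2_bound(3)[of q \<eta>] occ2_bound(3)[of p \<eta>] by linarith
  have "((\<lambda>t. semi P t (occ2 p) \<eta>) has_real_derivative semi P t (ssep_gen (occ2 p)) \<eta>) (at t within {0..})"
  proof (rule semi_deriv[OF t local_fun_occ2 occ2_continuous occ2_bound(3)])
    show "\<bar>ssep_gen (occ2 p) \<xi>\<bar> \<le> real (card ?I) * 2 / (2 * real CARD('n))" for \<xi>
    proof -
      have "\<bar>\<Sum>q\<in>?I. occ2 q \<xi> - occ2 p \<xi>\<bar> / (2 * real CARD('n)) \<le> real (card ?I) * 2 / (2 * real CARD('n))"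
        using sum_norm_bound[of ?I "\<lambda>q. occ2 q \<xi> - occ2 p \<xi>" 2] b by (intro divide_right_mono) auto
      then show ?thesis unfolding gen by (simp add: abs_divide)
    qed
    show "continuous_on UNIV (ssep_gen (occ2 p))"
      unfolding gen by (intro continuous_intros occ2_continuous) auto
  qed
  also have "semi P t (ssep_gen (occ2 p)) \<eta> = excl (\<lambda>p. semi P t (occ2 p) \<eta>) p"
    unfolding gen excl_def semi_divide
    by (subst semi_sum[OF t, where K = 2])
       (auto intro!: continuous_intros occ2_continuous b semi_diff[OF t, where K = 1 and K' = 1] occ2_bound
          arg_cong2[where f = "(/)"] sum.cong)
  finally show ?thesis .
qed

lemma ncov_deriv:
  assumes p: "fst p \<noteq> snd p" and t: "0 \<le> t"
  shows "((\<lambda>t. ncov \<eta> t p) has_real_derivative excl (ncov \<eta> t) p + source \<eta> t p) (at t within {0..})"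
proof -
  obtain x y where xy: "p = (x, y)" "x \<noteq> y" using p by (cases p) auto
  let ?u = "heat units t (indicator {x. \<eta> x})"
  have u: "((\<lambda>t. heat units t (indicator {x. \<eta> x}) z) has_real_derivative avg units ?u z - ?u z) (at t within {0..})" for z
    by (rule has_field_derivative_at_within[OF U.heat_deriv[OF U.ind_bound]])
  have "((\<lambda>t. ncov \<eta> t p) has_real_derivative
     ((avg units ?u x - ?u x) * ?u y + ?u x * (avg units ?u y - ?u y)) - excl (\<lambda>p. semi P t (occ2 p) \<eta>) p) (at t within {0..})"
    unfolding ncov_def xy fst_conv snd_conv
    by (rule DERIV_cong[OF DERIV_diff[OF DERIV_mult[OF u[of x] u[of y]] semi_occ2_deriv[OF p[unfolded xy] t]]])
       (simp add: mult.commute)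
  also have "((avg units ?u x - ?u x) * ?u y + ?u x * (avg units ?u y - ?u y)) - excl (\<lambda>p. semi P t (occ2 p) \<eta>) p
      = excl (ncov \<eta> t) p + source \<eta> t p"
    unfolding avg_product[OF xy(2)]
    by (simp add: xy source_def excl_def ncov_def[abs_def] sum_subtractf diff_divide_distrib right_diff_distrib)
  finally show ?thesis .
qed

lemma ncov_bound: "0 \<le> t \<Longrightarrow> \<bar>ncov \<eta> t p\<bar> \<le> 1"
proof -
  assume t: "0 \<le> t"
  let ?u = "heat units t (indicator {x. \<eta> x})"
  have u: "0 \<le> ?u x" "?u x \<le> 1" for x
    using U.heat_nonneg[OF t, of "indicator {x. \<eta> x}" 1] U.heat_bound[OF t, of "indicator {x. \<eta> x}" 1 x]
    by (auto simp: U.ind_bound)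
  have "0 \<le> ?u (fst p) * ?u (snd p)" "?u (fst p) * ?u (snd p) \<le> 1"
    using u by (auto intro: mult_le_one)
  moreover have "0 \<le> semi P t (occ2 p) \<eta>" by (rule semi_nonneg) (rule occ2_bound)
  moreover have "semi P t (occ2 p) \<eta> \<le> 1"
    using semi_mono_bound[OF t occ2_continuous occ2_bound(3), of p \<eta>] by simp
  ultimately show ?thesis unfolding ncov_def by linarith
qed

lemma ncov_0: "ncov \<eta> 0 p = 0"
  by (simp add: ncov_def semi_0[OF occ2_continuous] occ2_def occ_def indicator_def)

lemma ncov_continuous: "fst p \<noteq> snd p \<Longrightarrow> continuous_on {0..T} (\<lambda>t. ncov \<eta> t p)"
  by (rule semi_interior(2)[OF ncov_deriv])

text \<open>The initial configuration is deterministic, so the covariances start at 0; their source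
  is nonnegative and the comparison principle for pairs applies.\<close>

lemma ncov_nonneg:
  assumes p: "fst p \<noteq> snd p" and t: "0 \<le> t"
  shows "0 \<le> ncov \<eta> t p"
proof (rule excl_nonneg[where y = "ncov \<eta>" and T = t and K = 1])
  show "\<exists>D. ((\<lambda>t. ncov \<eta> t p) has_real_derivative D) (at t) \<and> excl (ncov \<eta> t) p \<le> D"
    if "fst p \<noteq> snd p" "0 < t" for p t
    using semi_interior(1)[OF ncov_deriv, OF that(1) _ that(2)] source_nonneg by (metis le_add_same_cancel1)
  show "- 1 \<le> ncov \<eta> t p" if "0 \<le> t" for t p using ncov_bound[OF that, of \<eta> p] by linarith
qed (use p t ncov_continuous in \<open>auto simp: ncov_0\<close>)

text \<open>The densities of the two parts add up and the source is quadratic in the gradient, so it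
  is dominated by twice the sum of the two sources. The pair equation is linear, and comparison
  transfers this to the solutions.\<close>

lemma ncov_split:
  assumes dis: "\<And>x. \<eta> x \<longleftrightarrow> \<eta>1 x \<or> \<eta>2 x" "\<And>x. \<not> (\<eta>1 x \<and> \<eta>2 x)"
    and p: "fst p \<noteq> snd p" and t: "0 \<le> t"
  shows "ncov \<eta> t p \<le> 2 * ncov \<eta>1 t p + 2 * ncov \<eta>2 t p"
proof -
  let ?y = "\<lambda>t p. 2 * ncov \<eta>1 t p + 2 * ncov \<eta>2 t p - ncov \<eta> t p"
  have "0 \<le> ?y t p"
  \<comment> \<open>\<open>K = 5\<close> is 2 + 2 + 1, since each \<open>ncov\<close> is at most 1
    in absolute value.\<close>
  proof (rule excl_nonneg[where y = ?y and T = t and K = 5])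
    fix p :: "'n site \<times> 'n site" and t :: real assume p: "fst p \<noteq> snd p" and t: "0 < t"
    have ind: "indicator {x. \<eta> x} = (\<lambda>x. indicator {x. \<eta>1 x} x + 1 * indicator {x. \<eta>2 x} x :: real)"
      using dis by (auto simp: indicator_def fun_eq_iff)
    have u: "heat units t (indicator {x. \<eta> x}) z = heat units t (indicator {x. \<eta>1 x}) z + heat units t (indicator {x. \<eta>2 x}) z" for z
      unfolding ind by (subst U.heat_add[OF U.ind_bound U.ind_bound]) simp
    have sq: "(a + b - (c + d))\<^sup>2 \<le> 2 * (a - c)\<^sup>2 + 2 * (b - d)\<^sup>2" for a b c d :: real
      using zero_le_power2[of "(a - c) - (b - d)"] by (simp add: power2_eq_square algebra_simps)
    have src: "source \<eta> t p \<le> 2 * source \<eta>1 t p + 2 * source \<eta>2 t p"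
    proof -
      let ?u1 = "heat units t (indicator {x. \<eta>1 x})" and ?u2 = "heat units t (indicator {x. \<eta>2 x})"
        and ?b = "of_bool (nearest_nbr (fst p) (snd p)) :: real"
      have "source \<eta> t p = ?b * (?u1 (fst p) + ?u2 (fst p) - (?u1 (snd p) + ?u2 (snd p)))\<^sup>2 / (2 * real CARD('n))"
        by (simp only: source_def u)
      also have "\<dots> \<le> ?b * (2 * (?u1 (fst p) - ?u1 (snd p))\<^sup>2 + 2 * (?u2 (fst p) - ?u2 (snd p))\<^sup>2) / (2 * real CARD('n))"
        by (intro divide_right_mono mult_left_mono sq) auto
      also have "\<dots> = 2 * source \<eta>1 t p + 2 * source \<eta>2 t p"
        unfolding source_def by (simp add: distrib_left add_divide_distrib)
      finally show ?thesis .
    qed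
    have d: "((\<lambda>t. ncov \<xi> t p) has_real_derivative excl (ncov \<xi> t) p + source \<xi> t p) (at t)" for \<xi>
      by (rule semi_interior(1)[OF ncov_deriv, OF p _ t])
    have dd: "((\<lambda>t. ?y t p) has_real_derivative
      2 * (excl (ncov \<eta>1 t) p + source \<eta>1 t p) + 2 * (excl (ncov \<eta>2 t) p + source \<eta>2 t p) - (excl (ncov \<eta> t) p + source \<eta> t p)) (at t)"
      by (intro DERIV_diff DERIV_add DERIV_cmult d)
    have eq: "excl (?y t) p = 2 * excl (ncov \<eta>1 t) p + 2 * excl (ncov \<eta>2 t) p - excl (ncov \<eta> t) p"
      by (simp add: excl_def sum_subtractf sum.distrib sum_distrib_left[symmetric] diff_divide_distrib add_divide_distrib
          algebra_simps flip: sum_distrib_left)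
    have arith: "2 * a1 + 2 * a2 - a \<le> 2 * (a1 + s1) + 2 * (a2 + s2) - (a + s)"
      if "s \<le> 2 * s1 + 2 * s2" for a a1 a2 s s1 s2 :: real
      using that by (simp add: distrib_left)
    have "excl (?y t) p \<le> 2 * (excl (ncov \<eta>1 t) p + source \<eta>1 t p) +
        2 * (excl (ncov \<eta>2 t) p + source \<eta>2 t p) - (excl (ncov \<eta> t) p + source \<eta> t p)"
      unfolding eq by (rule arith[OF src])
    then show "\<exists>D. ((\<lambda>t. ?y t p) has_real_derivative D) (at t) \<and> excl (?y t) p \<le> D"
      using dd by blast
  next
    fix p :: "'n site \<times> 'n site" and t :: real assume "0 \<le> t"
    then show "- 5 \<le> ?y t p"
      using ncov_bound[of t \<eta> p] ncov_bound[of t \<eta>1 p] ncov_bound[of t \<eta>2 p] by linarith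
  qed (use p t ncov_continuous in \<open>auto simp: ncov_0 intro!: continuous_intros\<close>)
  then show ?thesis by simp
qed

lemma ncov_le_product:
  "ncov \<eta> t p \<le> heat units t (indicator {x. \<eta> x}) (fst p) * heat units t (indicator {x. \<eta> x}) (snd p)"
  using semi_nonneg[of "occ2 p" t \<eta>] occ2_bound(1)[of p] by (simp add: ncov_def)

end

section \<open>The energy inequality\<close>

lemma sum_antisym:
  fixes h :: "'a \<Rightarrow> 'a \<Rightarrow> real"
  assumes F: "finite F"
    and sym: "\<And>p r. p \<in> F \<Longrightarrow> r \<in> F \<Longrightarrow> r \<in> N p \<longleftrightarrow> p \<in> N r"
    and anti: "\<And>p r. h r p = - h p r"
  shows "(\<Sum>p\<in>F. \<Sum>r\<in>N p \<inter> F. h p r) = 0"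
proof -
  let ?H = "\<lambda>p r. if r \<in> N p then h p r else 0"
  have seq: "(\<Sum>p\<in>F. \<Sum>r\<in>N p \<inter> F. h p r) = (\<Sum>p\<in>F. \<Sum>r\<in>F. ?H p r)"
    by (rule sum.cong[OF refl], subst Int_commute) (rule sum.inter_restrict[OF F])
  have "(\<Sum>p\<in>F. \<Sum>r\<in>F. ?H p r) = (\<Sum>r\<in>F. \<Sum>p\<in>F. ?H p r)" by (rule sum.swap)
  also have "\<dots> = (\<Sum>r\<in>F. \<Sum>p\<in>F. - ?H r p)"
  proof (intro sum.cong refl)
    fix r p assume "r \<in> F" "p \<in> F"
    then show "?H p r = - ?H r p" using sym[of p r] anti[of p r] by simp
  qed
  also have "\<dots> = - (\<Sum>p\<in>F. \<Sum>r\<in>F. ?H p r)" by (simp only: sum_negf)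
  finally have "(\<Sum>p\<in>F. \<Sum>r\<in>F. ?H p r) = 0" by linarith
  then show ?thesis by (simp only: seq)
qed

abbreviation offdiag :: "('a \<times> 'a) set" where
  "offdiag \<equiv> {p. fst p \<noteq> snd p}"

text \<open>The two-particle generator is symmetric, so only the flux through the boundary of \<open>F\<close>
  survives.\<close>

lemma excl_flux:
  fixes v w :: "'n::finite site \<times> 'n site \<Rightarrow> real"
  assumes F: "finite F" "F \<subseteq> offdiag"
    and v: "\<And>p. p \<in> offdiag \<Longrightarrow> 0 \<le> v p" "\<And>p. p \<in> offdiag \<Longrightarrow> v p \<le> 1"
    and w: "\<And>p. 0 \<le> w p"
  shows "(\<Sum>p\<in>F. excl v p * w p - v p * excl w p) \<le> (\<Sum>p | p \<in> F \<and> \<not> nbr_pairs p \<subseteq> F. 2 * w p)"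
proof -
  let ?c = "1 / (2 * real CARD('n))" and ?h = "\<lambda>p r. v r * w p - v p * w r"
  let ?F' = "{p \<in> F. \<not> nbr_pairs p \<subseteq> F}"
  have fin: "finite (nbr_pairs p)" for p :: "'n site \<times> 'n site"
    by (cases p) (simp add: finite_nbr_pairs)
  have "(\<Sum>p\<in>F. excl v p * w p - v p * excl w p) = (\<Sum>p\<in>F. ?c * (\<Sum>r\<in>nbr_pairs p. ?h p r))"
  proof (rule sum.cong[OF refl])
    fix p
    have "excl v p * w p - v p * excl w p =
        ?c * ((\<Sum>r\<in>nbr_pairs p. v r - v p) * w p - v p * (\<Sum>r\<in>nbr_pairs p. w r - w p))"
      by (simp add: excl_def right_diff_distrib)
    also have "(\<Sum>r\<in>nbr_pairs p. v r - v p) * w p - v p * (\<Sum>r\<in>nbr_pairs p. w r - w p) = (\<Sum>r\<in>nbr_pairs p. ?h p r)"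
      unfolding sum_distrib_left sum_distrib_right sum_subtractf[symmetric]
      by (intro sum.cong refl) (simp add: algebra_simps)
    finally show "excl v p * w p - v p * excl w p = ?c * (\<Sum>r\<in>nbr_pairs p. ?h p r)" .
  qed
  also have "\<dots> = ?c * (\<Sum>p\<in>F. \<Sum>r\<in>nbr_pairs p. ?h p r)" by (rule sum_distrib_left[symmetric])
  also have "(\<Sum>p\<in>F. \<Sum>r\<in>nbr_pairs p. ?h p r) =
      (\<Sum>p\<in>F. (\<Sum>r\<in>nbr_pairs p \<inter> F. ?h p r) + (\<Sum>r\<in>nbr_pairs p - F. ?h p r))"
    by (intro sum.cong refl sum.Int_Diff fin)
  also have "\<dots> = (\<Sum>p\<in>F. \<Sum>r\<in>nbr_pairs p - F. ?h p r)"
  proof -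
    have "(\<Sum>p\<in>F. \<Sum>r\<in>nbr_pairs p \<inter> F. ?h p r) = 0"
    proof (rule sum_antisym[OF F(1)])
      fix p r assume "p \<in> F" "r \<in> F"
      then have "fst p \<noteq> snd p" "fst r \<noteq> snd r" using F(2) by auto
      then show "r \<in> nbr_pairs p \<longleftrightarrow> p \<in> nbr_pairs r" by (intro nbr_pairs_sym)
    qed simp
    then show ?thesis by (simp add: sum.distrib)
  qed
  also have "\<dots> = (\<Sum>p\<in>?F'. \<Sum>r\<in>nbr_pairs p - F. ?h p r)"
  proof (rule sum.mono_neutral_right)
    show "\<forall>p\<in>F - ?F'. (\<Sum>r\<in>nbr_pairs p - F. ?h p r) = 0"
    proof
      fix p assume "p \<in> F - ?F'"
      then have "nbr_pairs p - F = {}" by blast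
      then show "(\<Sum>r\<in>nbr_pairs p - F. ?h p r) = 0" by (simp only: sum.empty)
    qed
  qed (use F in auto)
  finally have eq: "(\<Sum>p\<in>F. excl v p * w p - v p * excl w p) = ?c * (\<Sum>p\<in>?F'. \<Sum>r\<in>nbr_pairs p - F. ?h p r)" .
  have "(\<Sum>p\<in>?F'. \<Sum>r\<in>nbr_pairs p - F. ?h p r) \<le> (\<Sum>p\<in>?F'. 4 * real CARD('n) * w p)"
  proof (rule sum_mono)
    fix p assume p: "p \<in> ?F'"
    have "(\<Sum>r\<in>nbr_pairs p - F. ?h p r) \<le> (\<Sum>r\<in>nbr_pairs p - F. w p)"
    proof (rule sum_mono)
      fix r assume "r \<in> nbr_pairs p - F"
      then have "r \<in> offdiag" using nbr_pairs_distinct by blast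
      moreover have "p \<in> offdiag" using p F(2) by blast
      ultimately have "v r * w p \<le> 1 * w p" "0 \<le> v p * w r"
        using mult_right_mono[OF v(2)[of r] w[of p]] mult_nonneg_nonneg[OF v(1)[of p] w[of r]] by blast+
      then show "?h p r \<le> w p" by simp
    qed
    also have "\<dots> \<le> real (card (nbr_pairs p)) * w p"
      using fin[of p] w[of p] by (simp add: mult_right_mono card_mono)
    also have "\<dots> \<le> real (4 * CARD('n)) * w p"
      using card_nbr_pairs[of p] w[of p] by (intro mult_right_mono) (simp_all only: of_nat_le_iff)
    finally show "(\<Sum>r\<in>nbr_pairs p - F. ?h p r) \<le> 4 * real CARD('n) * w p" by simp
  qed
  then have "(\<Sum>p\<in>F. excl v p * w p - v p * excl w p) \<le> ?c * (\<Sum>p\<in>?F'. 4 * real CARD('n) * w p)"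
    unfolding eq by (rule mult_left_mono) simp
  also have "\<dots> = (\<Sum>p\<in>?F'. 2 * w p)" by (simp add: sum_distrib_left)
  finally show ?thesis by simp
qed

lemma sum_le_csum:
  assumes "finite F" "F \<subseteq> A"
  shows "(\<Sum>x\<in>F. f x) \<le> csum A f"
proof -
  have "(\<Sum>x\<in>F. f x) = csum F f" using assms by (simp add: nn_integral_count_space_finite)
  also have "\<dots> \<le> csum A f"
    unfolding csum_UNIV[of F] csum_UNIV[of A]
    by (intro nn_integral_mono) (use assms in \<open>auto simp: indicator_def\<close>)
  finally show ?thesis .
qed

lemma sum_heat_indicator:
  fixes B :: "'n::finite site set"
  assumes t: "0 \<le> t" and B: "finite B" and X: "finite X"
  shows "(\<Sum>x\<in>X. heat units t (indicator B) x) \<le> real (card B)"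
proof -
  have h0: "0 \<le> heat units t (indicator B) x" for x
    by (rule U.heat_nonneg[OF t U.ind_bound]) auto
  have "ennreal (\<Sum>x\<in>X. heat units t (indicator B) x) = (\<Sum>x\<in>X. ennreal (heat units t (indicator B) x))"
    using h0 by (simp add: sum_ennreal)
  also have "\<dots> \<le> csum UNIV (\<lambda>x. ennreal (heat units t (indicator B) x))"
    by (rule sum_le_csum[OF X]) auto
  also have "\<dots> = csum UNIV (\<lambda>x. csum UNIV (\<lambda>y. ennreal (ker units t (y - x)) * ennreal (indicator B y)))"
    by (intro nn_integral_cong U.heat_csum[OF t U.ind_bound]) auto
  also have "\<dots> = csum UNIV (\<lambda>y. csum UNIV (\<lambda>x. ennreal (ker units t (y - x))) * ennreal (indicator B y))"
    by (subst csum_swap) (simp add: nn_integral_multc)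
  also have "\<dots> = ennreal (real (card B))"
    using B by (simp add: U.csum_ker'[OF t] ennreal_indicator ennreal_of_nat_eq_real_of_nat)
  finally show ?thesis by simp
qed

context ssep
begin

text \<open>The pairing of the covariances at time \<open>s\<close> with the independent evolution of
  the indicator of \<open>B \<times> B\<close> over the remaining time \<open>t - s\<close> increases at most at the rate
  given by the source term, because independent walks spread faster than exclusion particles.\<close>

lemma ncov_energy:
  fixes B :: "'n site set"
  assumes t: "0 \<le> t" and B: "finite B"
    and R: "\<And>s F. 0 < s \<Longrightarrow> s < t \<Longrightarrow> finite F \<Longrightarrow> F \<subseteq> offdiag \<Longrightarrow>
      (\<Sum>p\<in>F. source \<eta> s p * (heat units (t - s) (indicator B) (fst p) * heat units (t - s) (indicator B) (snd p))) \<le> \<psi> s"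
    and \<Gamma>: "\<And>s. 0 < s \<Longrightarrow> s < t \<Longrightarrow> (\<Gamma> has_real_derivative \<psi> s) (at s)" "continuous_on {0..t} \<Gamma>"
  shows "(\<Sum>p\<in>B \<times> B \<inter> offdiag. ncov \<eta> t p) \<le> \<Gamma> t - \<Gamma> 0"
proof (rule field_le_epsilon)
  fix \<epsilon> :: real assume e: "0 < \<epsilon>"
  \<comment> \<open>The flux out of the finite set of pairs will be at most 2\<delta> per unit of
    time, hence at most \<epsilon> up to time t.\<close>
  define \<delta> where "\<delta> = \<epsilon> / (2 * (t + 1))"
  have \<delta>: "0 < \<delta>" "2 * \<delta> * t \<le> \<epsilon>" using e t by (auto simp: \<delta>_def field_simps)
  let ?k = "\<lambda>r. heat units r (indicator B)"
  define w where "w s p = ?k (t - s) (fst p) * ?k (t - s) (snd p)" for s and p :: "'n site \<times> 'n site"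
  \<comment> \<open>A majorant of \<open>w s\<close> for all s in [0, t], summable because
    \<open>B\<close> is finite; thus one finite set of pairs serves all times.\<close>
  define W where "W p = (exp t * ?k t (fst p)) * (exp t * ?k t (snd p))" for p
  have k0: "0 \<le> ?k r x" if "0 \<le> r" for r x
    by (rule U.heat_nonneg[OF that U.ind_bound]) auto
  have w0: "0 \<le> w s p" if "s \<le> t" for s p using that k0 by (simp add: w_def)
  have W0: "0 \<le> W p" for p using t k0 by (simp add: W_def)
  have wW: "w s p \<le> W p" if "0 \<le> s" "s \<le> t" for s p
    unfolding w_def W_def
    using that k0 t by (intro mult_mono U.ker_growth[where K = 1] U.ind_bound) auto
  have Wsum: "sum W F \<le> (exp t * real (card B))\<^sup>2" if "finite F" for F
  proof -
    have "sum W F \<le> sum W (fst ` F \<times> snd ` F)"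
      using that W0 by (intro sum_mono2) (auto simp: image_iff, force+)
    also have "\<dots> = (\<Sum>x\<in>fst ` F. exp t * ?k t x) * (\<Sum>x\<in>snd ` F. exp t * ?k t x)"
      by (simp only: sum_product sum.cartesian_product) (simp add: W_def case_prod_beta)
    also have "\<dots> = (exp t * (\<Sum>x\<in>fst ` F. ?k t x)) * (exp t * (\<Sum>x\<in>snd ` F. ?k t x))"
      by (simp only: sum_distrib_left)
    also have "\<dots> \<le> (exp t * real (card B)) * (exp t * real (card B))"
      using that k0[OF t] by (intro mult_mono mult_left_mono sum_heat_indicator[OF t B] mult_nonneg_nonneg sum_nonneg) auto
    finally show ?thesis by (simp add: power2_eq_square)
  qed
  have "W summable_on UNIV"
    by (rule nonneg_bdd_above_summable_on) (use W0 Wsum in \<open>auto intro!: bdd_aboveI2\<close>)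
  then obtain F0 where F0: "finite F0" "dist (sum W F0) (infsum W UNIV) \<le> \<delta>"
    using infsum_finite_approximation[of W UNIV \<delta>] \<delta> by auto
  have tail_W: "sum W F' \<le> \<delta>" if "finite F'" "F' \<inter> F0 = {}" for F'
  proof -
    have "sum W F0 + sum W F' = sum W (F0 \<union> F')" using F0 that by (subst sum.union_disjoint) auto
    also have "\<dots> \<le> infsum W UNIV"
      using F0 that W0 \<open>W summable_on UNIV\<close> by (intro finite_sum_le_infsum) auto
    finally show ?thesis using F0(2) by (simp add: dist_real_def)
  qed
  \<comment> \<open>Neighbours of \<open>F0\<close> are included, so a pair of \<open>F\<close> with
    a neighbour outside \<open>F\<close> lies outside \<open>F0\<close>, where little mass of
    \<open>W\<close> remains.\<close>
  define F where "F = (F0 \<union> (\<Union>p\<in>F0. nbr_pairs p) \<union> B \<times> B) \<inter> offdiag"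
  have fnb: "finite (nbr_pairs p)" for p :: "'n site \<times> 'n site"
    by (cases p) (simp add: finite_nbr_pairs)
  have F: "finite F" "F \<subseteq> offdiag" using F0(1) B fnb by (auto simp: F_def)
  define \<Phi> where "\<Phi> s = (\<Sum>p\<in>F. ncov \<eta> s p * w s p)" for s
  have "\<Phi> t - 2 * \<delta> * t - \<Gamma> t \<le> \<Phi> 0 - 2 * \<delta> * 0 - \<Gamma> 0"
  proof (rule DERIV_nonpos_imp_decreasing_open[where f = "\<lambda>s. \<Phi> s - 2 * \<delta> * s - \<Gamma> s", OF t])
    have kc: "continuous_on {0..t} (\<lambda>s. ?k (t - s) x)" for x
      by (rule continuous_on_compose2[OF U.heat_continuous[OF U.ind_bound, of UNIV]]) (auto intro!: continuous_intros)
    show "continuous_on {0..t} (\<lambda>s. \<Phi> s - 2 * \<delta> * s - \<Gamma> s)"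
      unfolding \<Phi>_def w_def
      using F(2) by (intro continuous_intros kc ncov_continuous \<Gamma>) auto
    fix s assume s: "0 < s" "s < t"
    let ?u = "?k (t - s)"
    have kd: "((\<lambda>s. ?k (t - s) x) has_real_derivative - (avg units ?u x - ?u x)) (at s)" for x
      by (rule DERIV_cong[OF DERIV_chain2[where f = "\<lambda>s. ?k s x" and g = "\<lambda>s. t - s", OF U.heat_deriv[OF U.ind_bound]]])
         (auto intro!: derivative_eq_intros)
    \<comment> \<open>By \<open>avg_product\<close> the independent evolution fails to solve the
      backward exclusion equation by a term of one sign on neighbouring pairs, which can be
      discarded against \<open>ncov \<ge> 0\<close>.\<close>
    have wd: "((\<lambda>s. w s p) has_real_derivative
        - excl (w s) p - of_bool (nearest_nbr (fst p) (snd p)) * (?u (fst p) - ?u (snd p))\<^sup>2 / (2 * real CARD('n))) (at s)"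
      if "p \<in> offdiag" for p
    proof -
      have "((\<lambda>s. w s p) has_real_derivative
          - ((avg units ?u (fst p) - ?u (fst p)) * ?u (snd p) + ?u (fst p) * (avg units ?u (snd p) - ?u (snd p)))) (at s)"
        unfolding w_def by (rule DERIV_cong[OF DERIV_mult[OF kd kd]]) (simp add: algebra_simps)
      moreover have "fst p \<noteq> snd p" using that by simp
      ultimately show ?thesis unfolding avg_product[OF \<open>fst p \<noteq> snd p\<close>] w_def[abs_def] by simp
    qed
    have nd: "((\<lambda>s. ncov \<eta> s p) has_real_derivative excl (ncov \<eta> s) p + source \<eta> s p) (at s)" if "p \<in> offdiag" for p
      by (rule semi_interior(1)[OF ncov_deriv, OF _ _ s(1)]) (use that in auto)
    let ?g = "\<lambda>p. of_bool (nearest_nbr (fst p) (snd p)) * (?u (fst p) - ?u (snd p))\<^sup>2 / (2 * real CARD('n))"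
    let ?D = "\<lambda>p. (excl (ncov \<eta> s) p + source \<eta> s p) * w s p + (- excl (w s) p - ?g p) * ncov \<eta> s p"
    have "(\<Phi> has_real_derivative (\<Sum>p\<in>F. ?D p)) (at s)"
      unfolding \<Phi>_def using F(2) by (intro DERIV_sum DERIV_mult nd wd) auto
    then have d: "((\<lambda>s. \<Phi> s - 2 * \<delta> * s - \<Gamma> s) has_real_derivative (\<Sum>p\<in>F. ?D p) - 2 * \<delta> - \<psi> s) (at s)"
      by (auto intro!: derivative_eq_intros \<Gamma> s)
    have "(\<Sum>p\<in>F. ?D p) \<le> (\<Sum>p\<in>F. (excl (ncov \<eta> s) p * w s p - ncov \<eta> s p * excl (w s) p) + source \<eta> s p * w s p)"
    proof (rule sum_mono)
      fix p assume "p \<in> F"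
      then have "0 \<le> ncov \<eta> s p" using F(2) s by (intro ncov_nonneg) auto
      then have "0 \<le> ?g p * ncov \<eta> s p" by simp
      then show "?D p \<le> (excl (ncov \<eta> s) p * w s p - ncov \<eta> s p * excl (w s) p) + source \<eta> s p * w s p"
        by (simp add: algebra_simps)
    qed
    also have "\<dots> = (\<Sum>p\<in>F. excl (ncov \<eta> s) p * w s p - ncov \<eta> s p * excl (w s) p) + (\<Sum>p\<in>F. source \<eta> s p * w s p)"
      by (rule sum.distrib)
    also have "(\<Sum>p\<in>F. source \<eta> s p * w s p) \<le> \<psi> s"
      unfolding w_def by (rule R[OF s F])
    also have "(\<Sum>p\<in>F. excl (ncov \<eta> s) p * w s p - ncov \<eta> s p * excl (w s) p)
        \<le> (\<Sum>p | p \<in> F \<and> \<not> nbr_pairs p \<subseteq> F. 2 * w s p)"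
    proof (rule excl_flux[OF F])
      fix p :: "'n site \<times> 'n site" assume "p \<in> offdiag"
      then show "0 \<le> ncov \<eta> s p" using s by (intro ncov_nonneg) auto
      show "ncov \<eta> s p \<le> 1" using ncov_bound[of s \<eta> p] s by simp
    qed (use s w0 in simp)
    also have "\<dots> \<le> (\<Sum>p | p \<in> F \<and> \<not> nbr_pairs p \<subseteq> F. 2 * W p)"
      using s wW by (intro sum_mono mult_left_mono) auto
    also have "\<dots> = 2 * sum W {p \<in> F. \<not> nbr_pairs p \<subseteq> F}" by (simp add: sum_distrib_left)
    also have "sum W {p \<in> F. \<not> nbr_pairs p \<subseteq> F} \<le> \<delta>"
    proof (rule tail_W)
      have "nbr_pairs p \<subseteq> F" if "p \<in> F0" for p
        using that nbr_pairs_distinct unfolding F_def by blast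
      then show "{p \<in> F. \<not> nbr_pairs p \<subseteq> F} \<inter> F0 = {}" by blast
    qed (use F in auto)
    finally have "(\<Sum>p\<in>F. ?D p) - 2 * \<delta> - \<psi> s \<le> 0" by simp
    then show "\<exists>y. ((\<lambda>s. \<Phi> s - 2 * \<delta> * s - \<Gamma> s) has_real_derivative y) (at s) \<and> y \<le> 0"
      using d by blast
  qed
  moreover have "\<Phi> 0 = 0" by (simp add: \<Phi>_def ncov_0)
  \<comment> \<open>At the final time \<open>w\<close> is the indicator of B x B, whose off-diagonal
    part is contained in \<open>F\<close>.\<close>
  moreover have "\<Phi> t = (\<Sum>p\<in>B \<times> B \<inter> offdiag. ncov \<eta> t p)"
    unfolding \<Phi>_def
    by (rule sum.mono_neutral_cong_right[OF F(1)]) (auto simp: F_def w_def indicator_def)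
  ultimately show "(\<Sum>p\<in>B \<times> B \<inter> offdiag. ncov \<eta> t p) \<le> \<Gamma> t - \<Gamma> 0 + \<epsilon>"
    using \<delta>(2) by linarith
qed

text \<open>Sites of \<open>B\<close> are at level n or above, so the evolved indicator of
  \<open>B\<close> is below the tail. Each edge occurs with both orientations; with 1/(2d) \<le> 1/2
  the two halves combine, after a translation, into one term per undirected edge.\<close>

lemma source_sum:
  fixes B :: "'n site set"
  assumes s: "0 \<le> s" and r: "0 \<le> r" and F: "finite F"
    and B: "\<And>x. x \<in> B \<Longrightarrow> n \<le> x $ k"
  shows "ennreal (\<Sum>p\<in>F. source \<eta> s p * (heat units r (indicator B) (fst p) * heat units r (indicator B) (snd p)))
    \<le> (\<Sum>i\<in>UNIV. csum UNIV (\<lambda>a. ennreal ((heat units s (indicator {x. \<eta> x}) a - heat units s (indicator {x. \<eta> x}) (a + axis i 1))\<^sup>2 *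
      tail (r / real CARD('n)) (n - a $ k) * tail (r / real CARD('n)) (n - (a + axis i 1) $ k))))"
proof -
  let ?u = "heat units s (indicator {x. \<eta> x})" and ?k = "heat units r (indicator B)"
  let ?h = "\<lambda>a :: 'n site. tail (r / real CARD('n)) (n - a $ k)"
  let ?c = "1 / (2 * real CARD('n))"
  let ?f = "\<lambda>x y. (?u x - ?u y)\<^sup>2 * ?h x * ?h y"
  have k0: "0 \<le> ?k x" for x
    by (rule U.heat_nonneg[OF r U.ind_bound]) auto
  have h0: "0 \<le> ?h x" for x using r by (intro tail_nonneg) auto
  have kh: "?k x \<le> ?h x" for x
    unfolding heat_units_tail[OF r, symmetric]
    by (rule U.heat_mono[OF r U.ind_bound U.ind_bound]) (use B in \<open>auto simp: indicator_def\<close>)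
  have f0: "0 \<le> ?f x y" for x y using h0 by simp
  have sk: "source \<eta> s (x, y) * (?k x * ?k y) \<le> of_bool (nearest_nbr x y) * (?f x y / 2)" for x y
  proof -
    have "source \<eta> s (x, y) * (?k x * ?k y) \<le> source \<eta> s (x, y) * (?h x * ?h y)"
      using k0 h0 kh by (intro mult_left_mono mult_mono source_nonneg) auto
    also have "\<dots> = ?c * (of_bool (nearest_nbr x y) * ?f x y)" by (simp add: source_def mult_ac)
    also have "\<dots> \<le> 1 / 2 * (of_bool (nearest_nbr x y) * ?f x y)"
    proof (intro mult_right_mono)
      have "1 \<le> real CARD('n)" by (simp add: Suc_leI)
      then show "?c \<le> 1 / 2" by (simp add: field_simps)
    qed (use f0 in auto)
    finally show ?thesis by simp
  qed
  have "ennreal (\<Sum>p\<in>F. source \<eta> s p * (?k (fst p) * ?k (snd p))) =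
      (\<Sum>p\<in>F. ennreal (source \<eta> s p * (?k (fst p) * ?k (snd p))))"
    using k0 source_nonneg by (intro sum_ennreal[symmetric]) auto
  also have "\<dots> \<le> csum UNIV (\<lambda>p. ennreal (source \<eta> s p * (?k (fst p) * ?k (snd p))))"
    using F by (intro sum_le_csum) auto
  also have "\<dots> = csum UNIV (\<lambda>x. csum UNIV (\<lambda>y. ennreal (source \<eta> s (x, y) * (?k x * ?k y))))"
    using nn_integral_fst_count_space[of "\<lambda>p. ennreal (source \<eta> s p * (?k (fst p) * ?k (snd p)))"] by simp
  also have "\<dots> \<le> csum UNIV (\<lambda>x. \<Sum>e\<in>units. ennreal (?f x (x + e) / 2))"
  proof (rule nn_integral_mono)
    fix x
    have "csum UNIV (\<lambda>y. ennreal (source \<eta> s (x, y) * (?k x * ?k y))) \<le>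
        csum UNIV (\<lambda>y. ennreal (?f x y / 2) * indicator ((+) x ` units) y)"
    proof (rule nn_integral_mono)
      fix y
      show "ennreal (source \<eta> s (x, y) * (?k x * ?k y)) \<le> ennreal (?f x y / 2) * indicator ((+) x ` units) y"
        using sk[of x y] unfolding nearest_nbr_image[symmetric]
        by (cases "nearest_nbr x y") (auto simp: ennreal_leI ennreal_eq_0_iff)
    qed
    also have "\<dots> = (\<Sum>y\<in>(+) x ` units. ennreal (?f x y / 2))"
      by (subst nn_integral_indicator_finite) (auto simp: U.fin)
    also have "\<dots> = (\<Sum>e\<in>units. ennreal (?f x (x + e) / 2))"
      by (subst sum.reindex) (auto simp: inj_on_def)
    finally show "csum UNIV (\<lambda>y. ennreal (source \<eta> s (x, y) * (?k x * ?k y))) \<le> (\<Sum>e\<in>units. ennreal (?f x (x + e) / 2))" .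
  qed
  also have "\<dots> = (\<Sum>e\<in>units. csum UNIV (\<lambda>x. ennreal (?f x (x + e) / 2)))"
    by (rule nn_integral_sum) auto
  also have "\<dots> = (\<Sum>i\<in>UNIV. csum UNIV (\<lambda>x. ennreal (?f x (x + axis i 1) / 2)) + csum UNIV (\<lambda>x. ennreal (?f x (x + - axis i 1) / 2)))"
    by (rule sum_units)
  also have "\<dots> = (\<Sum>i\<in>UNIV. csum UNIV (\<lambda>x. ennreal (?f x (x + axis i 1))))"
  proof (rule sum.cong[OF refl])
    fix i :: 'n
    let ?e = "axis i 1 :: 'n site"
    have "csum UNIV (\<lambda>x. ennreal (?f x (x + - ?e) / 2)) = csum UNIV (\<lambda>x. ennreal (?f (x + ?e) (x + ?e + - ?e) / 2))"
      by (rule csum_translate[symmetric])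
    also have "\<dots> = csum UNIV (\<lambda>x. ennreal (?f x (x + ?e) / 2))"
      by (intro nn_integral_cong) (simp add: power2_commute mult_ac)
    finally have "csum UNIV (\<lambda>x. ennreal (?f x (x + ?e) / 2)) + csum UNIV (\<lambda>x. ennreal (?f x (x + - ?e) / 2)) =
        csum UNIV (\<lambda>x. ennreal (?f x (x + ?e) / 2) + ennreal (?f x (x + ?e) / 2))"
      by (simp add: nn_integral_add)
    also have "\<dots> = csum UNIV (\<lambda>x. ennreal (?f x (x + ?e)))"
    proof (rule nn_integral_cong)
      have half: "ennreal (a / 2) + ennreal (a / 2) = ennreal a" if "0 \<le> a" for a
        using that by (subst ennreal_plus[symmetric]) auto
      show "ennreal (?f x (x + ?e) / 2) + ennreal (?f x (x + ?e) / 2) = ennreal (?f x (x + ?e))" for x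
        by (rule half[OF f0])
    qed
    finally show "csum UNIV (\<lambda>x. ennreal (?f x (x + ?e) / 2)) + csum UNIV (\<lambda>x. ennreal (?f x (x + - ?e) / 2)) = csum UNIV (\<lambda>x. ennreal (?f x (x + ?e)))" .
  qed
  finally show ?thesis .
qed

text \<open>The product bound summed over pairs is at most the square of the summed density.
  Exchanging the sums turns the density above level n into the sum over the initial particles of
  their probabilities of ending there.\<close>

lemma ncov_mass:
  fixes B :: "'n site set"
  assumes t: "0 \<le> t" and B: "finite B" "\<And>x. x \<in> B \<Longrightarrow> n \<le> x $ k"
  shows "ennreal (\<Sum>p\<in>B \<times> B \<inter> offdiag. ncov \<eta> t p) \<le>
    (csum {x. \<eta> x} (\<lambda>y. ennreal (tail (t / real CARD('n)) (n - y $ k))))\<^sup>2"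
proof -
  let ?u = "heat units t (indicator {x. \<eta> x})"
  have u0: "0 \<le> ?u x" for x by (rule U.heat_nonneg[OF t U.ind_bound]) auto
  have "(\<Sum>p\<in>B \<times> B \<inter> offdiag. ncov \<eta> t p) \<le> (\<Sum>p\<in>B \<times> B \<inter> offdiag. ?u (fst p) * ?u (snd p))"
    by (intro sum_mono ncov_le_product)
  also have "\<dots> \<le> (\<Sum>p\<in>B \<times> B. ?u (fst p) * ?u (snd p))"
    using B u0 by (intro sum_mono2) auto
  also have "\<dots> = (\<Sum>x\<in>B. ?u x) * (\<Sum>x\<in>B. ?u x)"
    by (simp add: sum_product sum.cartesian_product case_prod_beta)
  finally have "ennreal (\<Sum>p\<in>B \<times> B \<inter> offdiag. ncov \<eta> t p) \<le> ennreal (\<Sum>x\<in>B. ?u x) * ennreal (\<Sum>x\<in>B. ?u x)"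
    using u0 by (simp add: ennreal_leI sum_nonneg flip: ennreal_mult)
  also have "ennreal (\<Sum>x\<in>B. ?u x) \<le> csum {x. \<eta> x} (\<lambda>y. ennreal (tail (t / real CARD('n)) (n - y $ k)))"
  proof -
    let ?H = "\<lambda>x :: 'n site. indicator {n..} (x $ k) :: real"
    have "ennreal (\<Sum>x\<in>B. ?u x) = (\<Sum>x\<in>B. ennreal (?u x))" using u0 by (simp add: sum_ennreal)
    also have "\<dots> = (\<Sum>x\<in>B. ennreal (?H x) * ennreal (?u x))"
      using B(2) by (intro sum.cong) auto
    also have "\<dots> \<le> csum UNIV (\<lambda>x. ennreal (?H x) * ennreal (?u x))"
      using B(1) by (intro sum_le_csum) auto
    also have "\<dots> = csum UNIV (\<lambda>x. ennreal (?H x) * csum {x. \<eta> x} (\<lambda>y. ennreal (ker units t (y - x))))"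
      by (intro nn_integral_cong arg_cong2[where f = "(*)"] refl)
         (subst U.heat_csum[OF t U.ind_bound], auto simp: csum_UNIV[of "{x. \<eta> x}"] ennreal_indicator)
    also have "\<dots> = csum {x. \<eta> x} (\<lambda>y. csum UNIV (\<lambda>x. ennreal (?H x) * ennreal (ker units t (y - x))))"
      by (subst csum_swap[symmetric]) (simp add: nn_integral_cmult)
    also have "\<dots> = csum {x. \<eta> x} (\<lambda>y. ennreal (tail (t / real CARD('n)) (n - y $ k)))"
    proof (rule nn_integral_cong)
      fix y
      have "ennreal (tail (t / real CARD('n)) (n - y $ k)) = ennreal (heat units t ?H y)"
        by (simp add: heat_units_tail[OF t])
      also have "\<dots> = csum UNIV (\<lambda>x. ennreal (ker units t (x - y)) * ennreal (?H x))"
        by (rule U.heat_csum[OF t U.ind_bound]) auto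
      finally show "csum UNIV (\<lambda>x. ennreal (?H x) * ennreal (ker units t (y - x))) = ennreal (tail (t / real CARD('n)) (n - y $ k))"
        using U.ker_sym[of t "y - _"] by (simp add: mult.commute)
    qed
    finally show ?thesis .
  qed
  finally show ?thesis by (simp add: power2_eq_square mult_mono)
qed

end

section \<open>Counting the particles of a profile\<close>

lemma csum_level:
  fixes A :: "'n::finite site set"
  assumes top: "\<And>y. y \<in> A \<Longrightarrow> y $ k \<le> 0"
    and fin: "\<And>j. finite {y \<in> A. y $ k = - int j}"
    and card: "\<And>j. real (card {y \<in> A. y $ k = - int j}) \<le> c j"
  shows "csum A (\<lambda>y. f (y $ k)) \<le> csum UNIV (\<lambda>j. ennreal (c j) * f (- int j))"
proof -
  have "csum A (\<lambda>y. f (y $ k)) = csum A (\<lambda>y. csum UNIV (\<lambda>j. f (- int j) * indicator {nat (- y $ k)} j))"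
    by (intro nn_integral_cong) (auto simp: nn_integral_indicator_finite dest: top)
  also have "\<dots> = csum UNIV (\<lambda>j. csum A (\<lambda>y. f (- int j) * indicator {y \<in> A. y $ k = - int j} y))"
    by (subst csum_swap, intro nn_integral_cong) (auto simp: indicator_def dest: top)
  also have "\<dots> \<le> csum UNIV (\<lambda>j. ennreal (c j) * f (- int j))"
  proof (rule nn_integral_mono)
    fix j
    have "csum A (\<lambda>y. f (- int j) * indicator {y \<in> A. y $ k = - int j} y) =
        f (- int j) * emeasure (count_space A) {y \<in> A. y $ k = - int j}"
      by (rule nn_integral_cmult_indicator) auto
    also have "\<dots> = f (- int j) * ennreal (real (card {y \<in> A. y $ k = - int j}))"
      using fin[of j] by (subst emeasure_count_space_finite) (auto simp: ennreal_of_nat_eq_real_of_nat)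
    also have "\<dots> \<le> f (- int j) * ennreal (c j)"
      by (intro mult_left_mono ennreal_leI card) auto
    finally show "csum A (\<lambda>y. f (- int j) * indicator {y \<in> A. y $ k = - int j} y) \<le> ennreal (c j) * f (- int j)"
      by (simp add: mult.commute)
  qed
  finally show ?thesis .
qed

lemma card_box:
  fixes S :: "'n::finite \<Rightarrow> int set" and m :: int
  assumes S: "\<And>i. i \<noteq> k \<Longrightarrow> finite (S i)"
    and c: "\<And>i. i \<noteq> k \<Longrightarrow> real (card (S i)) \<le> c i"
  defines "X \<equiv> {y :: 'n site. y $ k = m \<and> (\<forall>i. i \<noteq> k \<longrightarrow> y $ i \<in> S i)}"
  shows "finite X" "real (card X) \<le> (\<Prod>i\<in>UNIV - {k}. c i)"
proof -
  let ?f = "\<lambda>y :: 'n site. restrict (($) y) (UNIV - {k})"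
  let ?P = "PiE (UNIV - {k}) S"
  have inj: "inj_on ?f X"
  proof (rule inj_onI)
    fix x y assume xy: "x \<in> X" "y \<in> X" "?f x = ?f y"
    have "x $ i = y $ i" for i
    proof (cases "i = k")
      case False
      then show ?thesis using fun_cong[OF xy(3), of i] by simp
    qed (use xy in \<open>simp add: X_def\<close>)
    then show "x = y" by (simp add: vec_eq_iff)
  qed
  have sub: "?f ` X \<subseteq> ?P"
    by (rule image_subsetI, rule PiE_I) (simp_all add: X_def)
  have fP: "finite ?P" by (rule finite_PiE) (use S in auto)
  show "finite X" using finite_subset[OF sub fP] inj by (rule finite_imageD)
  have "card X \<le> card ?P" by (rule card_inj_on_le[OF inj sub fP])
  also have "card ?P = (\<Prod>i\<in>UNIV - {k}. card (S i))" by (rule card_PiE) auto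
  finally have "real (card X) \<le> (\<Prod>i\<in>UNIV - {k}. real (card (S i)))"
    by (simp flip: of_nat_prod)
  also have "\<dots> \<le> (\<Prod>i\<in>UNIV - {k}. c i)" using c by (intro prod_mono) auto
  finally show "real (card X) \<le> (\<Prod>i\<in>UNIV - {k}. c i)" .
qed

lemma card_symmetric_interval:
  assumes "0 \<le> u"
  shows "finite {m :: int. \<bar>real_of_int m\<bar> \<le> u}" "real (card {m :: int. \<bar>real_of_int m\<bar> \<le> u}) \<le> 2 * u + 1"
proof -
  have eq: "{m :: int. \<bar>real_of_int m\<bar> \<le> u} = {- \<lfloor>u\<rfloor>..\<lfloor>u\<rfloor>}"
    by (auto simp: abs_le_iff le_floor_iff) linarith+
  show "finite {m :: int. \<bar>real_of_int m\<bar> \<le> u}" by (simp add: eq)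
  have "0 \<le> \<lfloor>u\<rfloor>" using assms by simp
  then have "real (card {m :: int. \<bar>real_of_int m\<bar> \<le> u}) = 2 * real_of_int \<lfloor>u\<rfloor> + 1"
    by (simp add: eq of_nat_nat)
  also have "\<dots> \<le> 2 * u + 1" by simp
  finally show "real (card {m :: int. \<bar>real_of_int m\<bar> \<le> u}) \<le> 2 * u + 1" .
qed

text \<open>Stepping from m to m + 1, an interval symmetric about 0 can only be left at floor u and
  entered at -floor u - 1.\<close>

lemma card_interval_ends:
  "finite {m :: int. (\<bar>real_of_int m\<bar> \<le> u) \<noteq> (\<bar>real_of_int m + 1\<bar> \<le> u)}"
  "real (card {m :: int. (\<bar>real_of_int m\<bar> \<le> u) \<noteq> (\<bar>real_of_int m + 1\<bar> \<le> u)}) \<le> 2"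
proof -
  have sub: "{m :: int. (\<bar>real_of_int m\<bar> \<le> u) \<noteq> (\<bar>real_of_int m + 1\<bar> \<le> u)} \<subseteq> {\<lfloor>u\<rfloor>, - \<lfloor>u\<rfloor> - 1}"
  proof
    fix m :: int assume "m \<in> {m :: int. (\<bar>real_of_int m\<bar> \<le> u) \<noteq> (\<bar>real_of_int m + 1\<bar> \<le> u)}"
    moreover have "\<bar>real_of_int m\<bar> \<le> u \<longleftrightarrow> \<bar>m\<bar> \<le> \<lfloor>u\<rfloor>" by (simp add: le_floor_iff)
    moreover have "\<bar>real_of_int m + 1\<bar> \<le> u \<longleftrightarrow> \<bar>m + 1\<bar> \<le> \<lfloor>u\<rfloor>" by (simp add: le_floor_iff)
    ultimately have "(\<bar>m\<bar> \<le> \<lfloor>u\<rfloor>) \<noteq> (\<bar>m + 1\<bar> \<le> \<lfloor>u\<rfloor>)" by simp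
    then show "m \<in> {\<lfloor>u\<rfloor>, - \<lfloor>u\<rfloor> - 1}" by auto
  qed
  show "finite {m :: int. (\<bar>real_of_int m\<bar> \<le> u) \<noteq> (\<bar>real_of_int m + 1\<bar> \<le> u)}"
    by (rule finite_subset[OF sub]) simp
  have "card {m :: int. (\<bar>real_of_int m\<bar> \<le> u) \<noteq> (\<bar>real_of_int m + 1\<bar> \<le> u)} \<le> card {\<lfloor>u\<rfloor>, - \<lfloor>u\<rfloor> - 1}"
    by (rule card_mono[OF _ sub]) simp
  also have "\<dots> \<le> 2" by (simp add: card_insert_if)
  finally show "real (card {m :: int. (\<bar>real_of_int m\<bar> \<le> u) \<noteq> (\<bar>real_of_int m + 1\<bar> \<le> u)}) \<le> 2" by simp
qed

text \<open>The assumptions are stable under freezing \<open>g\<close> beyond a given depth; the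
  locale is interpreted again for such truncated profiles.\<close>

locale profile_shape =
  fixes k :: "'n::finite" and g :: "'n \<Rightarrow> real \<Rightarrow> real"
  assumes g_nonneg: "\<And>i u. i \<noteq> k \<Longrightarrow> 0 \<le> u \<Longrightarrow> 0 \<le> g i u"
    and g_mono: "\<And>i u v. i \<noteq> k \<Longrightarrow> 0 \<le> u \<Longrightarrow> u \<le> v \<Longrightarrow> g i u \<le> g i v"
    and g_cont: "\<And>i. i \<noteq> k \<Longrightarrow> continuous_on {0..} (g i)"
begin

lemma downset_profile: "downset k {x. profile k g x}"
proof
  fix y assume "y \<in> {x. profile k g x}"
  then have y: "profile k g y" by simp
  have "\<bar>real_of_int (y $ i)\<bar> \<le> g i (- real_of_int (y $ k) + 1)" if "i \<noteq> k" for i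
    using y that g_mono[OF that, of "- real_of_int (y $ k)" "- real_of_int (y $ k) + 1"]
    by (force simp: profile_def)
  then show "y - axis k 1 \<in> {x. profile k g x}"
    using y by (auto simp: profile_def axis_def add.commute)
qed (simp add: profile_def)

text \<open>Bounds the number of lattice points in a face, orthogonal to axis i, of the
  cross-section at depth u. \<open>G_hat\<close> integrates the sum of these over i.\<close>

definition face :: "'n \<Rightarrow> real \<Rightarrow> real" where
  "face i u = (\<Prod>l\<in>UNIV - {k} - {i}. (2 * g l u + 1))"

lemma factor_ge_1: "l \<noteq> k \<Longrightarrow> 0 \<le> u \<Longrightarrow> 1 \<le> 2 * g l u + 1"
  using g_nonneg[of l u] by simp

lemma factor_mono: "l \<noteq> k \<Longrightarrow> 0 \<le> u \<Longrightarrow> u \<le> v \<Longrightarrow> 2 * g l u + 1 \<le> 2 * g l v + 1"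
  using g_mono[of l u v] by simp

lemma face_ge_1: "0 \<le> u \<Longrightarrow> 1 \<le> face i u"
  unfolding face_def by (intro prod_ge_1 factor_ge_1) auto

lemma face_mono: "0 \<le> u \<Longrightarrow> u \<le> v \<Longrightarrow> face i u \<le> face i v"
  unfolding face_def
  using factor_ge_1 factor_mono by (intro prod_mono) (metis Diff_iff insertI1 order_trans zero_le_one)

lemma G_mono: "0 \<le> u \<Longrightarrow> u \<le> v \<Longrightarrow> G_fun k g u \<le> G_fun k g v"
  unfolding G_fun_def
  using factor_ge_1 factor_mono by (intro prod_mono) (metis Diff_iff insertI1 order_trans zero_le_one)

lemma face_le_G: "0 \<le> u \<Longrightarrow> face i u \<le> G_fun k g u"
  unfolding face_def G_fun_def using factor_ge_1 by (intro prod_mono2) force+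

lemma G_ge_1: "0 \<le> u \<Longrightarrow> 1 \<le> G_fun k g u"
  unfolding G_fun_def by (intro prod_ge_1 factor_ge_1) auto

lemma G_hat_face: "G_hat k g u = integral {0..u} (\<lambda>v. \<Sum>i\<in>UNIV - {k}. face i v)"
  by (simp add: G_hat_def face_def)

lemma faces_integrable: "0 \<le> a \<Longrightarrow> (\<lambda>v. \<Sum>i\<in>UNIV - {k}. face i v) integrable_on {a..b}"
  unfolding face_def
  by (intro integrable_continuous_interval continuous_intros continuous_on_subset[OF g_cont]) auto

lemma faces_nonneg: "0 \<le> u \<Longrightarrow> 0 \<le> (\<Sum>i\<in>UNIV - {k}. face i u)"
  using face_ge_1 by (intro sum_nonneg) (meson order_trans zero_le_one)

lemma G_hat_mono:
  assumes "0 \<le> u" "u \<le> v"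
  shows "G_hat k g u \<le> G_hat k g v"
  unfolding G_hat_face
  by (rule integral_subset_le) (use assms faces_integrable faces_nonneg in auto)

lemma G_hat_nonneg: "0 \<le> u \<Longrightarrow> 0 \<le> G_hat k g u"
  using G_hat_mono[of 0 u] by (simp add: G_hat_face)

text \<open>A left Riemann sum of a nondecreasing function lies below its integral, and the other
  faces in the integrand are nonnegative.\<close>

lemma sum_face_le:
  assumes i: "i \<noteq> k"
  shows "(\<Sum>j<m. face i (real j)) \<le> G_hat k g (real m)"
proof (induction m)
  case (Suc m)
  let ?F = "\<lambda>v. \<Sum>i\<in>UNIV - {k}. face i v"
  have "face i (real m) \<le> ?F (real m)"
    using i face_ge_1[of "real m"] by (intro member_le_sum) (auto intro: order_trans[OF zero_le_one])
  also have "\<dots> = integral {real m..real m + 1} (\<lambda>_. ?F (real m))" by simp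
  also have "\<dots> \<le> integral {real m..real m + 1} ?F"
    by (intro integral_le faces_integrable sum_mono face_mono) auto
  finally have "(\<Sum>j<Suc m. face i (real j)) \<le> integral {0..real m} ?F + integral {real m..real m + 1} ?F"
    using Suc by (simp add: G_hat_face)
  also have "\<dots> = integral {0..real m + 1} ?F"
    by (rule Henstock_Kurzweil_Integration.integral_combine) (auto intro: faces_integrable)
  finally show ?case by (simp add: G_hat_face add.commute)
qed (simp add: G_hat_nonneg)

lemma card_level:
  "finite {y \<in> {x. profile k g x}. y $ k = - int j}"
  "real (card {y \<in> {x. profile k g x}. y $ k = - int j}) \<le> G_fun k g (real j)"
proof -
  let ?S = "\<lambda>i. {m :: int. \<bar>real_of_int m\<bar> \<le> g i (real j)}"
  have eq: "{y \<in> {x. profile k g x}. y $ k = - int j} = {y. y $ k = - int j \<and> (\<forall>i. i \<noteq> k \<longrightarrow> y $ i \<in> ?S i)}"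
    by (auto simp: profile_def)
  show "finite {y \<in> {x. profile k g x}. y $ k = - int j}"
    unfolding eq by (rule card_box(1)[where c = "\<lambda>i. 2 * g i (real j) + 1"])
      (auto intro!: card_symmetric_interval g_nonneg)
  show "real (card {y \<in> {x. profile k g x}. y $ k = - int j}) \<le> G_fun k g (real j)"
    unfolding eq G_fun_def by (rule card_box(2)) (auto intro!: card_symmetric_interval g_nonneg)
qed

lemma bdry_top: "y \<in> bdry {x. profile k g x} (axis i 1) \<Longrightarrow> i \<noteq> k \<Longrightarrow> y $ k \<le> 0"
  by (auto simp: bdry_def profile_def axis_def)

text \<open>A step along axis i changes membership only if all other transversal coordinates are
  admissible and coordinate i is at one of at most two ends.\<close>

lemma card_bdry_level:
  assumes i: "i \<noteq> k"
  shows "finite {y \<in> bdry {x. profile k g x} (axis i 1). y $ k = - int j}"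
    "real (card {y \<in> bdry {x. profile k g x} (axis i 1). y $ k = - int j}) \<le> 2 * face i (real j)"
proof -
  let ?S = "\<lambda>l. if l = i then {m :: int. (\<bar>real_of_int m\<bar> \<le> g i (real j)) \<noteq> (\<bar>real_of_int m + 1\<bar> \<le> g i (real j))}
    else {m :: int. \<bar>real_of_int m\<bar> \<le> g l (real j)}"
  let ?c = "\<lambda>l. if l = i then 2 else 2 * g l (real j) + 1"
  let ?X = "{y \<in> bdry {x. profile k g x} (axis i 1). y $ k = - int j}"
  let ?Y = "{y. y $ k = - int j \<and> (\<forall>l. l \<noteq> k \<longrightarrow> y $ l \<in> ?S l)}"
  have sub: "?X \<subseteq> ?Y"
  proof
    fix y assume y: "y \<in> ?X"
    have prof: "profile k g x \<longleftrightarrow> (\<forall>l. l \<noteq> k \<longrightarrow> \<bar>real_of_int (x $ l)\<bar> \<le> g l (real j))" if "x $ k = - int j" for x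
      using that by (simp add: profile_def)
    have yk: "y $ k = - int j" "(y + axis i 1) $ k = - int j" using y i by (auto simp: axis_def)
    have "profile k g y \<noteq> profile k g (y + axis i 1)" using y by (simp add: bdry_def)
    then have neq: "(\<forall>l. l \<noteq> k \<longrightarrow> \<bar>real_of_int (y $ l)\<bar> \<le> g l (real j)) \<noteq>
        (\<forall>l. l \<noteq> k \<longrightarrow> \<bar>real_of_int ((y + axis i 1) $ l)\<bar> \<le> g l (real j))"
      unfolding prof[OF yk(1)] prof[OF yk(2)] .
    have other: "(y + axis i 1) $ l = y $ l" if "l \<noteq> i" for l using that by (simp add: axis_def)
    have self: "(y + axis i 1) $ i = y $ i + 1" by (simp add: axis_def)
    have "y $ l \<in> ?S l" if l: "l \<noteq> k" for l
    proof (cases "l = i")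
      case True
      have "(\<bar>real_of_int (y $ i)\<bar> \<le> g i (real j)) \<noteq> (\<bar>real_of_int ((y + axis i 1) $ i)\<bar> \<le> g i (real j))"
        using neq other by metis
      then show ?thesis using True by (simp add: self)
    next
      case False
      then show ?thesis using neq other l by (metis mem_Collect_eq)
    qed
    then show "y \<in> ?Y" using yk by simp
  qed
  have fS: "finite (?S l)" and cS: "real (card (?S l)) \<le> ?c l" if "l \<noteq> k" for l
    using card_interval_ends[of "g i (real j)"] card_symmetric_interval[OF g_nonneg[OF that, of "real j"]]
    by (cases "l = i"; simp only: if_True if_False simp_thms of_nat_0_le_iff)+
  have Y: "finite ?Y" "real (card ?Y) \<le> (\<Prod>l\<in>UNIV - {k}. ?c l)"
    by (rule card_box(1)[where c = ?c, OF fS cS], assumption+) (rule card_box(2)[where c = ?c, OF fS cS], assumption+)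
  show "finite ?X" by (rule finite_subset[OF sub Y(1)])
  have "real (card ?X) \<le> real (card ?Y)" using card_mono[OF Y(1) sub] by simp
  also have "\<dots> \<le> (\<Prod>l\<in>UNIV - {k}. ?c l)" by (rule Y(2))
  also have "\<dots> = ?c i * (\<Prod>l\<in>UNIV - {k} - {i}. ?c l)" by (rule prod.remove) (use i in auto)
  also have "(\<Prod>l\<in>UNIV - {k} - {i}. ?c l) = face i (real j)"
    unfolding face_def by (intro prod.cong) auto
  finally show "real (card ?X) \<le> 2 * face i (real j)" by simp
qed

end

section \<open>From sums over levels to expectations of the walk\<close>

text \<open>Since floor z + 1 > z, the site floor z + 1 + j exceeds z by at least j, and
  monotonicity of F applies. The kernel there is the probability of travelling from depth j to the
  first level above z.\<close>

lemma walk_exp_ge: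
  assumes \<tau>: "0 < \<tau>" and F: "\<And>u v. 0 \<le> u \<Longrightarrow> u \<le> v \<Longrightarrow> F u \<le> F v"
  shows "csum UNIV (\<lambda>j. ennreal (F (real j)) * ennreal (kint \<tau> (\<lfloor>z\<rfloor> + 1 + int j))) \<le> walk_exp \<tau> z F"
proof -
  let ?n = "\<lfloor>z\<rfloor> + 1"
  have "csum UNIV (\<lambda>j. ennreal (F (real j)) * ennreal (kint \<tau> (?n + int j)))
      \<le> csum UNIV (\<lambda>j. ennreal (pmf (ctrw_pmf 0 \<tau>) (?n + int j)) *
          (ennreal (F (real_of_int (?n + int j) - z)) * indicator {z..} (real_of_int (?n + int j))))"
  proof (rule nn_integral_mono)
    fix j :: nat
    have 1: "z \<le> real_of_int (?n + int j)" by simp linarith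
    have 2: "real j \<le> real_of_int (?n + int j) - z" by simp linarith
    have 3: "ennreal (F (real j)) \<le> ennreal (F (real_of_int (?n + int j) - z))"
      by (intro ennreal_leI F 2) simp
    show "ennreal (F (real j)) * ennreal (kint \<tau> (?n + int j)) \<le>
        ennreal (pmf (ctrw_pmf 0 \<tau>) (?n + int j)) * (ennreal (F (real_of_int (?n + int j) - z)) * indicator {z..} (real_of_int (?n + int j)))"
      using 1 mult_right_mono[OF 3, of "ennreal (kint \<tau> (?n + int j))"]
      by (simp add: pmf_ctrw[OF \<tau>] mult.commute)
  qed
  also have "\<dots> = csum {?n..} (\<lambda>m. ennreal (pmf (ctrw_pmf 0 \<tau>) m) * (ennreal (F (real_of_int m - z)) * indicator {z..} (real_of_int m)))"
    by (rule nn_integral_bij_count_space[where f = "\<lambda>m. ennreal (pmf (ctrw_pmf 0 \<tau>) m) * (ennreal (F (real_of_int m - z)) * indicator {z..} (real_of_int m))"])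
       (rule bij_betw_byWitness[where f' = "\<lambda>m. nat (m - ?n)"], auto)
  also have "\<dots> \<le> csum UNIV (\<lambda>m. ennreal (pmf (ctrw_pmf 0 \<tau>) m) * (ennreal (F (real_of_int m - z)) * indicator {z..} (real_of_int m)))"
    unfolding csum_UNIV[of "{?n..}"] by (intro nn_integral_mono) (auto simp: indicator_def)
  also have "\<dots> = walk_exp \<tau> z F"
    unfolding walk_exp_def by (rule nn_integral_measure_pmf[symmetric])
  finally show ?thesis .
qed

lemma csum_convolution:
  "csum UNIV (\<lambda>j. a j * csum UNIV (\<lambda>l. b (j + l))) = csum UNIV (\<lambda>m::nat. (\<Sum>j\<le>m. a j) * b m)"
proof -
  have "csum UNIV (\<lambda>l. b (j + l)) = csum {j..} b" for j
    by (rule nn_integral_bij_count_space)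
       (rule bij_betw_byWitness[where f' = "\<lambda>m. m - j"], auto)
  then have "csum UNIV (\<lambda>j. a j * csum UNIV (\<lambda>l. b (j + l))) = csum UNIV (\<lambda>j. a j * csum UNIV (\<lambda>m. b m * indicator {j..} m))"
    by (simp add: csum_UNIV[of "{_..}"])
  also have "\<dots> = csum UNIV (\<lambda>j. csum UNIV (\<lambda>m. b m * (a j * indicator {..m} j)))"
    by (subst nn_integral_cmult[symmetric])
       (auto intro!: nn_integral_cong simp: indicator_def mult.commute)
  also have "\<dots> = csum UNIV (\<lambda>m. csum UNIV (\<lambda>j. b m * (a j * indicator {..m} j)))"
    by (rule csum_swap)
  also have "\<dots> = csum UNIV (\<lambda>m. b m * (\<Sum>j\<le>m. a j))"
    by (simp add: nn_integral_cmult nn_integral_indicator_finite)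
  finally show ?thesis by (simp add: mult.commute)
qed

context profile_shape
begin

lemma mass_bound:
  assumes \<tau>: "0 < \<tau>" and n: "n = \<lfloor>z\<rfloor> + 1" and A: "A \<subseteq> {x. profile k g x}"
  shows "csum A (\<lambda>y. ennreal (kint \<tau> (n - y $ k))) \<le> walk_exp \<tau> z (G_fun k g)"
proof -
  have "csum A (\<lambda>y. ennreal (kint \<tau> (n - y $ k))) \<le> csum {x. profile k g x} (\<lambda>y. ennreal (kint \<tau> (n - y $ k)))"
    unfolding csum_UNIV[of A] csum_UNIV[of "{x. profile k g x}"]
    using A by (intro nn_integral_mono) (auto simp: indicator_def)
  also have "\<dots> \<le> csum UNIV (\<lambda>j. ennreal (G_fun k g (real j)) * ennreal (kint \<tau> (n - - int j)))"
    by (rule csum_level[where f = "\<lambda>m. ennreal (kint \<tau> (n - m))"]) (use card_level in \<open>auto simp: profile_def\<close>)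
  also have "\<dots> \<le> walk_exp \<tau> z (G_fun k g)"
    using walk_exp_ge[OF \<tau>, of "G_fun k g" z] G_mono by (simp add: n)
  finally show ?thesis .
qed

text \<open>Tails are written as sums of kernels and the double sum is reordered by m = j + l. The
  kernel at m then carries all faces up to m: those with j < m are bounded by \<open>G_hat\<close>,
  the last one by \<open>G_fun\<close>.\<close>

lemma bdry_bound:
  assumes \<tau>: "0 < \<tau>" and n: "n = \<lfloor>z\<rfloor> + 1" and i: "i \<noteq> k"
    and A: "\<And>y. y \<in> A \<Longrightarrow> y $ k \<le> 0" "\<And>j. finite {y \<in> A. y $ k = - int j}"
      "\<And>j. real (card {y \<in> A. y $ k = - int j}) \<le> 2 * face i (real j)"
  shows "csum A (\<lambda>y. ennreal (tail \<tau> (n - y $ k))) \<le>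
    2 * (walk_exp \<tau> z (G_hat k g) + walk_exp \<tau> z (G_fun k g))"
proof -
  have f0: "0 \<le> face i (real j)" for j using face_ge_1[of "real j" i] by simp
  have "csum A (\<lambda>y. ennreal (tail \<tau> (n - y $ k))) \<le> csum UNIV (\<lambda>j. ennreal (2 * face i (real j)) * ennreal (tail \<tau> (n - - int j)))"
    by (rule csum_level[OF A, where f = "\<lambda>m. ennreal (tail \<tau> (n - m))"]) auto
  also have "\<dots> = csum UNIV (\<lambda>j. ennreal (2 * face i (real j)) * csum UNIV (\<lambda>l. ennreal (kint \<tau> (n + int (j + l)))))"
    using \<tau> by (simp add: tail_csum add.assoc)
  also have "\<dots> = csum UNIV (\<lambda>m. (\<Sum>j\<le>m. ennreal (2 * face i (real j))) * ennreal (kint \<tau> (n + int m)))"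
    by (rule csum_convolution)
  also have "\<dots> \<le> csum UNIV (\<lambda>m. 2 * (ennreal (G_hat k g (real m)) * ennreal (kint \<tau> (n + int m)) + ennreal (G_fun k g (real m)) * ennreal (kint \<tau> (n + int m))))"
  proof (rule nn_integral_mono)
    fix m
    have "(\<Sum>j\<le>m. ennreal (2 * face i (real j))) = ennreal (2 * (\<Sum>j\<le>m. face i (real j)))"
      using f0 by (simp add: sum_ennreal sum_distrib_left)
    also have "(\<Sum>j\<le>m. face i (real j)) \<le> G_hat k g (real m) + G_fun k g (real m)"
      using sum_face_le[OF i, of m] face_le_G[of "real m" i] by (simp add: lessThan_Suc_atMost[symmetric])
    then have "ennreal (2 * (\<Sum>j\<le>m. face i (real j))) \<le> ennreal (2 * (G_hat k g (real m) + G_fun k g (real m)))"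
      by (intro ennreal_leI) simp
    also have "\<dots> = 2 * (ennreal (G_hat k g (real m)) + ennreal (G_fun k g (real m)))"
      using G_hat_nonneg[of "real m"] G_ge_1[of "real m"]
      by (subst ennreal_mult) (simp_all add: ennreal_plus)
    finally have "(\<Sum>j\<le>m. ennreal (2 * face i (real j))) \<le> 2 * (ennreal (G_hat k g (real m)) + ennreal (G_fun k g (real m)))" .
    from mult_right_mono[OF this, of "ennreal (kint \<tau> (n + int m))"]
    show "(\<Sum>j\<le>m. ennreal (2 * face i (real j))) * ennreal (kint \<tau> (n + int m)) \<le>
        2 * (ennreal (G_hat k g (real m)) * ennreal (kint \<tau> (n + int m)) + ennreal (G_fun k g (real m)) * ennreal (kint \<tau> (n + int m)))"
      by (simp add: mult.assoc distrib_right)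
  qed
  also have "\<dots> = 2 * (csum UNIV (\<lambda>m. ennreal (G_hat k g (real m)) * ennreal (kint \<tau> (n + int m))) + csum UNIV (\<lambda>m. ennreal (G_fun k g (real m)) * ennreal (kint \<tau> (n + int m))))"
    by (simp add: nn_integral_cmult nn_integral_add)
  also have "\<dots> \<le> 2 * (walk_exp \<tau> z (G_hat k g) + walk_exp \<tau> z (G_fun k g))"
    using walk_exp_ge[OF \<tau>, of "G_hat k g" z] walk_exp_ge[OF \<tau>, of "G_fun k g" z] G_mono G_hat_mono
    unfolding n by (intro mult_left_mono add_mono) auto
  finally show ?thesis .
qed

end

section \<open>The covariance bound\<close>

text \<open>The Markov property is used at s = 0, where X_0 is almost surely constant: the
  conditional probability is then a constant and equals its mean.\<close>

lemma ssep_process_law: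
  assumes "ssep_process M X (\<eta> :: 'n::finite config)"
  obtains P where "ssep_transition P" "\<And>t. 0 \<le> t \<Longrightarrow> distr M borel (X t) = P t \<eta>"
proof -
  obtain P where P: "ssep_transition P" and cond: "\<And>s t A. 0 \<le> s \<Longrightarrow> 0 \<le> t \<Longrightarrow> A \<in> sets borel \<Longrightarrow> AE \<omega> in M.
      real_cond_exp M (natural_filtration M X s) (\<lambda>\<omega>'. indicator A (X (s + t) \<omega>')) \<omega> = measure (P t (X s \<omega>)) A"
    using assms unfolding ssep_process_def by blast
  interpret prob_space M using assms by (simp add: ssep_process_def)
  interpret ssep P by unfold_locales (rule P)
  have meas [measurable]: "X t \<in> M \<rightarrow>\<^sub>M borel" if "0 \<le> t" for t
    using assms that by (simp add: ssep_process_def)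
  let ?F = "natural_filtration M X 0"
  have sub: "subalgebra M ?F"
  proof -
    let ?G = "{X u -` A \<inter> space M | u A. 0 \<le> u \<and> u \<le> (0 :: real) \<and> A \<in> sets borel}"
    have G: "?G \<subseteq> sets M" using measurable_sets[OF meas] by auto
    have "?G \<subseteq> Pow (space M)" by auto
    then have "sets ?F = sigma_sets (space M) ?G" "space ?F = space M"
      unfolding natural_filtration_def by (simp_all add: sets_measure_of space_measure_of)
    then show ?thesis using sets.sigma_sets_subset[OF G] by (simp add: subalgebra_def)
  qed
  interpret finite_measure_subalgebra M ?F
    by unfold_locales (rule sub)
  have law: "distr M borel (X t) = P t \<eta>" if t: "0 \<le> t" for t
  proof (rule measure_eqI)
    show "sets (distr M borel (X t)) = sets (P t \<eta>)" by (simp add: P_sets[OF t])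
    fix A assume "A \<in> sets (distr M borel (X t))"
    then have A: "A \<in> sets borel" by simp
    note [measurable] = A meas[OF t]
    interpret Pt: prob_space "P t \<eta>" by (rule P_prob[OF t])
    let ?f = "\<lambda>\<omega>. indicator A (X (0 + t) \<omega>) :: real"
    have fm: "?f \<in> borel_measurable M" by simp
    have fi: "integrable M ?f" by (rule integrable_const_bound[where B = 1]) (auto simp: indicator_def)
    have "AE \<omega> in M. X 0 \<omega> = \<eta>" using assms by (simp add: ssep_process_def)
    with cond[OF order_refl t A] have ae: "AE \<omega> in M. real_cond_exp M ?F ?f \<omega> = measure (P t \<eta>) A"
      by eventually_elim simp
    have "measure (P t \<eta>) A = (\<integral>\<omega>. measure (P t \<eta>) A \<partial>M)" by (simp add: prob_space)
    also have "\<dots> = (\<integral>\<omega>. real_cond_exp M ?F ?f \<omega> \<partial>M)"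
      using ae by (intro integral_cong_AE) (auto intro: borel_measurable_cond_exp2)
    also have "\<dots> = (\<integral>\<omega>. ?f \<omega> \<partial>M)" by (rule real_cond_exp_int(2)[OF fi])
    also have "\<dots> = (\<integral>\<omega>. indicator (X t -` A \<inter> space M) \<omega> \<partial>M)"
      by (intro Bochner_Integration.integral_cong) (auto simp: indicator_def)
    also have "\<dots> = measure M (X t -` A \<inter> space M)" by simp
    finally show "emeasure (distr M borel (X t)) A = emeasure (P t \<eta>) A"
      by (simp add: emeasure_distr emeasure_eq_measure Pt.emeasure_eq_measure)
  qed
  show thesis by (rule that[OF P law])
qed

lemma (in ssep) covariance_ncov:
  assumes M: "prob_space M" and X: "X t \<in> M \<rightarrow>\<^sub>M borel" and t: "0 \<le> t"
    and law: "distr M borel (X t) = P t \<eta>"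
  shows "covariance M (\<lambda>\<omega>. of_bool (X t \<omega> x)) (\<lambda>\<omega>. of_bool (X t \<omega> y)) = - ncov \<eta> t (x, y)"
proof -
  interpret prob_space M by (rule M)
  let ?U = "\<lambda>x \<omega>. occ x (X t \<omega>)"
  have exp: "(\<integral>\<omega>. f (X t \<omega>) \<partial>M) = semi P t f \<eta>" if "continuous_on UNIV f" for f
    unfolding semi_def law[symmetric]
    by (rule integral_distr[symmetric, OF X borel_measurable_continuous_onI[OF that]])
  have int: "integrable M (\<lambda>\<omega>. f (X t \<omega>))" if "continuous_on UNIV f" "\<And>\<xi>. \<bar>f \<xi>\<bar> \<le> 1" for f :: "'n config \<Rightarrow> real"
    by (rule integrable_const_bound[where B = 1])
       (use measurable_compose[OF X borel_measurable_continuous_onI[OF that(1)]] that(2) in auto)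
  define a b where "a = (\<integral>\<omega>. ?U x \<omega> \<partial>M)" and "b = (\<integral>\<omega>. ?U y \<omega> \<partial>M)"
  have "covariance M (\<lambda>\<omega>. of_bool (X t \<omega> x)) (\<lambda>\<omega>. of_bool (X t \<omega> y)) = (\<integral>\<omega>. (?U x \<omega> - a) * (?U y \<omega> - b) \<partial>M)"
    by (simp add: covariance_def occ_def a_def b_def)
  also have "\<dots> = (\<integral>\<omega>. occ2 (x, y) (X t \<omega>) - a * ?U y \<omega> - b * ?U x \<omega> + a * b \<partial>M)"
    by (intro Bochner_Integration.integral_cong) (auto simp: occ2_def algebra_simps)
  also have "\<dots> = (\<integral>\<omega>. occ2 (x, y) (X t \<omega>) \<partial>M) - a * b - b * a + a * b"
    by (simp add: int occ2_continuous occ2_bound occ_continuous occ_bound prob_space a_def b_def)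
  also have "\<dots> = - ncov \<eta> t (x, y)"
    by (simp add: a_def b_def exp occ2_continuous occ_continuous semi_occ[OF t] ncov_def)
  finally show ?thesis .
qed

lemma (in ssep) ncov_commute: "ncov \<eta> t (x, y) = ncov \<eta> t (y, x)"
proof -
  have "occ2 (x, y) = occ2 (y, x)" by (auto simp: occ2_def fun_eq_iff)
  then show ?thesis by (simp add: ncov_def)
qed

text \<open>After negation all terms are nonnegative, so bounds on finite sums suffice. The factor 2
  in \<open>cov_sum\<close> counts each unordered pair as two ordered ones, and a finite family of
  pairs lies in B x B for its union B.\<close>

lemma (in ssep) cov_sum_le:
  assumes t: "0 \<le> t" and cov: "\<And>x y. covariance M (\<lambda>\<omega>. of_bool (X t \<omega> x)) (\<lambda>\<omega>. of_bool (X t \<omega> y)) = - ncov \<eta> t (x, y)"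
    and c: "\<And>B. finite B \<Longrightarrow> (\<And>x. x \<in> B \<Longrightarrow> z < real_of_int (x $ k)) \<Longrightarrow> (\<Sum>p\<in>B \<times> B \<inter> offdiag. ncov \<eta> t p) \<le> c"
  shows "cov_sum k M X t z \<le> ereal c"
proof -
  let ?I = "{{x, y} | x y. x \<noteq> y \<and> z < real_of_int (x $ k) \<and> z < real_of_int (y $ k)}"
  define h where "h p = - pair_cov M (X t) p" for p
  have h: "h {x, y} = ncov \<eta> t (x, y)" for x y
    by (simp add: h_def pair_cov_doubleton cov)
  have h0: "0 \<le> h p" if p: "p \<in> ?I" for p
  proof -
    obtain x y where "p = {x, y}" "x \<noteq> y" using p by blast
    then show ?thesis using ncov_nonneg[of "(x, y)" t \<eta>] t by (simp add: h)
  qed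
  have h0': "0 \<le> ereal (h p)" if p: "p \<in> ?I" for p
    using h0[OF p] by simp
  have fin: "2 * sum h F \<le> c" if F: "finite F" "F \<subseteq> ?I" for F
  proof -
    let ?B = "\<Union>F"
    have fB: "finite ?B" using F by (auto intro!: finite_Union)
    let ?O = "{p \<in> ?B \<times> ?B \<inter> offdiag. {fst p, snd p} \<in> F}"
    have fO: "finite ?O" using fB by auto
    have "(\<Sum>p\<in>?O. ncov \<eta> t p) = (\<Sum>r\<in>F. \<Sum>p | p \<in> ?O \<and> {fst p, snd p} = r. ncov \<eta> t p)"
      by (rule sum.group[symmetric, OF fO F(1)]) blast
    also have "\<dots> = (\<Sum>r\<in>F. 2 * h r)"
    proof (rule sum.cong[OF refl])
      fix r assume r: "r \<in> F"
      then obtain x y where xy: "r = {x, y}" "x \<noteq> y" using F by blast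
      have "{p. p \<in> ?O \<and> {fst p, snd p} = r} = {(x, y), (y, x)}"
      proof (intro set_eqI iffI)
        fix p assume "p \<in> {p. p \<in> ?O \<and> {fst p, snd p} = r}"
        then have "{fst p, snd p} = {x, y}" using xy(1) by simp
        then have "fst p = x \<and> snd p = y \<or> fst p = y \<and> snd p = x" by (simp only: doubleton_eq_iff)
        then show "p \<in> {(x, y), (y, x)}" by (cases p) auto
      next
        fix p assume "p \<in> {(x, y), (y, x)}"
        then have p: "p = (x, y) \<or> p = (y, x)" by blast
        have yx: "{y, x} = r" using xy(1) by blast
        have "x \<in> ?B" "y \<in> ?B" using r xy(1) by blast+
        then show "p \<in> {p. p \<in> ?O \<and> {fst p, snd p} = r}"
          using p xy(2) r by (elim disjE) (simp_all add: yx xy(1)[symmetric])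
      qed
      then show "(\<Sum>p | p \<in> ?O \<and> {fst p, snd p} = r. ncov \<eta> t p) = 2 * h r"
        using xy ncov_commute[of \<eta> t y x] by (simp add: h)
    qed
    finally have "2 * sum h F = (\<Sum>p\<in>?O. ncov \<eta> t p)" by (simp add: sum_distrib_left)
    also have "\<dots> \<le> (\<Sum>p\<in>?B \<times> ?B \<inter> offdiag. ncov \<eta> t p)"
    proof (rule sum_mono2)
      fix p assume "p \<in> ?B \<times> ?B \<inter> offdiag - ?O"
      then have "fst p \<noteq> snd p" by blast
      then show "0 \<le> ncov \<eta> t p" using t by (rule ncov_nonneg)
    qed (use fB in blast)+
    also have "\<dots> \<le> c" by (rule c[OF fB]) (use F in blast)
    finally show ?thesis .
  qed
  define S where "S = infsum (\<lambda>p. ereal (h p)) ?I"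
  have sm: "(\<lambda>p. ereal (h p)) summable_on ?I"
    by (rule nonneg_summable_on_complete) (simp only: h0' )
  have hs: "((\<lambda>p. ereal (h p)) has_sum S) ?I" using sm by (simp add: S_def)
  have eq: "sum (\<lambda>p. ereal (pair_cov M (X t) p)) = (\<lambda>F. - sum (\<lambda>p. ereal (h p)) F)"
    by (rule ext) (simp add: h_def sum_negf)
  \<comment> \<open>Summability in \<open>ereal\<close> is available for the nonnegative negated
    terms; the sign is moved through the limit of finite sums.\<close>
  have "((\<lambda>p. ereal (pair_cov M (X t) p)) has_sum - S) ?I"
    unfolding has_sum_def eq by (rule tendsto_uminus_ereal[OF hs[unfolded has_sum_def]])
  then have cs: "cov_sum k M X t z = - 2 * - S" unfolding cov_sum_def by (simp add: infsumI)
  have S2: "S \<le> ereal (c / 2)"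
    unfolding S_def
  proof (rule infsum_le_finite_sums[OF sm])
    fix F assume "finite F" "F \<subseteq> ?I"
    then have "sum h F \<le> c / 2" using fin[of F] by simp
    then show "(\<Sum>p\<in>F. ereal (h p)) \<le> ereal (c / 2)" by simp
  qed
  have "cov_sum k M X t z \<le> 2 * ereal (c / 2)"
  proof -
    have "- 2 * - S = 2 * S" by (cases S) auto
    then show ?thesis
      unfolding cs using ereal_mult_left_mono[OF S2, of 2] by (simp only:) simp
  qed
  then show ?thesis by simp
qed

section \<open>Time integrals of the decay rates\<close>

text \<open>All decays of exponent 3 or more are integrable; capping the exponent at 3 leaves one
  explicit antiderivative for them, the last case of \<open>time_int\<close>.\<close>

definition time_rate :: "nat \<Rightarrow> real \<Rightarrow> real" where
  "time_rate e s = (1 / sqrt (1 + s)) ^ min e 3"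

definition time_int :: "nat \<Rightarrow> real \<Rightarrow> real" where
  "time_int e s = (if e = 1 then 2 * sqrt (1 + s) else if e = 2 then ln (1 + s) else - 2 / sqrt (1 + s))"

lemma time_rate_ge: "0 \<le> s \<Longrightarrow> (1 / sqrt (1 + s)) ^ e \<le> time_rate e s"
  unfolding time_rate_def by (rule power_decreasing) (auto simp: divide_le_eq_1)

lemma time_int_deriv:
  assumes s: "0 \<le> s" and e: "1 \<le> e"
  shows "(time_int e has_real_derivative time_rate e s) (at s)"
proof -
  have sqrt: "((\<lambda>s. sqrt (1 + s)) has_real_derivative inverse (sqrt (1 + s)) / 2 * (0 + 1)) (at s)"
    using s by (intro DERIV_chain2[OF DERIV_real_sqrt] DERIV_add DERIV_const DERIV_ident) simp
  consider "e = 1" | "e = 2" | "3 \<le> e" using e by linarith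
  then show ?thesis
  proof cases
    case 1
    then have eq: "time_int e = (\<lambda>s. 2 * sqrt (1 + s))" by (auto simp: time_int_def)
    show ?thesis unfolding eq
      by (rule DERIV_cong[OF DERIV_cmult[OF sqrt]]) (simp add: 1 time_rate_def inverse_eq_divide)
  next
    case 2
    then have eq: "time_int e = (\<lambda>s. ln (1 + s))" by (auto simp: time_int_def)
    have "((\<lambda>s. ln (1 + s)) has_real_derivative inverse (1 + s) * (0 + 1)) (at s)"
      using s by (intro DERIV_chain2[OF DERIV_ln] DERIV_add DERIV_const DERIV_ident) simp
    moreover have "inverse (1 + s) * (0 + 1) = time_rate e s"
      using s 2 by (simp add: time_rate_def power_divide inverse_eq_divide)
    ultimately show ?thesis unfolding eq by simp
  next
    case 3
    then have eq: "time_int e = (\<lambda>s. - 2 / sqrt (1 + s))" by (auto simp: time_int_def)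
    have "((\<lambda>s. - 2 / sqrt (1 + s)) has_real_derivative
        (0 * sqrt (1 + s) - - 2 * (inverse (sqrt (1 + s)) / 2 * (0 + 1))) / (sqrt (1 + s) * sqrt (1 + s))) (at s)"
      by (rule DERIV_divide[OF DERIV_const sqrt]) (use s in simp)
    also have "(0 * sqrt (1 + s) - - 2 * (inverse (sqrt (1 + s)) / 2 * (0 + 1))) / (sqrt (1 + s) * sqrt (1 + s)) = time_rate e s"
    proof -
      have "(0 * r - - 2 * (inverse r / 2 * (0 + 1))) / (r * r) = (1 / r) ^ 3" for r :: real
        by (cases "r = 0") (auto simp: field_simps power3_eq_cube)
      moreover have "min e 3 = 3" using 3 by simp
      ultimately show ?thesis by (simp only: time_rate_def)
    qed
    finally show ?thesis unfolding eq .
  qed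
qed

text \<open>Exponent d - 1 of the longitudinal rate gives \<gamma>_d, exponent d of the transversal
  rate gives \<gamma>_{d+1}. In the logarithmic case t \<ge> 3 ensures 1 + t \<le> t^2.\<close>

lemma time_int_le:
  assumes t: "3 \<le> t" and e: "1 \<le> e"
  shows "time_int e t - time_int e 0 \<le> 4 * gamma_dim (e + 1) t"
proof -
  consider "e = 1" | "e = 2" | "3 \<le> e" using e by linarith
  then show ?thesis
  proof cases
    case 1
    have "sqrt (1 + t) \<le> sqrt (4 * t)" using t by simp
    then show ?thesis using 1 by (simp add: time_int_def gamma_dim_def real_sqrt_mult)
  next
    case 2
    have "1 + t \<le> t\<^sup>2"
    proof -
      have "3 * t \<le> t * t" using t by (intro mult_right_mono) auto
      then show ?thesis unfolding power2_eq_square using t by linarith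
    qed
    then have "ln (1 + t) \<le> ln (t\<^sup>2)" using t by simp
    also have "\<dots> = 2 * ln t" using t by (simp add: ln_realpow)
    finally have le: "ln (1 + t) \<le> 2 * ln t" .
    have "0 \<le> ln t" using t by simp
    with le have "ln (1 + t) \<le> 4 * ln t" by linarith
    then show ?thesis using 2 by (simp add: time_int_def gamma_dim_def)
  next
    case 3
    have "0 \<le> 2 / sqrt (1 + t)" using t by simp
    moreover have "time_int e t = - (2 / sqrt (1 + t))" "time_int e 0 = - 2" "gamma_dim (e + 1) t = 1"
      using 3 by (auto simp: time_int_def gamma_dim_def)
    ultimately show ?thesis by linarith
  qed
qed

lemma gamma_dim_ge_1: "3 \<le> t \<Longrightarrow> 1 \<le> gamma_dim d t"
proof -
  assume t: "3 \<le> t"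
  have "ln (exp 1) \<le> ln t" using t exp_le by (subst ln_le_cancel_iff) auto
  moreover have "1 \<le> sqrt t" using t by simp
  ultimately show ?thesis by (simp add: gamma_dim_def)
qed

text \<open>For d = 2 this is ln t \<le> 2 sqrt t; for d = 3 it uses ln t \<ge> 1, that is t \<ge> 3
  > e.\<close>

lemma gamma_dim_Suc: "3 \<le> t \<Longrightarrow> 2 \<le> d \<Longrightarrow> gamma_dim (d + 1) t \<le> 2 * gamma_dim d t"
proof -
  assume t: "3 \<le> t" and d: "2 \<le> d"
  have "ln t = ln (sqrt t ^ 2)" using t by simp
  also have "\<dots> = 2 * ln (sqrt t)" using t by (subst ln_realpow) auto
  also have "\<dots> \<le> 2 * sqrt t" using t ln_le_minus_one[of "sqrt t"] by simp
  finally show ?thesis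
    using gamma_dim_ge_1[OF t, of d] d by (auto simp: gamma_dim_def)
qed

context profile_shape
begin

section \<open>Cutting the profile into a near and a far part\<close>

text \<open>Freezing \<open>g\<close> at depth m keeps the cross-sections down to m and makes the
  deeper ones constant. The near part is thus again a profile, rather than a slab with an artificial
  lower boundary.\<close>

lemma cut_shape: "profile_shape k (\<lambda>i u. g i (min u (real m)))"
proof
  show "continuous_on {0..} (\<lambda>u. g i (min u (real m)))" if "i \<noteq> k" for i
    by (rule continuous_on_compose2[OF g_cont[OF that]]) (auto intro!: continuous_intros)
qed (auto intro!: g_nonneg g_mono)

lemma cut_subset: "profile k (\<lambda>i u. g i (min u (real m))) x \<Longrightarrow> profile k g x"
proof -
  assume x: "profile k (\<lambda>i u. g i (min u (real m))) x"
  have "\<bar>real_of_int (x $ i)\<bar> \<le> g i (- real_of_int (x $ k))" if "i \<noteq> k" for i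
  proof -
    have "\<bar>real_of_int (x $ i)\<bar> \<le> g i (min (- real_of_int (x $ k)) (real m))"
      using x that by (simp add: profile_def)
    also have "\<dots> \<le> g i (- real_of_int (x $ k))"
      using x by (intro g_mono[OF that]) (auto simp: profile_def)
    finally show ?thesis .
  qed
  then show ?thesis using x by (simp add: profile_def)
qed

lemma cut_far:
  assumes "profile k g x" "\<not> profile k (\<lambda>i u. g i (min u (real m))) x"
  shows "int m < - (x $ k)"
proof (rule ccontr)
  assume "\<not> int m < - (x $ k)"
  then have "- real_of_int (x $ k) \<le> real m" by linarith
  then show False using assms by (auto simp: profile_def min_absorb1)
qed

text \<open>Consecutive cross-sections at depths m and beyond coincide, so a site deeper than m has
  its upper neighbour in the profile.\<close>

lemma cut_front:
  assumes "y \<in> downset.front k {x. profile k (\<lambda>i u. g i (min u (real m))) x}"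
  shows "- (y $ k) \<le> int m"
proof (rule ccontr)
  let ?g = "\<lambda>i u. g i (min u (real m))"
  interpret C: profile_shape k ?g by (rule cut_shape)
  interpret D: downset k "{x. profile k ?g x}" by (rule C.downset_profile)
  assume "\<not> - (y $ k) \<le> int m"
  then have m: "int m + 1 \<le> - (y $ k)" by simp
  then have "real m + 1 \<le> - real_of_int (y $ k)" by linarith
  then have "min (- real_of_int (y $ k)) (real m) = min (- (real_of_int (y $ k) + 1)) (real m)" by simp
  moreover have "y \<in> {x. profile k ?g x}" "y + axis k 1 \<notin> {x. profile k ?g x}"
    using assms by (auto simp: D.front_def)
  ultimately show False using m by (auto simp: profile_def axis_def)
qed

text \<open>By \<open>cut_front\<close> and n + m \<le> \<tau>, all lines of the truncated profile
  end within distance \<tau> of n. Direction k gives the first term; the transversal directions, at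
  most d in number, give the second. Monotonicity of \<open>g\<close> replaces the truncated sizes
  by the full ones.\<close>

lemma energy_rate:
  fixes P :: "real \<Rightarrow> 'n config \<Rightarrow> 'n config measure"
  assumes P: "ssep P" and \<tau>: "\<tau> = t / real CARD('n)" and n: "n = \<lfloor>z\<rfloor> + 1"
    and m: "real_of_int n + real m \<le> \<tau>" and s: "0 < s" "s < t" and F: "finite F"
    and B: "\<And>x. x \<in> B \<Longrightarrow> n \<le> x $ k"
  defines "\<eta> \<equiv> profile k (\<lambda>i u. g i (min u (real m)))"
  shows "ennreal (\<Sum>p\<in>F. ssep.source \<eta> s p *
      (heat units (t - s) (indicator B) (fst p) * heat units (t - s) (indicator B) (snd p)))
    \<le> ennreal (4 * step_bound CARD('n) s ^ (CARD('n) - 1)) * (walk_exp \<tau> z (G_fun k g))\<^sup>2 +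
      of_nat CARD('n) * (ennreal (step_bound CARD('n) s ^ CARD('n)) * walk_exp \<tau> z (G_fun k g) *
        (2 * (walk_exp \<tau> z (G_hat k g) + walk_exp \<tau> z (G_fun k g))))"
proof -
  interpret ssep P by (rule P)
  let ?g = "\<lambda>i u. g i (min u (real m))"
  interpret C: profile_shape k ?g by (rule cut_shape)
  have \<eta>: "{x. \<eta> x} = {x. profile k ?g x}" by (simp add: \<eta>_def)
  interpret D: downset k "{x. \<eta> x}" unfolding \<eta> by (rule C.downset_profile)
  let ?b = "step_bound CARD('n) s" and ?EG = "walk_exp \<tau> z (G_fun k g)" and ?EH = "walk_exp \<tau> z (G_hat k g)"
  have \<tau>0: "0 < \<tau>" using s by (simp add: \<tau>)
  have r: "0 \<le> t - s" "s + (t - s) = t" and s0: "0 \<le> s" using s by auto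
  let ?Q = "csum {x. \<eta> x} (\<lambda>y. ennreal (kint \<tau> (n - y $ k)))"
  have Q: "?Q \<le> ?EG"
    by (rule mass_bound[OF \<tau>0 n]) (auto simp: \<eta>_def intro: cut_subset)
  let ?c = "\<lambda>i. csum UNIV (\<lambda>a. ennreal ((heat units s (indicator {x. \<eta> x}) a - heat units s (indicator {x. \<eta> x}) (a + axis i 1))\<^sup>2 *
      tail ((t - s) / real CARD('n)) (n - a $ k) * tail ((t - s) / real CARD('n)) (n - (a + axis i 1) $ k)))"
  have ck: "?c k \<le> ennreal (4 * ?b ^ (CARD('n) - 1)) * ?EG\<^sup>2"
  proof -
    have "?c k \<le> ennreal (4 * ?b ^ (CARD('n) - 1)) * ?Q\<^sup>2"
    proof (rule D.energy_longitudinal[OF s0 r(1), unfolded r(2), folded \<tau>])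
      show "real_of_int (n - y $ k) \<le> \<tau>" if "y \<in> D.front" for y
        using cut_front[of y m] that m unfolding \<eta> by linarith
    qed (use s in simp)
    also have "\<dots> \<le> ennreal (4 * ?b ^ (CARD('n) - 1)) * ?EG\<^sup>2"
      using Q by (intro mult_left_mono power_mono) auto
    finally show ?thesis .
  qed
  have ci: "?c i \<le> ennreal (?b ^ CARD('n)) * ?EG * (2 * (?EH + ?EG))" if i: "i \<noteq> k" for i
  proof -
    have face: "C.face i (real j) \<le> face i (real j)" for j
      unfolding C.face_def face_def
      by (intro prod_mono conjI add_mono mult_left_mono g_mono add_nonneg_nonneg mult_nonneg_nonneg g_nonneg) auto
    have "?c i \<le> ennreal (?b ^ CARD('n)) * ?Q * csum (bdry {x. \<eta> x} (axis i 1)) (\<lambda>y. ennreal (tail \<tau> (n - y $ k)))"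
      by (rule D.energy_transversal[OF s0 r(1) i, unfolded r(2), folded \<tau>])
    also have "\<dots> \<le> ennreal (?b ^ CARD('n)) * ?EG * (2 * (?EH + ?EG))"
    proof (intro mult_mono mult_left_mono Q bdry_bound[OF \<tau>0 n i])
      show "y $ k \<le> 0" if "y \<in> bdry {x. \<eta> x} (axis i 1)" for y
        using that i C.bdry_top unfolding \<eta> by blast
      show "finite {y \<in> bdry {x. \<eta> x} (axis i 1). y $ k = - int j}" for j
        unfolding \<eta> by (rule C.card_bdry_level(1)[OF i])
      show "real (card {y \<in> bdry {x. \<eta> x} (axis i 1). y $ k = - int j}) \<le> 2 * face i (real j)" for j
        using C.card_bdry_level(2)[OF i, of j] face[of j] unfolding \<eta> by linarith
    qed auto
    finally show ?thesis .
  qed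
  have "ennreal (\<Sum>p\<in>F. source \<eta> s p * (heat units (t - s) (indicator B) (fst p) * heat units (t - s) (indicator B) (snd p)))
      \<le> (\<Sum>i\<in>UNIV. ?c i)"
    by (rule source_sum[OF s0 r(1) F B])
  also have "\<dots> = ?c k + (\<Sum>i\<in>UNIV - {k}. ?c i)" by (rule sum.remove) auto
  also have "\<dots> \<le> ennreal (4 * ?b ^ (CARD('n) - 1)) * ?EG\<^sup>2 +
      of_nat (card (UNIV - {k})) * (ennreal (?b ^ CARD('n)) * ?EG * (2 * (?EH + ?EG)))"
    by (intro add_mono ck sum_bounded_above ci) auto
  also have "\<dots> \<le> ennreal (4 * ?b ^ (CARD('n) - 1)) * ?EG\<^sup>2 +
      of_nat CARD('n) * (ennreal (?b ^ CARD('n)) * ?EG * (2 * (?EH + ?EG)))"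
    by (intro add_mono order_refl mult_right_mono of_nat_mono card_mono) auto
  finally show ?thesis .
qed

text \<open>Integrates \<open>energy_rate\<close> over time through \<open>ncov_energy\<close>. The
  extra E[G] in \<open>bdry_bound\<close> puts D + A, not D alone, next to the transversal rate; its
  share of A is absorbed by \<open>gamma_dim_Suc\<close>.\<close>

lemma near_bound:
  fixes A D :: real and P :: "real \<Rightarrow> 'n config \<Rightarrow> 'n config measure"
  assumes P: "ssep P" and d: "2 \<le> CARD('n)" and t: "3 \<le> t" and \<tau>: "\<tau> = t / real CARD('n)" and n: "n = \<lfloor>z\<rfloor> + 1"
    and m: "real_of_int n + real m \<le> \<tau>"
    and B: "finite B" "\<And>x. x \<in> B \<Longrightarrow> n \<le> x $ k"
    and A: "0 \<le> A" "(walk_exp \<tau> z (G_fun k g))\<^sup>2 = ennreal A"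
    and D: "0 \<le> D" "walk_exp \<tau> z (G_fun k g) * walk_exp \<tau> z (G_hat k g) = ennreal D"
  defines "\<eta> \<equiv> profile k (\<lambda>i u. g i (min u (real m)))"
  shows "(\<Sum>p\<in>B \<times> B \<inter> offdiag. ssep.ncov P \<eta> t p)
    \<le> 32 * real CARD('n) * (16 * real CARD('n)) ^ CARD('n) *
      (gamma_dim CARD('n) t * A + gamma_dim (CARD('n) + 1) t * D)"
proof -
  interpret ssep P by (rule P)
  let ?d = "CARD('n)" and ?K = "16 * real CARD('n)"
  let ?\<psi> = "\<lambda>s. 4 * (?K ^ (?d - 1) * time_rate (?d - 1) s) * A + 2 * real ?d * (?K ^ ?d * time_rate ?d s) * (D + A)"
  let ?\<Gamma> = "\<lambda>s. 4 * (?K ^ (?d - 1) * time_int (?d - 1) s) * A + 2 * real ?d * (?K ^ ?d * time_int ?d s) * (D + A)"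
  have sb: "step_bound ?d s ^ e \<le> ?K ^ e * time_rate e s" if "0 \<le> s" for e s
  proof -
    have "step_bound ?d s = ?K * (1 / sqrt (1 + s))" by (simp add: step_bound_def)
    then have "step_bound ?d s ^ e = ?K ^ e * (1 / sqrt (1 + s)) ^ e" by (simp only: power_mult_distrib)
    also have "\<dots> \<le> ?K ^ e * time_rate e s" by (intro mult_left_mono time_rate_ge that) simp
    finally show ?thesis .
  qed
  have der: "(?\<Gamma> has_real_derivative ?\<psi> s) (at s)" if "0 \<le> s" for s
    by (intro DERIV_add DERIV_cmult_right DERIV_cmult time_int_deriv) (use that d in auto)
  have "(\<Sum>p\<in>B \<times> B \<inter> offdiag. ncov \<eta> t p) \<le> ?\<Gamma> t - ?\<Gamma> 0"
  proof (rule ncov_energy[where \<psi> = ?\<psi>])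
    fix s F assume s: "0 < s" "s < t" and F: "finite F" "F \<subseteq> (offdiag :: ('n site \<times> 'n site) set)"
    let ?b = "step_bound ?d s" and ?EG = "walk_exp \<tau> z (G_fun k g)" and ?EH = "walk_exp \<tau> z (G_hat k g)"
    have b0: "0 \<le> ?b" using s by (intro step_bound_nonneg) simp
    have EE: "?EG * (2 * (?EH + ?EG)) = ennreal (2 * (D + A))"
    proof -
      have "?EG * (2 * (?EH + ?EG)) = 2 * (?EG * ?EH + ?EG\<^sup>2)"
        by (simp add: distrib_left power2_eq_square mult.left_commute)
      also have "\<dots> = ennreal (2 * (D + A))"
        unfolding A D using A(1) D(1) by (subst ennreal_mult) (simp_all add: ennreal_plus)
      finally show ?thesis .
    qed
    have "ennreal (\<Sum>p\<in>F. source \<eta> s p * (heat units (t - s) (indicator B) (fst p) * heat units (t - s) (indicator B) (snd p)))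
      \<le> ennreal (4 * ?b ^ (?d - 1)) * ?EG\<^sup>2 + of_nat ?d * (ennreal (?b ^ ?d) * ?EG * (2 * (?EH + ?EG)))"
      unfolding \<eta>_def by (rule energy_rate[OF ssep_axioms \<tau> n m s F(1) B(2)])
    also have "\<dots> = ennreal (4 * ?b ^ (?d - 1) * A + real ?d * (?b ^ ?d * (2 * (D + A))))"
      unfolding mult.assoc EE A(2) using b0 A(1) D(1)
      by (simp add: ennreal_plus ennreal_mult ennreal_of_nat_eq_real_of_nat mult.assoc)
    finally have "(\<Sum>p\<in>F. source \<eta> s p * (heat units (t - s) (indicator B) (fst p) * heat units (t - s) (indicator B) (snd p)))
      \<le> 4 * ?b ^ (?d - 1) * A + real ?d * (?b ^ ?d * (2 * (D + A)))"
      by (subst (asm) ennreal_le_iff) (use b0 A(1) D(1) in auto)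
    also have "\<dots> \<le> 4 * (?K ^ (?d - 1) * time_rate (?d - 1) s) * A + real ?d * ((?K ^ ?d * time_rate ?d s) * (2 * (D + A)))"
      using s A(1) D(1) by (intro add_mono mult_left_mono mult_right_mono sb) auto
    finally have *: "(\<Sum>p\<in>F. source \<eta> s p * (heat units (t - s) (indicator B) (fst p) * heat units (t - s) (indicator B) (snd p)))
      \<le> 4 * (?K ^ (?d - 1) * time_rate (?d - 1) s) * A + real ?d * ((?K ^ ?d * time_rate ?d s) * (2 * (D + A)))" .
    show "(\<Sum>p\<in>F. source \<eta> s p * (heat units (t - s) (indicator B) (fst p) * heat units (t - s) (indicator B) (snd p))) \<le> ?\<psi> s"
    proof -
      have "x * (y * (2 * F)) = 2 * x * y * F" for x y F :: real by simp
      then show ?thesis using * by (simp only:)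
    qed
  next
    show "continuous_on {0..t} ?\<Gamma>"
      by (rule DERIV_continuous_on[OF has_field_derivative_at_within[OF der]]) auto
  qed (use t B der in auto)
  also have "?\<Gamma> t - ?\<Gamma> 0 = 4 * (?K ^ (?d - 1) * (time_int (?d - 1) t - time_int (?d - 1) 0)) * A +
      2 * real ?d * (?K ^ ?d * (time_int ?d t - time_int ?d 0)) * (D + A)"
  proof -
    have "4 * (a * x) * A' + c * (b * y) * F - (4 * (a * x0) * A' + c * (b * y0) * F)
        = 4 * (a * (x - x0)) * A' + c * (b * (y - y0)) * F" for a x x0 A' b c y y0 F :: real
      by (simp add: algebra_simps)
    then show ?thesis .
  qed
  also have "\<dots> \<le> 4 * (?K ^ ?d * (4 * gamma_dim ?d t)) * A + 2 * real ?d * (?K ^ ?d * (4 * gamma_dim (?d + 1) t)) * (D + A)"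
  proof (intro add_mono mult_left_mono mult_right_mono mult_mono)
    show "time_int (?d - 1) t - time_int (?d - 1) 0 \<le> 4 * gamma_dim ?d t"
      using time_int_le[OF t, of "?d - 1"] d by simp
    show "time_int ?d t - time_int ?d 0 \<le> 4 * gamma_dim (?d + 1) t"
      using time_int_le[OF t, of ?d] d by simp
    show "?K ^ (?d - 1) \<le> ?K ^ ?d" using d by (intro power_increasing) auto
    \<comment> \<open>Nonnegativity of this increment is required before its coefficient is enlarged
      to the power d.\<close>
    have "time_int (?d - 1) 0 \<le> time_int (?d - 1) t"
    proof (rule DERIV_nonneg_imp_nondecreasing[where f = "time_int (?d - 1)"])
      fix x :: real assume x: "0 \<le> x"
      have "0 \<le> time_rate (?d - 1) x" using x by (simp add: time_rate_def)
      moreover have "(time_int (?d - 1) has_real_derivative time_rate (?d - 1) x) (at x)"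
        using x d by (intro time_int_deriv) auto
      ultimately show "\<exists>y. (time_int (?d - 1) has_real_derivative y) (at x) \<and> 0 \<le> y" by blast
    qed (use t in simp)
    then show "0 \<le> time_int (?d - 1) t - time_int (?d - 1) 0" by simp
  qed (use A(1) D(1) gamma_dim_ge_1[OF t, of "?d + 1"] in auto)
  also have "\<dots> \<le> 32 * real ?d * ?K ^ ?d * (gamma_dim ?d t * A + gamma_dim (?d + 1) t * D)"
  proof -
    let ?g = "gamma_dim ?d t" and ?g' = "gamma_dim (?d + 1) t" and ?N = "real ?d"
    have gg: "?g' * A \<le> 2 * ?g * A" "0 \<le> ?g * A" "0 \<le> ?g' * D"
      using gamma_dim_Suc[OF t d] gamma_dim_ge_1[OF t, of ?d] gamma_dim_ge_1[OF t, of "?d + 1"] A(1) D(1)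
      by (auto intro: mult_right_mono)
    have N: "1 \<le> ?N" using d by simp
    have 1: "4 * (K * (4 * h)) * A' + 2 * N * (K * (4 * h')) * (D' + A') =
        K * (16 * (h * A') + 8 * N * (h' * D' + h' * A'))" for K h h' A' N D' :: real
      by (simp add: algebra_simps)
    have 2: "32 * N * K * x = K * (32 * N * x)" for K N x :: real by simp
    \<comment> \<open>Origin of the 32: the longitudinal part gives 4 * 4 = 16, the transversal part
      gives 8 and doubles to 16 by \<open>gamma_dim_Suc\<close>.\<close>
    have "16 * (?g * A) + 8 * ?N * (?g' * D + ?g' * A) \<le> 16 * ?N * (?g * A) + 8 * ?N * (?g' * D + 2 * ?g * A)"
    proof (rule add_mono)
      show "16 * (?g * A) \<le> 16 * ?N * (?g * A)" using mult_right_mono[OF N gg(2)] by simp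
      show "8 * ?N * (?g' * D + ?g' * A) \<le> 8 * ?N * (?g' * D + 2 * ?g * A)"
        by (rule mult_left_mono) (use gg N in auto)
    qed
    also have "\<dots> = ?N * (32 * (?g * A) + 8 * (?g' * D))"
      by (simp add: distrib_left)
    also have "\<dots> \<le> ?N * (32 * (?g * A) + 32 * (?g' * D))"
      by (rule mult_left_mono) (use gg N in \<open>auto simp: mult.commute\<close>)
    also have "\<dots> = 32 * ?N * (?g * A + ?g' * D)" by (simp add: distrib_left)
    finally show ?thesis
      unfolding 1 2 by (rule mult_left_mono) simp
  qed
  finally show ?thesis .
qed

text \<open>For particles at distance at least \<tau>, \<open>tail_far\<close> bounds the expected
  number above z by 2 E[G]; \<open>ncov_mass\<close> squares this.\<close>

lemma far_bound:
  fixes A :: real and P :: "real \<Rightarrow> 'n config \<Rightarrow> 'n config measure"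
  assumes P: "ssep P" and t: "0 < t" and \<tau>: "\<tau> = t / real CARD('n)" and n: "n = \<lfloor>z\<rfloor> + 1"
    and sub: "\<And>x. \<eta> x \<Longrightarrow> profile k g x" and far: "\<And>x. \<eta> x \<Longrightarrow> \<tau> \<le> real_of_int (n - x $ k)"
    and B: "finite B" "\<And>x. x \<in> B \<Longrightarrow> n \<le> x $ k"
    and A: "0 \<le> A" "(walk_exp \<tau> z (G_fun k g))\<^sup>2 = ennreal A"
  shows "(\<Sum>p\<in>B \<times> B \<inter> offdiag. ssep.ncov P \<eta> t p) \<le> 4 * A"
proof -
  interpret ssep P by (rule P)
  have \<tau>0: "0 < \<tau>" using t by (simp add: \<tau>)
  have "csum {x. \<eta> x} (\<lambda>y. ennreal (tail \<tau> (n - y $ k))) \<le> csum {x. \<eta> x} (\<lambda>y. 2 * ennreal (kint \<tau> (n - y $ k)))"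
  proof (rule nn_integral_mono)
    fix y assume "y \<in> space (count_space {x. \<eta> x})"
    then have "tail \<tau> (n - y $ k) \<le> 2 * kint \<tau> (n - y $ k)" using tail_far[OF \<tau>0 far] by simp
    then have "ennreal (tail \<tau> (n - y $ k)) \<le> ennreal (2 * kint \<tau> (n - y $ k))" by (rule ennreal_leI)
    also have "\<dots> = 2 * ennreal (kint \<tau> (n - y $ k))" by (simp add: ennreal_mult')
    finally show "ennreal (tail \<tau> (n - y $ k)) \<le> 2 * ennreal (kint \<tau> (n - y $ k))" .
  qed
  also have "\<dots> = 2 * csum {x. \<eta> x} (\<lambda>y. ennreal (kint \<tau> (n - y $ k)))" by (rule nn_integral_cmult) simp
  also have "\<dots> \<le> 2 * walk_exp \<tau> z (G_fun k g)"
    by (intro mult_left_mono mass_bound[OF \<tau>0 n]) (auto intro: sub)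
  finally have le: "csum {x. \<eta> x} (\<lambda>y. ennreal (tail \<tau> (n - y $ k))) \<le> 2 * walk_exp \<tau> z (G_fun k g)" .
  have "ennreal (\<Sum>p\<in>B \<times> B \<inter> offdiag. ncov \<eta> t p) \<le> (csum {x. \<eta> x} (\<lambda>y. ennreal (tail \<tau> (n - y $ k))))\<^sup>2"
    unfolding \<tau> using t by (intro ncov_mass B) auto
  also have "\<dots> \<le> (2 * walk_exp \<tau> z (G_fun k g))\<^sup>2" by (intro power_mono le) auto
  also have "\<dots> = ennreal (4 * A)"
    using A by (simp add: power_mult_distrib ennreal_mult)
  finally show ?thesis using A(1) by (subst (asm) ennreal_le_iff) auto
qed

lemma total_bound:
  fixes A D :: real and P :: "real \<Rightarrow> 'n config \<Rightarrow> 'n config measure"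
  assumes P: "ssep P" and d: "2 \<le> CARD('n)" and t: "3 \<le> t" and \<tau>: "\<tau> = t / real CARD('n)" and n: "n = \<lfloor>z\<rfloor> + 1"
    and B: "finite B" "\<And>x. x \<in> B \<Longrightarrow> n \<le> x $ k"
    and A: "0 \<le> A" "(walk_exp \<tau> z (G_fun k g))\<^sup>2 = ennreal A"
    and D: "0 \<le> D" "walk_exp \<tau> z (G_fun k g) * walk_exp \<tau> z (G_hat k g) = ennreal D"
  shows "(\<Sum>p\<in>B \<times> B \<inter> offdiag. ssep.ncov P (profile k g) t p)
    \<le> (64 * real CARD('n) * (16 * real CARD('n)) ^ CARD('n) + 8) *
      (gamma_dim CARD('n) t * A + gamma_dim (CARD('n) + 1) t * D)"
proof -
  interpret ssep P by (rule P)
  let ?T = "gamma_dim CARD('n) t * A + gamma_dim (CARD('n) + 1) t * D"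
  let ?C = "32 * real CARD('n) * (16 * real CARD('n)) ^ CARD('n)"
  have AT: "A \<le> ?T"
  proof -
    have "1 * A \<le> gamma_dim CARD('n) t * A" by (intro mult_right_mono gamma_dim_ge_1 t A)
    moreover have "0 \<le> gamma_dim (CARD('n) + 1) t * D"
      using gamma_dim_ge_1[OF t, of "CARD('n) + 1"] D(1) by simp
    ultimately show ?thesis by simp
  qed
  have C2: "2 * ?C + 8 = 64 * real CARD('n) * (16 * real CARD('n)) ^ CARD('n) + 8" by simp
  have T0: "0 \<le> ?T" using AT A(1) by linarith
  have tpos: "0 < t" using t by simp
  show ?thesis
  proof (cases "real_of_int n \<le> \<tau>")
    case False
    \<comment> \<open>The profile lies at levels at most 0, so n > \<tau> makes every particle far
      and no cut is made.\<close>
    have "(\<Sum>p\<in>B \<times> B \<inter> offdiag. ncov (profile k g) t p) \<le> 4 * A"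
    proof (rule far_bound[OF ssep_axioms tpos \<tau> n _ _ B A])
      show "\<tau> \<le> real_of_int (n - x $ k)" if "profile k g x" for x
        using that False by (simp add: profile_def)
    qed
    also have "4 * A \<le> 8 * ?T" using AT A(1) by (intro mult_mono) auto
    also have "\<dots> \<le> (2 * ?C + 8) * ?T" using T0 by (intro mult_right_mono) auto
    finally show ?thesis by (simp only: C2)
  next
    case True
    \<comment> \<open>The largest m with n + m \<le> \<tau>: the lines of the truncated profile end
      near n, while removed sites have depth at least m + 1 and hence distance more than
      \<tau>.\<close>
    define m where "m = nat \<lfloor>\<tau> - real_of_int n\<rfloor>"
    have m0: "0 \<le> \<lfloor>\<tau> - real_of_int n\<rfloor>" using True by (simp add: le_floor_iff)
    have m1: "real_of_int n + real m \<le> \<tau>" "\<tau> < real_of_int n + real m + 1"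
      unfolding m_def using m0 by (simp_all add: of_nat_nat)
    define \<eta>1 where "\<eta>1 = profile k (\<lambda>i u. g i (min u (real m)))"
    define \<eta>2 where "\<eta>2 x \<longleftrightarrow> profile k g x \<and> \<not> \<eta>1 x" for x
    have near: "(\<Sum>p\<in>B \<times> B \<inter> offdiag. ncov \<eta>1 t p) \<le> ?C * ?T"
      unfolding \<eta>1_def by (rule near_bound[OF ssep_axioms d t \<tau> n m1(1) B A D])
    have far: "(\<Sum>p\<in>B \<times> B \<inter> offdiag. ncov \<eta>2 t p) \<le> 4 * A"
    proof (rule far_bound[OF ssep_axioms tpos \<tau> n _ _ B A])
      show "\<tau> \<le> real_of_int (n - x $ k)" if "\<eta>2 x" for x
        using cut_far[of x m] that m1(2) unfolding \<eta>2_def \<eta>1_def by linarith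
    qed (simp add: \<eta>2_def)
    have "(\<Sum>p\<in>B \<times> B \<inter> offdiag. ncov (profile k g) t p) \<le> (\<Sum>p\<in>B \<times> B \<inter> offdiag. 2 * ncov \<eta>1 t p + 2 * ncov \<eta>2 t p)"
      using t cut_subset by (intro sum_mono ncov_split) (auto simp: \<eta>2_def \<eta>1_def)
    also have "\<dots> = 2 * (\<Sum>p\<in>B \<times> B \<inter> offdiag. ncov \<eta>1 t p) + 2 * (\<Sum>p\<in>B \<times> B \<inter> offdiag. ncov \<eta>2 t p)"
      by (simp add: sum.distrib sum_distrib_left)
    also have "\<dots> \<le> 2 * (?C * ?T) + 2 * (4 * ?T)"
      by (intro add_mono mult_left_mono near order_trans[OF far] AT) auto
    also have "\<dots> = (2 * ?C + 8) * ?T" by (simp only: distrib_right mult.assoc)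
    finally show ?thesis by (simp only: C2)
  qed
qed

end

theorem proposition4p6:
  fixes k :: "'n::finite" and g :: "'n \<Rightarrow> real \<Rightarrow> real"
  assumes "2 \<le> CARD('n)"
    and "\<And>i u. i \<noteq> k \<Longrightarrow> 0 \<le> u \<Longrightarrow> 0 \<le> g i u"
    and "\<And>i. i \<noteq> k \<Longrightarrow> condition_A (g i)"
    and "\<And>i. i \<noteq> k \<Longrightarrow> condition_B (g i)"
  shows "\<exists>C::real. 0 < C \<and>
    (\<forall>\<^sub>F t in at_top. \<forall>(M :: 'w measure) X. ssep_process M X (profile k g) \<longrightarrow>
       (\<forall>z::real.
          cov_sum k M X t z \<le>
            enn2ereal (ennreal C *
              (ennreal (gamma_dim CARD('n) t) *
                 (walk_exp (t / real CARD('n)) z (G_fun k g)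
                   + walk_exp (t / real CARD('n)) z (hderiv (G_fun k g)))\<^sup>2
               + ennreal (gamma_dim (CARD('n) + 1) t) *
                   walk_exp (t / real CARD('n)) z (G_fun k g) *
                   walk_exp (t / real CARD('n)) z (G_hat k g)))))"
proof -
  interpret profile_shape k g
  proof
    fix i u v assume i: "i \<noteq> k"
    show "g i u \<le> g i v" if "0 \<le> u" "u \<le> v"
      using assms(3)[OF i] that by (auto simp: condition_A_def intro: mono_onD)
    show "continuous_on {0..} (g i)"
      using assms(4)[OF i] by (auto simp: condition_B_def intro: differentiable_imp_continuous_on)
  qed (rule assms(2))
  \<comment> \<open>Twice the near constant plus twice the far constant 4, the factors 2 being those
    of \<open>ncov_split\<close>. It depends on the dimension alone.\<close>
  define C where "C = 64 * real CARD('n) * (16 * real CARD('n)) ^ CARD('n) + 8"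
  have C0: "0 < C" by (auto simp: C_def intro!: add_nonneg_pos)
  have main: "cov_sum k M X t z \<le> enn2ereal (ennreal C *
      (ennreal (gamma_dim CARD('n) t) *
         (walk_exp (t / real CARD('n)) z (G_fun k g) + walk_exp (t / real CARD('n)) z (hderiv (G_fun k g)))\<^sup>2
       + ennreal (gamma_dim (CARD('n) + 1) t) * walk_exp (t / real CARD('n)) z (G_fun k g) *
           walk_exp (t / real CARD('n)) z (G_hat k g)))"
    if t: "3 \<le> t" and X: "ssep_process M X (profile k g)" for t z and M :: "'w measure" and X
  proof -
    let ?\<tau> = "t / real CARD('n)"
    let ?EG = "walk_exp ?\<tau> z (G_fun k g)" and ?EH = "walk_exp ?\<tau> z (G_hat k g)"
    let ?g = "gamma_dim CARD('n) t" and ?g' = "gamma_dim (CARD('n) + 1) t"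
    let ?T = "ennreal ?g * ?EG\<^sup>2 + ennreal ?g' * ?EG * ?EH"
    have g1: "1 \<le> ?g" "1 \<le> ?g'" using t by (auto intro: gamma_dim_ge_1)
    have "cov_sum k M X t z \<le> enn2ereal (ennreal C * ?T)"
    proof (cases "?T = \<top>")
      case True
      have "ennreal C * ?T = \<top>" unfolding True using C0 by (simp add: ennreal_mult_top)
      then show ?thesis by (simp only: top_ennreal.rep_eq) (simp add: top_ereal_def)
    next
      case False
      \<comment> \<open>Both rates are at least 1 for t \<ge> 3, so finiteness of the sum passes to
        the two products of expectations.\<close>
      then have "?EG\<^sup>2 \<noteq> \<top>" "?EG * ?EH \<noteq> \<top>"
        using g1 by (auto simp: ennreal_mult_eq_top_iff mult.assoc)
      then obtain A D where A: "0 \<le> A" "?EG\<^sup>2 = ennreal A" and D: "0 \<le> D" "?EG * ?EH = ennreal D"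
        by (metis ennreal_cases)
      obtain P where P: "ssep_transition P" and law: "\<And>t. 0 \<le> t \<Longrightarrow> distr M borel (X t) = P t (profile k g)"
        using ssep_process_law[OF X] by blast
      interpret ssep P by unfold_locales (rule P)
      have "cov_sum k M X t z \<le> ereal (C * (?g * A + ?g' * D))"
      proof (rule cov_sum_le)
        show "covariance M (\<lambda>\<omega>. of_bool (X t \<omega> x)) (\<lambda>\<omega>. of_bool (X t \<omega> y)) = - ncov (profile k g) t (x, y)" for x y
          using X t by (intro covariance_ncov law) (auto simp: ssep_process_def)
        show "(\<Sum>p\<in>B \<times> B \<inter> offdiag. ncov (profile k g) t p) \<le> C * (?g * A + ?g' * D)"
          if "finite B" "\<And>x. x \<in> B \<Longrightarrow> z < real_of_int (x $ k)" for B
          unfolding C_def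
        proof (rule total_bound[OF ssep_axioms assms(1) t refl refl that(1) _ A D])
          show "\<lfloor>z\<rfloor> + 1 \<le> x $ k" if "x \<in> B" for x
          proof -
            have "\<lfloor>z\<rfloor> < x $ k"
              using \<open>\<And>x. x \<in> B \<Longrightarrow> z < real_of_int (x $ k)\<close>[OF that] by (simp add: floor_less_iff)
            then show ?thesis by simp
          qed
        qed
      qed (use t in simp)
      also have "ereal (C * (?g * A + ?g' * D)) = enn2ereal (ennreal C * ?T)"
      proof -
        have "ennreal C * ?T = ennreal (C * (?g * A + ?g' * D))"
          unfolding mult.assoc A D using A(1) D(1) g1 C0
          by (simp add: ennreal_plus ennreal_mult)
        then show ?thesis using A(1) D(1) g1 C0 by (simp add: enn2ereal_ennreal)
      qed
      finally show ?thesis .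
    qed
    also have "\<dots> \<le> enn2ereal (ennreal C *
      (ennreal ?g * (?EG + walk_exp ?\<tau> z (hderiv (G_fun k g)))\<^sup>2 + ennreal ?g' * ?EG * ?EH))"
      unfolding less_eq_ennreal.rep_eq[symmetric]
      by (intro mult_left_mono add_mono power_mono order_refl) auto
    finally show ?thesis .
  qed
  show ?thesis
    by (intro exI[of _ C] conjI C0 eventually_mono[OF eventually_ge_at_top[of 3]] allI impI main)
qed

end
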